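(* Let $\Omega=\Omega_1\times\Omega_2\times\cdots\times\Omega_k\subset\mathbb{R}^n$ with $2\le k\le n$, where each $\Omega_i$ is a domain in $\mathbb{R}^{m_i}$, $1\le m_i\le n-1$, $\sum_i m_i=n$. Let $\mathcal{S}$ be a basis of shapes in $\Omega$ and $\mathcal{S}_i$ a basis of shapes in $\Omega_i$, $1\le i\le k$, and let $1\le p<\infty$. (a) If $\mathcal{S}$ satisfies the weak decomposition property with respect to $\{\mathcal{S}_i\}_{i=1}^k$ and $f\in\bigcap_{i=1}^k \mathrm{BMO}^p_{\mathcal{S}_i}(\Omega)$, then $f\in\mathrm{BMO}^p_{\mathcal{S}}(\Omega)$ and $$\|f\|_{\mathrm{BMO}^p_{\mathcal{S}}(\Omega)}\le\sum_{i=1}^k\|f\|_{\mathrm{BMO}^p_{\mathcal{S}_i}(\Omega)}.$$ (b) If $\mathcal{S}$ satisfies the strong decomposition property with respect to $\{\mathcal{S}_i\}_{i=1}^k$, each $\mathcal{S}_i$ contains a differentiation basis that differentiates $L^1_{loc}(\Omega_i)$, and $f\in\mathrm{BMO}^p_{\mathcal{S}}(\Omega)$, then $f\in\bigcap_{i=1}^k\mathrm{BMO}^p_{\mathcal{S}_i}(\Omega)$ and $$\max_{1\le i\le k}\|f\|_{\mathrm{BMO}^p_{\mathcal{S}_i}(\Omega)}\le 2^{k-1}\|f\|_{\mathrm{BMO}^p_{\mathcal{S}}(\Omega)};$$ when $p=2$ the constant $2^{k-1}$ can be replaced by $1$.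
   Context: A domain is an open connected set. A shape in $\mathbb{R}^m$ is an open set $S$ with $0<|S|<\infty$ (Lebesgue measure). A basis of shapes in a domain $D$ is a collection of shapes contained in $D$ that covers $D$. For $f\in L^1(S)$, $f_S=\frac{1}{|S|}\int_S f$. For a basis $\mathcal{S}$ in $D$ and $1\le p<\infty$, $\mathrm{BMO}^p_{\mathcal{S}}(D)$ is the space of functions $f$ with $f\in L^1(S)$ for all $S\in\mathcal{S}$ such that $\big(\frac{1}{|S|}\int_S|f-f_S|^p\big)^{1/p}\le K$ for all $S\in\mathcal{S}$, and $\|f\|_{\mathrm{BMO}^p_{\mathcal{S}}(D)}$ is the infimum of such $K$. $\mathcal{S}$ satisfies the weak decomposition property with respect to $\{\mathcal{S}_i\}$ if every $S\in\mathcal{S}$ can be written $S=S_1\times\cdots\times S_k$ with $S_i\in\mathcal{S}_i$; it satisfies the strong decomposition property if in addition every product $S_1\times\cdots\times S_k$ with $S_i\in\mathcal{S}_i$ belongs to $\mathcal{S}$. For $i$ fixed, write points of $\Omega$ as $(x,y)$ with $x\in\Omega_i$ and $y$ the remaining coordinates, in $\tilde\Omega_i=\prod_{j\ne i}\Omega_j$, and $f_y(x)=f(x,y)$. Then $\mathrm{BMO}^p_{\mathcal{S}_i}(\Omega)$ is the set of $f\in L^1_{loc}(\Omega)$ with $\|f\|_{\mathrm{BMO}^p_{\mathcal{S}_i}(\Omega)}:=\sup_{y\in\tilde\Omega_i}\|f_y\|_{\mathrm{BMO}^p_{\mathcal{S}_i}(\Omega_i)}<\infty$. For a basis $\mathcal{S}$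 in $D$ and $x\in D$, $\mathcal{S}(x)$ denotes the shapes containing $x$. $\mathcal{S}$ is a differentiation basis if for each $x\in D$ there are $S_k\in\mathcal{S}(x)$ with Euclidean diameter $\delta(S_k)\to0$. It differentiates $L^1_{loc}(D)$ if for every $f\in L^1_{loc}(D)$ and a.e. $x\in D$, the upper derivative $\sup\{\limsup_k \frac{1}{|S_k|}\int_{S_k}f : S_k\in\mathcal{S}(x),\ \delta(S_k)\to0\}$ and lower derivative $\inf\{\liminf_k\frac{1}{|S_k|}\int_{S_k}f: S_k\in\mathcal{S}(x),\ \delta(S_k)\to0\}$ both equal $f(x)$.
   Formalization: The supremum over y in the norm of BMO^p_{S_i}(Ω) is taken as an essential supremum: with the literal supremum, part (b) fails when f is changed on a null set {y0}×Ω_i so that its slice there is not in BMO. *)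

theory Defs
  imports "HOL-Analysis.Analysis"
begin

text \<open>Points of R^I (I a finite index set of coordinates) are represented as
  extensional functions nat => real on I (undefined outside I), as in the
  library's product topology and product measure.\<close>

type_synonym pt = "nat \<Rightarrow> real"

definition Rtop :: "nat set \<Rightarrow> pt topology" where
  "Rtop I = product_topology (\<lambda>_. euclideanreal) I"

definition leb :: "nat set \<Rightarrow> pt measure" where
  "leb I = completion (PiM I (\<lambda>_. lborel))"

definition is_domain :: "nat set \<Rightarrow> pt set \<Rightarrow> bool" where
  "is_domain I D \<longleftrightarrow> openin (Rtop I) D \<and> connectedin (Rtop I) D \<and> D \<noteq> {}"

definition is_shape :: "nat set \<Rightarrow> pt set \<Rightarrow> bool" where
  "is_shape I S \<longleftrightarrow> openin (Rtop I) S \<and> 0 < emeasure (leb I) S \<and> emeasure (leb I) S < \<infinity>"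

definition shape_basis :: "nat set \<Rightarrow> pt set \<Rightarrow> pt set set \<Rightarrow> bool" where
  "shape_basis I D \<S> \<longleftrightarrow> (\<forall>S\<in>\<S>. is_shape I S \<and> S \<subseteq> D) \<and> \<Union>\<S> = D"

definition avg :: "nat set \<Rightarrow> pt set \<Rightarrow> (pt \<Rightarrow> real) \<Rightarrow> real" where
  "avg I S f = (LINT x:S|leb I. f x) / measure (leb I) S"

definition mean_osc :: "nat set \<Rightarrow> real \<Rightarrow> pt set \<Rightarrow> (pt \<Rightarrow> real) \<Rightarrow> ennreal" where
  "mean_osc I p S f =
     (\<integral>\<^sup>+x\<in>S. ennreal (\<bar>f x - avg I S f\<bar> powr p) \<partial>leb I) / emeasure (leb I) S"

definition bmo_bound :: "nat set \<Rightarrow> real \<Rightarrow> pt set set \<Rightarrow> (pt \<Rightarrow> real) \<Rightarrow> real \<Rightarrow> bool" where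
  "bmo_bound I p \<S> f K \<longleftrightarrow>
     (\<forall>S\<in>\<S>. set_integrable (leb I) S f \<and> mean_osc I p S f < \<infinity> \<and>
              (enn2real (mean_osc I p S f)) powr (1/p) \<le> K)"

definition in_BMO :: "nat set \<Rightarrow> real \<Rightarrow> pt set set \<Rightarrow> (pt \<Rightarrow> real) \<Rightarrow> bool" where
  "in_BMO I p \<S> f \<longleftrightarrow> (\<exists>K. bmo_bound I p \<S> f K)"

definition BMO_norm :: "nat set \<Rightarrow> real \<Rightarrow> pt set set \<Rightarrow> (pt \<Rightarrow> real) \<Rightarrow> real" where
  "BMO_norm I p \<S> f = Inf {K. bmo_bound I p \<S> f K}"

definition blk :: "(nat \<Rightarrow> nat) \<Rightarrow> nat \<Rightarrow> nat set" where
  "blk m i = {sum m {..<i} ..< sum m {..<i} + m i}"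

definition prod_set :: "nat \<Rightarrow> (nat \<Rightarrow> nat) \<Rightarrow> nat \<Rightarrow> (nat \<Rightarrow> pt set) \<Rightarrow> pt set" where
  "prod_set n m k A = {x \<in> PiE {..<n} (\<lambda>_. UNIV). \<forall>i<k. restrict x (blk m i) \<in> A i}"

definition weak_decomp ::
  "nat \<Rightarrow> (nat \<Rightarrow> nat) \<Rightarrow> nat \<Rightarrow> pt set set \<Rightarrow> (nat \<Rightarrow> pt set set) \<Rightarrow> bool" where
  "weak_decomp n m k \<S> \<S>i \<longleftrightarrow>
     (\<forall>S\<in>\<S>. \<exists>A. (\<forall>i<k. A i \<in> \<S>i i) \<and> S = prod_set n m k A)"

definition strong_decomp ::
  "nat \<Rightarrow> (nat \<Rightarrow> nat) \<Rightarrow> nat \<Rightarrow> pt set set \<Rightarrow> (nat \<Rightarrow> pt set set) \<Rightarrow> bool" where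
  "strong_decomp n m k \<S> \<S>i \<longleftrightarrow> weak_decomp n m k \<S> \<S>i \<and>
     (\<forall>A. (\<forall>i<k. A i \<in> \<S>i i) \<longrightarrow> prod_set n m k A \<in> \<S>)"

definition co_idx :: "nat \<Rightarrow> (nat \<Rightarrow> nat) \<Rightarrow> nat \<Rightarrow> nat set" where
  "co_idx n m i = {..<n} - blk m i"

definition co_dom :: "nat \<Rightarrow> (nat \<Rightarrow> nat) \<Rightarrow> nat \<Rightarrow> (nat \<Rightarrow> pt set) \<Rightarrow> nat \<Rightarrow> pt set" where
  "co_dom n m k \<Omega> i = {y \<in> PiE (co_idx n m i) (\<lambda>_. UNIV).
      \<forall>j<k. j \<noteq> i \<longrightarrow> restrict y (blk m j) \<in> \<Omega> j}"

definition join :: "nat set \<Rightarrow> pt \<Rightarrow> pt \<Rightarrow> pt" where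
  "join A x y = (\<lambda>c. if c \<in> A then x c else y c)"

definition slice :: "(nat \<Rightarrow> nat) \<Rightarrow> nat \<Rightarrow> (pt \<Rightarrow> real) \<Rightarrow> pt \<Rightarrow> pt \<Rightarrow> real" where
  "slice m i f y = (\<lambda>x. f (join (blk m i) x y))"

definition loc_int :: "nat set \<Rightarrow> pt set \<Rightarrow> (pt \<Rightarrow> real) \<Rightarrow> bool" where
  "loc_int I D f \<longleftrightarrow> (\<forall>K. compactin (Rtop I) K \<and> K \<subseteq> D \<longrightarrow> set_integrable (leb I) K f)"

definition ess_sup_on :: "pt measure \<Rightarrow> pt set \<Rightarrow> (pt \<Rightarrow> ereal) \<Rightarrow> ereal" where
  "ess_sup_on M A g = Inf {z. AE y in M. y \<in> A \<longrightarrow> g y \<le> z}"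

definition slice_norm ::
  "(nat \<Rightarrow> nat) \<Rightarrow> real \<Rightarrow> (nat \<Rightarrow> pt set set) \<Rightarrow> nat \<Rightarrow> (pt \<Rightarrow> real) \<Rightarrow> pt \<Rightarrow> ereal" where
  "slice_norm m p \<S>i i f y =
     (if in_BMO (blk m i) p (\<S>i i) (slice m i f y)
      then ereal (BMO_norm (blk m i) p (\<S>i i) (slice m i f y)) else \<infinity>)"

definition dir_ess_sup ::
  "nat \<Rightarrow> (nat \<Rightarrow> nat) \<Rightarrow> nat \<Rightarrow> (nat \<Rightarrow> pt set) \<Rightarrow> real \<Rightarrow> (nat \<Rightarrow> pt set set) \<Rightarrow> nat
   \<Rightarrow> (pt \<Rightarrow> real) \<Rightarrow> ereal" where
  "dir_ess_sup n m k \<Omega> p \<S>i i f =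
     ess_sup_on (leb (co_idx n m i)) (co_dom n m k \<Omega> i) (slice_norm m p \<S>i i f)"

definition in_BMO_dir ::
  "nat \<Rightarrow> (nat \<Rightarrow> nat) \<Rightarrow> nat \<Rightarrow> (nat \<Rightarrow> pt set) \<Rightarrow> real \<Rightarrow> (nat \<Rightarrow> pt set set) \<Rightarrow> nat
   \<Rightarrow> (pt \<Rightarrow> real) \<Rightarrow> bool" where
  "in_BMO_dir n m k \<Omega> p \<S>i i f \<longleftrightarrow>
     loc_int {..<n} (prod_set n m k \<Omega>) f \<and> dir_ess_sup n m k \<Omega> p \<S>i i f < \<infinity>"

definition BMO_dir_norm ::
  "nat \<Rightarrow> (nat \<Rightarrow> nat) \<Rightarrow> nat \<Rightarrow> (nat \<Rightarrow> pt set) \<Rightarrow> real \<Rightarrow> (nat \<Rightarrow> pt set set) \<Rightarrow> nat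
   \<Rightarrow> (pt \<Rightarrow> real) \<Rightarrow> real" where
  "BMO_dir_norm n m k \<Omega> p \<S>i i f = real_of_ereal (dir_ess_sup n m k \<Omega> p \<S>i i f)"

definition edist :: "nat set \<Rightarrow> pt \<Rightarrow> pt \<Rightarrow> real" where
  "edist I x y = sqrt (\<Sum>c\<in>I. (x c - y c)\<^sup>2)"

definition ediam :: "nat set \<Rightarrow> pt set \<Rightarrow> ereal" where
  "ediam I S = (SUP x\<in>S. SUP y\<in>S. ereal (edist I x y))"

definition shrinking_seqs :: "nat set \<Rightarrow> pt set set \<Rightarrow> pt \<Rightarrow> (nat \<Rightarrow> pt set) set" where
  "shrinking_seqs I \<S> x =
     {Sk. (\<forall>j. Sk j \<in> \<S> \<and> x \<in> Sk j) \<and> (\<lambda>j. ediam I (Sk j)) \<longlonglongrightarrow> 0}"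

definition diff_basis :: "nat set \<Rightarrow> pt set \<Rightarrow> pt set set \<Rightarrow> bool" where
  "diff_basis I D \<S> \<longleftrightarrow> shape_basis I D \<S> \<and> (\<forall>x\<in>D. shrinking_seqs I \<S> x \<noteq> {})"

definition upper_deriv :: "nat set \<Rightarrow> pt set set \<Rightarrow> (pt \<Rightarrow> real) \<Rightarrow> pt \<Rightarrow> ereal" where
  "upper_deriv I \<S> f x =
     (SUP Sk\<in>shrinking_seqs I \<S> x. limsup (\<lambda>j. ereal (avg I (Sk j) f)))"

definition lower_deriv :: "nat set \<Rightarrow> pt set set \<Rightarrow> (pt \<Rightarrow> real) \<Rightarrow> pt \<Rightarrow> ereal" where
  "lower_deriv I \<S> f x =
     (INF Sk\<in>shrinking_seqs I \<S> x. liminf (\<lambda>j. ereal (avg I (Sk j) f)))"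

definition differentiates :: "nat set \<Rightarrow> pt set \<Rightarrow> pt set set \<Rightarrow> bool" where
  "differentiates I D \<S> \<longleftrightarrow>
     (\<forall>f. loc_int I D f \<longrightarrow>
        (AE x in leb I. x \<in> D \<longrightarrow>
           upper_deriv I \<S> f x = ereal (f x) \<and> lower_deriv I \<S> f x = ereal (f x)))"

end

theory Submission
  imports Defs "HOL-Probability.Infinite_Product_Measure"
begin

text \<open>Lebesgue measure on the whole space is the image of the product of the Lebesgue measures of the
  blocks, and \<open>f\<close> may be replaced by a Borel function, so everything happens on a finite product.

  (a) On a product of two probability spaces write \<open>f - c = (f - a) + (a - c)\<close>, where \<open>a\<close> is the mean
  of \<open>f\<close> in the first variable. The first summand is controlled by the oscillation in the first
  variable, the second one, by Jensen, by the oscillation in the second variable. Induct on the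
  number of factors.

  (b) Fix a finite union \<open>E\<close> of rational boxes inside a shape \<open>S\<close> of the \<open>i\<close>-th factor. The
  unnormalised oscillation over \<open>E\<close> of the \<open>i\<close>-th sections is at most \<open>Q\<^sup>p\<close> times the integral over \<open>S\<close>
  of the \<open>p\<close>-th power of the distance to any constant (\<open>Q = 2\<close>, or \<open>Q = 1\<close> if \<open>p = 2\<close>), so its averages
  over products of the remaining shapes are bounded. Differentiating one factor at a time turns
  this into an almost everywhere bound. There are only countably many sets \<open>E\<close>, hence one null set
  serves all of them, and exhausting an arbitrary shape \<open>S\<close> by such sets gives, by Fatou, the bound
  for uncountably many shapes \<open>S\<close> simultaneously. This yields the constant \<open>2\<close> instead of \<open>2\<^sup>k\<^sup>-\<^sup>1\<close>.\<close>


subsection \<open>Mean oscillation on products of probability spaces\<close>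

text \<open>Oscillation about the own mean is not monotone in the set. In (b) the centre is
  therefore first changed to a constant \<open>a\<close> that depends neither on the section nor on
  \<open>E\<close>; distance to \<open>a\<close> is monotone, so \<open>E\<close> may then be
  enlarged to \<open>S\<close>, and Fubini leads to a product shape. This change of centre is the
  only loss: a factor \<open>Q = 2\<close> by convexity and Jensen, none for \<open>p = 2\<close>,
  where the mean is the best constant. It is paid once, since the other factors are handled by
  differentiating a nonnegative function, with no further means. Hence the constant does not grow
  with \<open>k\<close>. The directional norm is an essential supremum of norms over uncountably
  many shapes, so no exceptional set may depend on the shape. The bound over \<open>E\<close> is
  measured against the size of \<open>S\<close>, not of \<open>E\<close>, and so passes unchanged to
  the limit when such sets exhaust \<open>S\<close>. In (a) shapes are open and \<open>f\<close> is
  only locally integrable, so integrability over a whole product shape has to be proved together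
  with the estimate.\<close>

lemma abs_powr_convex:
  fixes u v a b p :: real
  assumes p: "1 \<le> p" and a: "0 \<le> a" and b: "0 \<le> b" and ab: "a + b = 1"
  shows "\<bar>a * u + b * v\<bar> powr p \<le> a * \<bar>u\<bar> powr p + b * \<bar>v\<bar> powr p"
proof -
  have scale: "(c * t) powr p \<le> c * t powr p" if "0 \<le> c" "c \<le> 1" "0 \<le> t" for c t :: real
  proof -
    have "c powr p \<le> c powr 1"
      using that p by (intro powr_mono') auto
    also have "c powr 1 = c" using that by simp
    finally have "c powr p \<le> c" .
    then have "c powr p * t powr p \<le> c * t powr p"
      by (intro mult_right_mono) auto
    then show ?thesis by (metis powr_mult that(1,3))
  qed
  have "\<bar>a * u + b * v\<bar> \<le> \<bar>a * u\<bar> + \<bar>b * v\<bar>" by (rule abs_triangle_ineq)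
  then have "\<bar>a * u + b * v\<bar> \<le> a * \<bar>u\<bar> + b * \<bar>v\<bar>"
    using a b by (simp only: abs_mult abs_of_nonneg)
  then have "\<bar>a * u + b * v\<bar> powr p \<le> (a * \<bar>u\<bar> + b * \<bar>v\<bar>) powr p"
    using p by (intro powr_mono2) auto
  also have "\<dots> \<le> a * \<bar>u\<bar> powr p + b * \<bar>v\<bar> powr p"
  proof -
    \<comment> \<open>Convexity of the power function is applied at positive arguments only; if
      \<open>u\<close> or \<open>v\<close> vanishes, the claim is \<open>scale\<close>.\<close>
    consider "u = 0" | "v = 0" | "u \<noteq> 0" "v \<noteq> 0" by blast
    then show ?thesis
    proof cases
      case 1
      then show ?thesis using scale[of b "\<bar>v\<bar>"] a b ab by simp
    next
      case 2
      then show ?thesis using scale[of a "\<bar>u\<bar>"] a b ab by simp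
    next
      case 3
      have "a = 1 - b" using ab by simp
      then show ?thesis
        using convex_onD[OF powr_convex[OF p], of b "\<bar>u\<bar>" "\<bar>v\<bar>"] 3 a b by simp
    qed
  qed
  finally show ?thesis .
qed

lemma convex_on_abs_powr:
  assumes "1 \<le> p"
  shows "convex_on UNIV (\<lambda>x::real. \<bar>x\<bar> powr p)"
  using abs_powr_convex[OF assms] by (auto intro!: convex_onI simp: add.commute)

lemma le_one_plus_powr:
  assumes "1 \<le> p" and "0 \<le> (t::real)"
  shows "t \<le> 1 + t powr p"
proof (cases "t \<le> 1")
  case False
  then have "t powr 1 \<le> t powr p" using assms by (intro powr_mono) auto
  then show ?thesis using False by simp
qed (use assms in \<open>simp add: add_increasing2\<close>)

text \<open>The pointwise bound \<open>t \<le> 1 + t powr p\<close> replaces Hoelder's inequality,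
  because the constant 1 is integrable here.\<close>

lemma (in finite_measure) integrable_of_powr:
  assumes "1 \<le> p" and [measurable]: "w \<in> borel_measurable M"
    and fin: "(\<integral>\<^sup>+x. ennreal (\<bar>w x\<bar> powr p) \<partial>M) < \<infinity>"
  shows "integrable M w"
proof (rule integrableI_bounded)
  have "(\<integral>\<^sup>+x. ennreal (norm (w x)) \<partial>M) \<le> (\<integral>\<^sup>+x. (1 + ennreal (\<bar>w x\<bar> powr p)) \<partial>M)"
    using le_one_plus_powr[OF assms(1)]
    by (intro nn_integral_mono) (simp flip: ennreal_plus ennreal_1 add: ennreal_leI)
  also have "\<dots> = emeasure M (space M) + (\<integral>\<^sup>+x. ennreal (\<bar>w x\<bar> powr p) \<partial>M)"
    by (simp add: nn_integral_add)
  also have "\<dots> < \<infinity>"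
    using fin by (simp add: less_top[symmetric])
  finally show "(\<integral>\<^sup>+x. ennreal (norm (w x)) \<partial>M) < \<infinity>" .
qed simp

lemma (in prob_space) jensen_powr:
  assumes p: "1 \<le> p" and w: "integrable M w"
  shows "ennreal (\<bar>expectation w\<bar> powr p) \<le> (\<integral>\<^sup>+x. ennreal (\<bar>w x\<bar> powr p) \<partial>M)"
proof (cases "(\<integral>\<^sup>+x. ennreal (\<bar>w x\<bar> powr p) \<partial>M) < \<infinity>")
  case True
  have [measurable]: "w \<in> borel_measurable M" using w by simp
  have i: "integrable M (\<lambda>x. \<bar>w x\<bar> powr p)"
    using True by (intro integrableI_bounded) auto
  have "\<bar>expectation w\<bar> powr p \<le> expectation (\<lambda>x. \<bar>w x\<bar> powr p)"
    using jensens_inequality[OF w _ _ i convex_on_abs_powr[OF p]] by auto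
  then show ?thesis
    using i by (subst nn_integral_eq_integral) (auto intro: ennreal_leI)
next
  case False
  then show ?thesis by (simp add: not_less top.extremum_unique)
qed

text \<open>Meant for probability measures, so nothing is divided by the size of a set. The root is
  moved to the right as \<open>K powr p\<close>, which keeps the integral in \<open>ennreal\<close>
  and includes its finiteness.\<close>

definition osc_le :: "'a measure \<Rightarrow> real \<Rightarrow> ('a \<Rightarrow> real) \<Rightarrow> real \<Rightarrow> bool" where
  "osc_le M p g K \<longleftrightarrow> integrable M g \<and>
     (\<integral>\<^sup>+x. ennreal (\<bar>g x - integral\<^sup>L M g\<bar> powr p) \<partial>M) \<le> ennreal (K powr p)"

text \<open>Minkowski's inequality below divides by its constants; approaching \<open>K\<close> from
  above also covers constants that are zero.\<close>

lemma osc_le_limit: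
  assumes K: "0 \<le> K" and p: "1 \<le> p" and L: "\<And>L. K < L \<Longrightarrow> osc_le M p g L"
  shows "osc_le M p g K"
proof -
  have int: "integrable M g" using L[of "K + 1"] by (simp add: osc_le_def)
  define I where "I = (\<integral>\<^sup>+x. ennreal (\<bar>g x - integral\<^sup>L M g\<bar> powr p) \<partial>M)"
  have "I \<le> ennreal ((K + 1 / real (Suc n)) powr p)" for n
    using L[of "K + 1 / real (Suc n)"] by (simp add: osc_le_def I_def)
  moreover have "(\<lambda>n. ennreal ((K + 1 / real (Suc n)) powr p)) \<longlonglongrightarrow> ennreal ((K + 0) powr p)"
    using p K LIMSEQ_inverse_real_of_nat
    by (intro tendsto_ennrealI tendsto_powr2 tendsto_add tendsto_const always_eventually)
       (auto simp: inverse_eq_divide)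
  ultimately have "I \<le> ennreal ((K + 0) powr p)"
    using LIMSEQ_le_const by blast
  then show ?thesis using int by (simp add: osc_le_def I_def)
qed

text \<open>Convexity with the weights \<open>a = K / (K + L)\<close> and
  \<open>b = L / (K + L)\<close>: \<open>(u + v) / (K + L)\<close> is the convex combination of
  \<open>u / K\<close> and \<open>v / L\<close>, whose p-th powers integrate to at most 1.\<close>

lemma nn_integral_minkowski_powr:
  assumes p: "1 \<le> p" and K: "0 < K" "0 < L"
    and [measurable]: "u \<in> borel_measurable M" "v \<in> borel_measurable M"
    and u: "(\<integral>\<^sup>+x. ennreal (\<bar>u x\<bar> powr p) \<partial>M) \<le> ennreal (K powr p)"
    and v: "(\<integral>\<^sup>+x. ennreal (\<bar>v x\<bar> powr p) \<partial>M) \<le> ennreal (L powr p)"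
  shows "(\<integral>\<^sup>+x. ennreal (\<bar>u x + v x\<bar> powr p) \<partial>M) \<le> ennreal ((K + L) powr p)"
proof -
  define a where "a = K / (K + L)"
  define b where "b = L / (K + L)"
  define T where "T = (K + L) powr p"
  have ab: "0 < a" "0 < b" "a + b = 1" and T: "0 \<le> T"
    using K by (auto simp: a_def b_def T_def add_divide_distrib[symmetric])
  have "(\<integral>\<^sup>+x. ennreal (\<bar>u x + v x\<bar> powr p) \<partial>M)
      \<le> (\<integral>\<^sup>+x. ennreal (T * a / K powr p) * ennreal (\<bar>u x\<bar> powr p)
            + ennreal (T * b / L powr p) * ennreal (\<bar>v x\<bar> powr p) \<partial>M)"
  proof (rule nn_integral_mono)
    fix x
    have "u x + v x = (K + L) * (a * (u x / K) + b * (v x / L))"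
      using K by (simp add: a_def b_def distrib_left)
    then have "\<bar>u x + v x\<bar> powr p = T * \<bar>a * (u x / K) + b * (v x / L)\<bar> powr p"
      using K by (simp add: T_def abs_mult powr_mult)
    also have "\<dots> \<le> T * (a * \<bar>u x / K\<bar> powr p + b * \<bar>v x / L\<bar> powr p)"
      using ab T by (intro mult_left_mono abs_powr_convex[OF p]) auto
    also have "\<dots> = T * a / K powr p * \<bar>u x\<bar> powr p + T * b / L powr p * \<bar>v x\<bar> powr p"
      using K by (simp add: abs_divide powr_divide algebra_simps)
    finally show "ennreal (\<bar>u x + v x\<bar> powr p) \<le> ennreal (T * a / K powr p) * ennreal (\<bar>u x\<bar> powr p)
            + ennreal (T * b / L powr p) * ennreal (\<bar>v x\<bar> powr p)"
      using T ab by (simp add: ennreal_leI flip: ennreal_mult ennreal_plus)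
  qed
  also have "\<dots> = ennreal (T * a / K powr p) * (\<integral>\<^sup>+x. ennreal (\<bar>u x\<bar> powr p) \<partial>M)
      + ennreal (T * b / L powr p) * (\<integral>\<^sup>+x. ennreal (\<bar>v x\<bar> powr p) \<partial>M)"
    by (simp add: nn_integral_add nn_integral_cmult)
  also have "\<dots> \<le> ennreal (T * a / K powr p) * ennreal (K powr p)
      + ennreal (T * b / L powr p) * ennreal (L powr p)"
    by (intro add_mono mult_left_mono u v) auto
  also have "\<dots> = ennreal (T * a + T * b)"
    using K T ab by (simp flip: ennreal_mult ennreal_plus)
  also have "T * a + T * b = T" using ab by (simp flip: distrib_left)
  finally show ?thesis by (simp add: T_def)
qed

lemma osc_le_pair:
  fixes g :: "'a \<times> 'b \<Rightarrow> real"
  assumes "prob_space M1" "prob_space M2" and p: "1 \<le> p" and K: "0 \<le> K1" "0 \<le> K2"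
    and g[measurable]: "g \<in> borel_measurable (M1 \<Otimes>\<^sub>M M2)"
    and 1: "AE y in M2. osc_le M1 p (\<lambda>x. g (x, y)) K1"
    and 2: "AE x in M1. osc_le M2 p (\<lambda>y. g (x, y)) K2"
  shows "osc_le (M1 \<Otimes>\<^sub>M M2) p g (K1 + K2)"
proof -
  interpret M1: prob_space M1 by fact
  interpret M2: prob_space M2 by fact
  interpret P: pair_prob_space M1 M2 ..
  define a where "a y = (\<integral>x. g (x, y) \<partial>M1)" for y
  define b where "b x = (\<integral>y. g (x, y) \<partial>M2)" for x
  define D where "D z = g z - a (snd z)" for z
  have [measurable]: "a \<in> borel_measurable M2" "b \<in> borel_measurable M1"
    unfolding a_def b_def by measurable
  have [measurable]: "D \<in> borel_measurable (M1 \<Otimes>\<^sub>M M2)"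
    unfolding D_def by measurable
  have D_bound: "(\<integral>\<^sup>+z. ennreal (\<bar>D z\<bar> powr p) \<partial>(M1 \<Otimes>\<^sub>M M2)) \<le> ennreal (K1 powr p)"
  proof -
    have "(\<integral>\<^sup>+z. ennreal (\<bar>D z\<bar> powr p) \<partial>(M1 \<Otimes>\<^sub>M M2))
        = (\<integral>\<^sup>+y. \<integral>\<^sup>+x. ennreal (\<bar>D (x, y)\<bar> powr p) \<partial>M1 \<partial>M2)"
      by (subst P.nn_integral_snd[symmetric]) auto
    also have "\<dots> \<le> (\<integral>\<^sup>+y. ennreal (K1 powr p) \<partial>M2)"
      using 1 by (intro nn_integral_mono_AE) (auto simp: osc_le_def D_def a_def)
    finally show ?thesis by (simp add: M2.emeasure_space_1)
  qed
  have D_int: "integrable (M1 \<Otimes>\<^sub>M M2) D"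
    by (rule P.integrable_of_powr[OF p]) (use D_bound in \<open>auto intro: le_less_trans\<close>)
  \<comment> \<open>For almost every fixed \<open>x\<close> both \<open>D (x, _)\<close> and
    \<open>g (x, _)\<close> are integrable, and their difference is \<open>a\<close>, whatever
    \<open>x\<close> is. One such \<open>x\<close> suffices.\<close>
  have a_int: "integrable M2 a"
  proof -
    from P.AE_integrable_fst'[OF D_int] 2
    have "AE x in M1. integrable M2 (\<lambda>y. D (x, y)) \<and> osc_le M2 p (\<lambda>y. g (x, y)) K2"
      by eventually_elim simp
    then have "\<exists>x. integrable M2 (\<lambda>y. D (x, y)) \<and> osc_le M2 p (\<lambda>y. g (x, y)) K2"
      by (rule eventually_happens'[OF M1.ae_filter_bot])
    then obtain x where "integrable M2 (\<lambda>y. D (x, y))" "integrable M2 (\<lambda>y. g (x, y))"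
      by (auto simp: osc_le_def)
    from Bochner_Integration.integrable_diff[OF this(2,1)] show ?thesis by (simp add: D_def)
  qed
  have a_snd: "integrable (M1 \<Otimes>\<^sub>M M2) (\<lambda>z. a (snd z))"
  proof (rule integrableI_bounded)
    have "(\<integral>\<^sup>+z. ennreal (norm (a (snd z))) \<partial>(M1 \<Otimes>\<^sub>M M2)) = (\<integral>\<^sup>+y. ennreal (norm (a y)) \<partial>M2)"
      by (subst P.nn_integral_snd[symmetric]) (auto simp: M1.emeasure_space_1)
    also have "\<dots> < \<infinity>" using a_int by (simp add: integrable_iff_bounded)
    finally show "(\<integral>\<^sup>+z. ennreal (norm (a (snd z))) \<partial>(M1 \<Otimes>\<^sub>M M2)) < \<infinity>" .
  qed simp
  have g_int: "integrable (M1 \<Otimes>\<^sub>M M2) g"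
    using Bochner_Integration.integrable_add[OF D_int a_snd] by (simp add: D_def)
  define c where "c = (\<integral>z. g z \<partial>(M1 \<Otimes>\<^sub>M M2))"
  have c_b: "c = (\<integral>x. b x \<partial>M1)" and b_int: "integrable M1 b"
    unfolding c_def b_def using P.integral_fst'[OF g_int] P.integrable_fst'[OF g_int] by auto
  \<comment> \<open>As \<open>c\<close> is also the mean of \<open>b\<close>, the number
    \<open>a y - c\<close> is the mean over \<open>x\<close> of \<open>g (x, y) - b x\<close>. After
    Jensen and Fubini only oscillations in the second variable remain.\<close>
  have a_bound: "(\<integral>\<^sup>+y. ennreal (\<bar>a y - c\<bar> powr p) \<partial>M2) \<le> ennreal (K2 powr p)"
  proof -
    have "(\<integral>\<^sup>+y. ennreal (\<bar>a y - c\<bar> powr p) \<partial>M2)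
        \<le> (\<integral>\<^sup>+y. \<integral>\<^sup>+x. ennreal (\<bar>g (x, y) - b x\<bar> powr p) \<partial>M1 \<partial>M2)"
    proof (rule nn_integral_mono_AE, use 1 in eventually_elim)
      fix y assume "osc_le M1 p (\<lambda>x. g (x, y)) K1"
      then have i: "integrable M1 (\<lambda>x. g (x, y))" by (simp add: osc_le_def)
      then have "a y - c = (\<integral>x. g (x, y) - b x \<partial>M1)"
        by (simp add: a_def c_b b_int)
      then show "ennreal (\<bar>a y - c\<bar> powr p) \<le> (\<integral>\<^sup>+x. ennreal (\<bar>g (x, y) - b x\<bar> powr p) \<partial>M1)"
        using M1.jensen_powr[OF p, of "\<lambda>x. g (x, y) - b x"] i b_int by simp
    qed
    also have "\<dots> = (\<integral>\<^sup>+x. \<integral>\<^sup>+y. ennreal (\<bar>g (x, y) - b x\<bar> powr p) \<partial>M2 \<partial>M1)"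
      by (rule P.Fubini') measurable
    also have "\<dots> \<le> (\<integral>\<^sup>+x. ennreal (K2 powr p) \<partial>M1)"
      using 2 by (intro nn_integral_mono_AE) (auto simp: osc_le_def b_def)
    finally show ?thesis by (simp add: M1.emeasure_space_1)
  qed
  have a_snd_bound: "(\<integral>\<^sup>+z. ennreal (\<bar>a (snd z) - c\<bar> powr p) \<partial>(M1 \<Otimes>\<^sub>M M2)) \<le> ennreal (K2 powr p)"
    using a_bound by (subst P.nn_integral_snd[symmetric]) (auto simp: M1.emeasure_space_1)
  show ?thesis
  proof (rule osc_le_limit)
    fix L assume L: "K1 + K2 < L"
    \<comment> \<open>The surplus of \<open>L\<close> is shared equally, which makes both constants
      for Minkowski positive.\<close>
    define e where "e = (L - K1 - K2) / 2"
    have e: "0 < e" "L = (K1 + e) + (K2 + e)" using L by (auto simp: e_def field_simps)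
    have "(\<integral>\<^sup>+z. ennreal (\<bar>D z + (a (snd z) - c)\<bar> powr p) \<partial>(M1 \<Otimes>\<^sub>M M2)) \<le> ennreal (L powr p)"
      unfolding e(2) using K e(1) p
      by (intro nn_integral_minkowski_powr order_trans[OF D_bound] order_trans[OF a_snd_bound])
         (auto intro!: ennreal_leI powr_mono2)
    then show "osc_le (M1 \<Otimes>\<^sub>M M2) p g L"
      using g_int by (simp add: osc_le_def D_def c_def)
  qed (use K p in auto)
qed

lemma osc_le_distr:
  assumes [measurable]: "T \<in> M \<rightarrow>\<^sub>M N" "g \<in> borel_measurable N"
  shows "osc_le (distr M N T) p g K \<longleftrightarrow> osc_le M p (\<lambda>x. g (T x)) K"
  by (simp add: osc_le_def integrable_distr_eq integral_distr nn_integral_distr)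

text \<open>Splitting off one factor at a time, \<open>osc_le_pair\<close> adds its constant to the
  sum for the rest.\<close>

lemma osc_le_PiM:
  assumes "finite J" and p: "1 \<le> p"
    and "\<And>i. i \<in> J \<Longrightarrow> prob_space (P i)" and "\<And>i. i \<in> J \<Longrightarrow> 0 \<le> K i"
    and "g \<in> borel_measurable (PiM J P)"
    and "\<And>i. i \<in> J \<Longrightarrow> AE w in PiM (J - {i}) P. osc_le (P i) p (\<lambda>x. g (w(i := x))) (K i)"
  shows "osc_le (PiM J P) p g (\<Sum>i\<in>J. K i)"
  using assms(1,3-)
proof (induction J arbitrary: g)
  case empty
  then show ?case
    by (simp add: osc_le_def PiM_empty integrable_count_space lebesgue_integral_count_space_finite
        nn_integral_count_space_finite)
next
  case (insert j J)
  note [measurable] = insert.prems(3)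
  interpret Pj: prob_space "P j" using insert.prems by simp
  interpret PJ: prob_space "PiM J P" by (intro prob_space_PiM insert.prems) auto
  interpret Pr: pair_prob_space "P j" "PiM J P" ..
  have "osc_le (P j \<Otimes>\<^sub>M PiM J P) p (\<lambda>z. g ((snd z)(j := fst z))) (K j + (\<Sum>i\<in>J. K i))"
  proof (rule osc_le_pair)
    show "AE w in PiM J P. osc_le (P j) p (\<lambda>x. g ((snd (x, w))(j := fst (x, w)))) (K j)"
      using insert.prems(4)[of j, unfolded Diff_insert_absorb[OF insert.hyps(2)]] by (simp add: fun_upd_def)
    \<comment> \<open>The induction hypothesis is used for fixed \<open>x\<close>, so the null set
      of each direction \<open>i\<close> is sliced at the new coordinate \<open>j\<close>. Finitely
      many directions leave one null set of \<open>x\<close>.\<close>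
    have "AE x in P j. \<forall>i\<in>J. AE w in PiM (J - {i}) P. osc_le (P i) p (\<lambda>t. g (w(j := x, i := t))) (K i)"
    proof (intro AE_finite_allI[OF insert.hyps(1)])
      fix i assume i: "i \<in> J"
      interpret Q: prob_space "PiM (J - {i}) P" by (intro prob_space_PiM insert.prems) auto
      interpret Pq: pair_prob_space "P j" "PiM (J - {i}) P" ..
      have eq: "insert j J - {i} = insert j (J - {i})" using i insert.hyps by auto
      have d: "distr (P j \<Otimes>\<^sub>M PiM (J - {i}) P) (PiM (insert j (J - {i})) P) (\<lambda>(x, X). X(j := x))
          = PiM (insert j (J - {i})) P"
        by (rule distr_pair_PiM_eq_PiM) (use insert.prems in auto)
      have "AE w in PiM (insert j J - {i}) P. osc_le (P i) p (\<lambda>x. g (w(i := x))) (K i)"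
        by (rule insert.prems(4)) (use i in simp)
      then have *: "AE w in distr (P j \<Otimes>\<^sub>M PiM (J - {i}) P) (PiM (insert j (J - {i})) P) (\<lambda>(x, X). X(j := x)).
          osc_le (P i) p (\<lambda>x. g (w(i := x))) (K i)"
        unfolding d eq .
      have "AE z in P j \<Otimes>\<^sub>M PiM (J - {i}) P.
          osc_le (P i) p (\<lambda>t. g (((\<lambda>(x, X). X(j := x)) z)(i := t))) (K i)"
        by (rule AE_distrD[OF _ *]) measurable
      from Pq.AE_pair[OF this]
      show "AE x in P j. AE w in PiM (J - {i}) P. osc_le (P i) p (\<lambda>t. g (w(j := x, i := t))) (K i)"
        by simp
    qed
    then show "AE x in P j. osc_le (PiM J P) p (\<lambda>w. g ((snd (x, w))(j := fst (x, w)))) (\<Sum>i\<in>J. K i)"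
      using AE_space
    proof eventually_elim
      case (elim x)
      then have x: "x \<in> space (P j)"
        and *: "\<forall>i\<in>J. AE w in PiM (J - {i}) P. osc_le (P i) p (\<lambda>t. g (w(j := x, i := t))) (K i)" by auto
      have "osc_le (PiM J P) p (\<lambda>w. g (w(j := x))) (\<Sum>i\<in>J. K i)"
    proof (rule insert.IH)
      show "(\<lambda>w. g (w(j := x))) \<in> borel_measurable (PiM J P)"
        using x by measurable
      fix i assume i: "i \<in> J"
      then have "i \<noteq> j" using insert.hyps by auto
      then have "(\<lambda>t. g (w(i := t, j := x))) = (\<lambda>t. g (w(j := x, i := t)))" for w
        by (intro ext arg_cong[where f = g] fun_upd_twist)
      then show "AE w in PiM (J - {i}) P. osc_le (P i) p (\<lambda>t. g (w(i := t, j := x))) (K i)"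
        using * i by simp
    qed (use insert.prems in auto)
      then show ?case by simp
    qed
  qed (use insert.prems p in \<open>auto intro!: sum_nonneg Pj.prob_space_axioms PJ.prob_space_axioms\<close>)
  then have "osc_le (distr (P j \<Otimes>\<^sub>M PiM J P) (PiM (insert j J) P) (\<lambda>(x, X). X(j := x))) p g (K j + (\<Sum>i\<in>J. K i))"
    by (subst osc_le_distr) (auto simp: case_prod_unfold)
  then show ?case
    using insert by (subst (asm) distr_pair_PiM_eq_PiM) auto
qed

section \<open>Products of normalised and of sigma-finite measures\<close>

lemma prod_divide_ennreal:
  fixes a s :: "'i \<Rightarrow> ennreal"
  assumes "finite J" "\<And>i. i \<in> J \<Longrightarrow> s i \<noteq> 0" "\<And>i. i \<in> J \<Longrightarrow> s i \<noteq> top"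
  shows "(\<Prod>i\<in>J. a i) / (\<Prod>i\<in>J. s i) = (\<Prod>i\<in>J. a i / s i)"
proof -
  have "(\<Prod>i\<in>J. a i) = (\<Prod>i\<in>J. a i / s i * s i)"
  proof (intro prod.cong refl)
    fix i assume i: "i \<in> J"
    have "a i / s i * s i = a i * s i / s i" by (metis ennreal_times_divide mult.commute)
    then show "a i = a i / s i * s i" using assms i by (simp add: mult_divide_eq_ennreal)
  qed
  also have "\<dots> = (\<Prod>i\<in>J. a i / s i) * (\<Prod>i\<in>J. s i)" by (simp add: prod.distrib)
  finally show ?thesis
    using assms by (simp add: mult_divide_eq_ennreal ennreal_prod_eq_top)
qed

context product_sigma_finite begin

text \<open>Both sides have the same value on boxes, since intersection and normalisation act factor
  by factor. This makes a product shape a product of probability spaces.\<close>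

lemma PiM_uniform_measure:
  assumes J: "finite J" and S: "\<And>i. i \<in> J \<Longrightarrow> S i \<in> sets (M i)"
    "\<And>i. i \<in> J \<Longrightarrow> emeasure (M i) (S i) \<noteq> 0" "\<And>i. i \<in> J \<Longrightarrow> emeasure (M i) (S i) \<noteq> top"
  shows "PiM J (\<lambda>i. uniform_measure (M i) (S i)) = uniform_measure (PiM J M) (PiE J S)"
proof -
  \<comment> \<open>The product locale asks for a sigma-finite measure at every index, while
    \<open>S i\<close> is controlled only for \<open>i\<close> in \<open>J\<close>.\<close>
  define Q where "Q i = (if i \<in> J then uniform_measure (M i) (S i) else M i)" for i
  interpret Q: product_sigma_finite Q
  proof (rule product_sigma_finite.intro)
    fix i
    have "prob_space (uniform_measure (M i) (S i))" if "i \<in> J"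
      using S that by (intro prob_space_uniform_measure) auto
    then show "sigma_finite_measure (Q i)"
      using sigma_finite_measures by (auto simp: Q_def intro: prob_space_imp_sigma_finite)
  qed
  have sQ: "sets (Q i) = sets (M i)" for i by (simp add: Q_def)
  have [measurable]: "PiE J S \<in> sets (PiM J M)" using S J by (intro sets_PiM_I_finite) auto
  have "uniform_measure (PiM J M) (PiE J S) = PiM J Q"
  proof (rule Q.PiM_eqI[OF J])
    show "sets (uniform_measure (PiM J M) (PiE J S)) = sets (PiM J Q)"
      by (simp add: sQ cong: sets_PiM_cong)
    fix A assume A: "\<And>i. i \<in> J \<Longrightarrow> A i \<in> sets (Q i)"
    have [measurable]: "PiE J A \<in> sets (PiM J M)" using A J by (intro sets_PiM_I_finite) (auto simp: sQ)
    have "emeasure (uniform_measure (PiM J M) (PiE J S)) (PiE J A)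
        = emeasure (PiM J M) (PiE J (\<lambda>i. S i \<inter> A i)) / emeasure (PiM J M) (PiE J S)"
      by (simp add: PiE_Int)
    also have "\<dots> = (\<Prod>i\<in>J. emeasure (M i) (S i \<inter> A i)) / (\<Prod>i\<in>J. emeasure (M i) (S i))"
      using A S J by (subst (1 2) emeasure_PiM) (auto simp: sQ)
    also have "\<dots> = (\<Prod>i\<in>J. emeasure (M i) (S i \<inter> A i) / emeasure (M i) (S i))"
      using S J by (intro prod_divide_ennreal) auto
    also have "\<dots> = (\<Prod>i\<in>J. emeasure (Q i) (A i))"
      using A S by (intro prod.cong) (auto simp: Q_def sQ)
    finally show "emeasure (uniform_measure (PiM J M) (PiE J S)) (PiE J A) = (\<Prod>i\<in>J. emeasure (Q i) (A i))" .
  qed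
  also have "PiM J Q = PiM J (\<lambda>i. uniform_measure (M i) (S i))"
    by (intro PiM_cong) (auto simp: Q_def)
  finally show ?thesis by simp
qed

text \<open>The sigma-finite counterpart of \<open>distr_pair_PiM_eq_PiM\<close>, read off from
  iterated integrals of indicator functions.\<close>

lemma distr_PiM_insert:
  assumes J: "finite J" "j \<notin> J"
  shows "distr (M j \<Otimes>\<^sub>M PiM J M) (PiM (insert j J) M) (\<lambda>(x, X). X(j := x)) = PiM (insert j J) M"
proof (rule measure_eqI)
  interpret J: sigma_finite_measure "PiM J M" by (rule sigma_finite) fact
  fix A assume "A \<in> sets (distr (M j \<Otimes>\<^sub>M PiM J M) (PiM (insert j J) M) (\<lambda>(x, X). X(j := x)))"
  then have [measurable]: "A \<in> sets (PiM (insert j J) M)" by simp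
  have "emeasure (PiM (insert j J) M) A = (\<integral>\<^sup>+z. indicator A z \<partial>PiM (insert j J) M)" by simp
  also have "\<dots> = (\<integral>\<^sup>+x. \<integral>\<^sup>+X. indicator A (X(j := x)) \<partial>PiM J M \<partial>M j)"
    using J by (intro product_nn_integral_insert_rev) auto
  also have "\<dots> = (\<integral>\<^sup>+z. indicator A ((snd z)(j := fst z)) \<partial>(M j \<Otimes>\<^sub>M PiM J M))"
    by (subst J.nn_integral_fst[symmetric]) auto
  also have "\<dots> = (\<integral>\<^sup>+z. indicator A z \<partial>distr (M j \<Otimes>\<^sub>M PiM J M) (PiM (insert j J) M) (\<lambda>(x, X). X(j := x)))"
    by (subst nn_integral_distr) (auto simp: case_prod_unfold)
  finally show "emeasure (distr (M j \<Otimes>\<^sub>M PiM J M) (PiM (insert j J) M) (\<lambda>(x, X). X(j := x))) A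
      = emeasure (PiM (insert j J) M) A" by simp
qed simp

end

subsection \<open>From bounds on products of shapes to pointwise bounds\<close>

text \<open>Membership in a grid set depends on countable discretisations of the two coordinates. In this form
  the grid sets are visibly an algebra that contains the rectangles, and each of them is a countable
  disjoint union of rectangles.\<close>

definition grid_sets :: "'a measure \<Rightarrow> 'b measure \<Rightarrow> ('a \<times> 'b) set set" where
  "grid_sets M1 M2 = {D. \<exists>u v Q. u \<in> M1 \<rightarrow>\<^sub>M count_space (UNIV :: nat set) \<and>
     v \<in> M2 \<rightarrow>\<^sub>M count_space (UNIV :: nat set) \<and>
     D = {z \<in> space (M1 \<Otimes>\<^sub>M M2). (u (fst z), v (snd z)) \<in> Q}}"

lemma grid_setsE:
  assumes "D \<in> grid_sets M1 M2"
  obtains u v Q where "u \<in> M1 \<rightarrow>\<^sub>M count_space (UNIV :: nat set)" "v \<in> M2 \<rightarrow>\<^sub>M count_space (UNIV :: nat set)"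
    "D = {z \<in> space (M1 \<Otimes>\<^sub>M M2). (u (fst z), v (snd z)) \<in> Q}"
  using assms unfolding grid_sets_def by blast

lemma grid_setsI:
  assumes "u \<in> M1 \<rightarrow>\<^sub>M count_space (UNIV :: nat set)" "v \<in> M2 \<rightarrow>\<^sub>M count_space (UNIV :: nat set)"
    "D = {z \<in> space (M1 \<Otimes>\<^sub>M M2). (u (fst z), v (snd z)) \<in> Q}"
  shows "D \<in> grid_sets M1 M2"
  using assms unfolding grid_sets_def by blast

lemma grid_sets_cover:
  assumes "D \<in> grid_sets M1 M2"
  obtains A B and Q :: "(nat \<times> nat) set" where
    "\<And>q. A q \<in> sets M1" "\<And>q. B q \<in> sets M2"
    "disjoint_family_on (\<lambda>q. A q \<times> B q) Q" "D = (\<Union>q\<in>Q. A q \<times> B q)"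
proof -
  obtain u v Q where [measurable]: "u \<in> M1 \<rightarrow>\<^sub>M count_space (UNIV :: nat set)" "v \<in> M2 \<rightarrow>\<^sub>M count_space (UNIV :: nat set)"
    and D: "D = {z \<in> space (M1 \<Otimes>\<^sub>M M2). (u (fst z), v (snd z)) \<in> Q}"
    using assms by (elim grid_setsE)
  show thesis
  proof
    show "{x \<in> space M1. u x = fst q} \<in> sets M1" "{y \<in> space M2. v y = snd q} \<in> sets M2" for q
      by measurable
    show "disjoint_family_on (\<lambda>q. {x \<in> space M1. u x = fst q} \<times> {y \<in> space M2. v y = snd q}) Q"
      by (auto simp: disjoint_family_on_def prod_eq_iff)
    show "D = (\<Union>q\<in>Q. {x \<in> space M1. u x = fst q} \<times> {y \<in> space M2. v y = snd q})"
      by (auto simp: D space_pair_measure)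
  qed
qed

lemma sets_grid_sets: "D \<in> grid_sets M1 M2 \<Longrightarrow> D \<in> sets (M1 \<Otimes>\<^sub>M M2)"
  by (elim grid_sets_cover) (auto intro!: sets.countable_UN'')

text \<open>Sum the inequality over the countably many disjoint cells.\<close>

lemma emeasure_grid_sets_mono:
  assumes D: "D \<in> grid_sets M1 M2"
    and s: "sets \<mu> = sets (M1 \<Otimes>\<^sub>M M2)" "sets \<nu> = sets (M1 \<Otimes>\<^sub>M M2)"
    and le: "\<And>A B. A \<in> sets M1 \<Longrightarrow> B \<in> sets M2 \<Longrightarrow> emeasure \<nu> (A \<times> B) \<le> emeasure \<mu> (A \<times> B)"
  shows "emeasure \<nu> D \<le> emeasure \<mu> D"
proof -
  obtain A B and Q :: "(nat \<times> nat) set" where [measurable]: "\<And>q. A q \<in> sets M1" "\<And>q. B q \<in> sets M2"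
    and *: "disjoint_family_on (\<lambda>q. A q \<times> B q) Q" "D = (\<Union>q\<in>Q. A q \<times> B q)"
    by (rule grid_sets_cover[OF D]) (rule that)
  have AB: "A q \<times> B q \<in> sets (M1 \<Otimes>\<^sub>M M2)" for q by simp
  have "emeasure \<nu> D = (\<integral>\<^sup>+q. emeasure \<nu> (A q \<times> B q) \<partial>count_space Q)"
    unfolding *(2) by (rule emeasure_UN_countable) (use AB *(1) in \<open>simp_all add: s\<close>)
  also have "\<dots> \<le> (\<integral>\<^sup>+q. emeasure \<mu> (A q \<times> B q) \<partial>count_space Q)"
    by (intro nn_integral_mono le) auto
  also have "\<dots> = emeasure \<mu> D"
    unfolding *(2) by (rule emeasure_UN_countable[symmetric]) (use AB *(1) in \<open>simp_all add: s\<close>)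
  finally show ?thesis .
qed

lemma grid_sets_rect:
  assumes [measurable]: "A \<in> sets M1" "B \<in> sets M2"
  shows "A \<times> B \<in> grid_sets M1 M2"
proof (rule grid_setsI)
  show "(\<lambda>x. if x \<in> A then 1 else 0) \<in> M1 \<rightarrow>\<^sub>M count_space (UNIV :: nat set)"
    "(\<lambda>x. if x \<in> B then 1 else 0) \<in> M2 \<rightarrow>\<^sub>M count_space (UNIV :: nat set)" by measurable
  show "A \<times> B = {z \<in> space (M1 \<Otimes>\<^sub>M M2). (if fst z \<in> A then 1 else 0, if snd z \<in> B then 1 else 0) \<in> {(1::nat, 1::nat)}}"
    using sets.sets_into_space[OF assms(1)] sets.sets_into_space[OF assms(2)]
    by (auto simp: space_pair_measure split: if_splits)
qed

lemma grid_sets_Diff: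
  assumes "D \<in> grid_sets M1 M2"
  shows "space (M1 \<Otimes>\<^sub>M M2) - D \<in> grid_sets M1 M2"
proof -
  obtain u v Q where u: "u \<in> M1 \<rightarrow>\<^sub>M count_space (UNIV :: nat set)" "v \<in> M2 \<rightarrow>\<^sub>M count_space (UNIV :: nat set)"
    and D: "D = {z \<in> space (M1 \<Otimes>\<^sub>M M2). (u (fst z), v (snd z)) \<in> Q}"
    using assms by (elim grid_setsE)
  show ?thesis by (rule grid_setsI[OF u, of _ "- Q"]) (auto simp: D)
qed

lemma grid_sets_Un:
  assumes "D \<in> grid_sets M1 M2" "E \<in> grid_sets M1 M2"
  shows "D \<union> E \<in> grid_sets M1 M2"
proof -
  obtain u v Q where [measurable]: "u \<in> M1 \<rightarrow>\<^sub>M count_space (UNIV :: nat set)" "v \<in> M2 \<rightarrow>\<^sub>M count_space (UNIV :: nat set)"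
    and D: "D = {z \<in> space (M1 \<Otimes>\<^sub>M M2). (u (fst z), v (snd z)) \<in> Q}"
    using assms(1) by (elim grid_setsE)
  obtain u' v' Q' where [measurable]: "u' \<in> M1 \<rightarrow>\<^sub>M count_space (UNIV :: nat set)" "v' \<in> M2 \<rightarrow>\<^sub>M count_space (UNIV :: nat set)"
    and E: "E = {z \<in> space (M1 \<Otimes>\<^sub>M M2). (u' (fst z), v' (snd z)) \<in> Q'}"
    using assms(2) by (elim grid_setsE)
  show ?thesis
  \<comment> \<open>The common refinement of two discretisations is the pair of their values, coded
    as one natural number by \<open>prod_encode\<close>.\<close>
  proof (rule grid_setsI)
    show "(\<lambda>x. prod_encode (u x, u' x)) \<in> M1 \<rightarrow>\<^sub>M count_space (UNIV :: nat set)"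
      "(\<lambda>x. prod_encode (v x, v' x)) \<in> M2 \<rightarrow>\<^sub>M count_space (UNIV :: nat set)" by measurable
    show "D \<union> E = {z \<in> space (M1 \<Otimes>\<^sub>M M2).
        (prod_encode (u (fst z), u' (fst z)), prod_encode (v (snd z), v' (snd z)))
          \<in> {(a, b). (fst (prod_decode a), fst (prod_decode b)) \<in> Q \<or> (snd (prod_decode a), snd (prod_decode b)) \<in> Q'}}"
      by (auto simp: D E)
  qed
qed

text \<open>Approximation of a generated sigma-algebra by a generating algebra. Symmetric
  differences are unchanged by complements and subadditive under unions; finiteness of
  \<open>\<rho>\<close> takes care of countable unions.\<close>

lemma grid_sets_approx:
  assumes "finite_measure \<rho>" and s: "sets \<rho> = sets (M1 \<Otimes>\<^sub>M M2)"
    and D: "D \<in> sets (M1 \<Otimes>\<^sub>M M2)" and "0 < (e::real)"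
  shows "\<exists>E\<in>grid_sets M1 M2. measure \<rho> (D - E \<union> (E - D)) < e"
proof -
  interpret finite_measure \<rho> by fact
  let ?S = "space (M1 \<Otimes>\<^sub>M M2)"
  have sp: "space \<rho> = ?S" using s by (rule sets_eq_imp_space_eq)
  have sets_eq: "sets \<rho> = sigma_sets (space M1 \<times> space M2) {a \<times> b |a b. a \<in> sets M1 \<and> b \<in> sets M2}"
    by (simp add: s sets_pair_measure)
  have g: "E \<in> sets \<rho>" if "E \<in> grid_sets M1 M2" for E using sets_grid_sets[OF that] s by simp
  have Un: "\<exists>E\<in>grid_sets M1 M2. measure \<rho> (A \<union> B - E \<union> (E - (A \<union> B))) < e"
    if A: "A \<in> sets \<rho>" "\<And>e. 0 < e \<Longrightarrow> \<exists>E\<in>grid_sets M1 M2. measure \<rho> (A - E \<union> (E - A)) < e"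
      and B: "B \<in> sets \<rho>" "\<And>e. 0 < e \<Longrightarrow> \<exists>E\<in>grid_sets M1 M2. measure \<rho> (B - E \<union> (E - B)) < e"
      and "0 < (e::real)" for A B e
  proof -
    obtain E where E: "E \<in> grid_sets M1 M2" "measure \<rho> (A - E \<union> (E - A)) < e / 2"
      using A(2)[of "e / 2"] \<open>0 < e\<close> by auto
    obtain F where F: "F \<in> grid_sets M1 M2" "measure \<rho> (B - F \<union> (F - B)) < e / 2"
      using B(2)[of "e / 2"] \<open>0 < e\<close> by auto
    have "measure \<rho> (A \<union> B - (E \<union> F) \<union> (E \<union> F - (A \<union> B))) \<le>
        measure \<rho> ((A - E \<union> (E - A)) \<union> (B - F \<union> (F - B)))"
      using A(1) B(1) g[OF E(1)] g[OF F(1)] by (intro finite_measure_mono) auto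
    also have "\<dots> \<le> measure \<rho> (A - E \<union> (E - A)) + measure \<rho> (B - F \<union> (F - B))"
      using A(1) B(1) g[OF E(1)] g[OF F(1)] by (intro measure_Un_le) auto
    finally show ?thesis using E(2) F(2) by (intro bexI[OF _ grid_sets_Un[OF E(1) F(1)]]) linarith
  qed
  have "D \<in> sigma_sets (space M1 \<times> space M2) {a \<times> b |a b. a \<in> sets M1 \<and> b \<in> sets M2}"
    using D by (simp add: sets_pair_measure)
  then show ?thesis using \<open>0 < e\<close>
  proof (induction arbitrary: e)
    case (Basic a)
    then have "a \<in> grid_sets M1 M2" using grid_sets_rect by auto
    then show ?case using Basic.prems by (intro bexI[of _ a]) auto
  next
    case Empty
    then show ?case using grid_sets_rect[of "{}" M1 "{}" M2] by (intro bexI[of _ "{}"]) auto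
  next
    case (Compl a)
    then obtain E where E: "E \<in> grid_sets M1 M2" "measure \<rho> (a - E \<union> (E - a)) < e" by auto
    have sub: "a \<subseteq> ?S" "E \<subseteq> ?S"
      using sets.sets_into_space[of a \<rho>] sets.sets_into_space[OF g[OF E(1)]] Compl.hyps
      by (auto simp: sp sets_eq)
    have "space M1 \<times> space M2 - a - (?S - E) \<union> (?S - E - (space M1 \<times> space M2 - a)) = a - E \<union> (E - a)"
      using sub by (auto simp: space_pair_measure)
    then show ?case using E(2) by (intro bexI[OF _ grid_sets_Diff[OF E(1)]]) simp
  next
    case (Union a)
    \<comment> \<open>Finite unions are approximated by an inner induction; continuity from below
      makes the rest of the countable union small.\<close>
    define G where "G n = (\<Union>i\<le>n. a i)" for n :: nat
    have a: "a i \<in> sets \<rho>" for i using Union.hyps by (simp add: sets_eq)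
    have [measurable]: "G n \<in> sets \<rho>" for n using a by (auto simp: G_def)
    have ap: "\<exists>E\<in>grid_sets M1 M2. measure \<rho> (G n - E \<union> (E - G n)) < e" if "0 < e" for n e
      using that
    proof (induction n arbitrary: e)
      case 0
      then show ?case using Union.IH[of e 0] by (simp add: G_def)
    next
      case (Suc n)
      have "G (Suc n) = G n \<union> a (Suc n)" by (auto simp: G_def le_Suc_eq)
      then show ?case using Un[of "G n" "a (Suc n)" e] Suc Union.IH[of _ "Suc n"] a by simp
    qed
    have "(\<lambda>n. measure \<rho> (G n)) \<longlonglongrightarrow> measure \<rho> (\<Union>n. G n)"
    proof (rule finite_Lim_measure_incseq)
      show "range G \<subseteq> sets \<rho>" by auto
      show "incseq G" by (rule monoI) (force simp: G_def)
    qed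
    moreover have UG: "(\<Union>n. G n) = (\<Union>i. a i)" by (auto simp: G_def)
    ultimately have "eventually (\<lambda>n. measure \<rho> (\<Union>i. a i) - e / 2 < measure \<rho> (G n)) sequentially"
      using Union.prems by (intro order_tendstoD(1)[of _ "measure \<rho> (\<Union>i. a i)"]) (simp, linarith)
    then obtain n where n: "measure \<rho> (\<Union>i. a i) - e / 2 < measure \<rho> (G n)"
      by (auto simp: eventually_sequentially)
    obtain E where E: "E \<in> grid_sets M1 M2" "measure \<rho> (G n - E \<union> (E - G n)) < e / 2"
      using ap[of "e / 2" n] Union.prems by auto
    have Gs: "G n \<subseteq> (\<Union>i. a i)" by (auto simp: G_def)
    have "measure \<rho> ((\<Union>i. a i) - E \<union> (E - (\<Union>i. a i)))
        \<le> measure \<rho> ((G n - E \<union> (E - G n)) \<union> ((\<Union>i. a i) - G n))"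
      using a g[OF E(1)] Gs by (intro finite_measure_mono) auto
    also have "\<dots> \<le> measure \<rho> (G n - E \<union> (E - G n)) + measure \<rho> ((\<Union>i. a i) - G n)"
      using a g[OF E(1)] by (intro measure_Un_le) auto
    also have "measure \<rho> ((\<Union>i. a i) - G n) = measure \<rho> (\<Union>i. a i) - measure \<rho> (G n)"
      using a Gs by (intro finite_measure_Diff) auto
    finally show ?case using E(2) n by (intro bexI[OF _ E(1)]) linarith
  qed
qed

text \<open>For an inequality the Dynkin-class argument fails: the sets satisfying it need not be
  closed under complements. Approximation by disjoint unions of rectangles is used instead.\<close>

lemma emeasure_mono_of_rectangles:
  assumes \<rho>: "finite_measure \<rho>" "sets \<rho> = sets (M1 \<Otimes>\<^sub>M M2)"
    and s: "sets \<mu> = sets (M1 \<Otimes>\<^sub>M M2)" "sets \<nu> = sets (M1 \<Otimes>\<^sub>M M2)"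
    and dom: "\<And>A. A \<in> sets (M1 \<Otimes>\<^sub>M M2) \<Longrightarrow> emeasure \<mu> A \<le> emeasure \<rho> A"
      "\<And>A. A \<in> sets (M1 \<Otimes>\<^sub>M M2) \<Longrightarrow> emeasure \<nu> A \<le> emeasure \<rho> A"
    and le: "\<And>A B. A \<in> sets M1 \<Longrightarrow> B \<in> sets M2 \<Longrightarrow> emeasure \<nu> (A \<times> B) \<le> emeasure \<mu> (A \<times> B)"
    and D: "D \<in> sets (M1 \<Otimes>\<^sub>M M2)"
  shows "emeasure \<nu> D \<le> emeasure \<mu> D"
proof (rule ennreal_le_epsilon)
  fix e :: real assume e: "0 < e"
  interpret \<rho>: finite_measure \<rho> by fact
  \<comment> \<open>Because \<open>\<rho>\<close> dominates both measures, a single set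
    \<open>E\<close> is close to \<open>D\<close> for \<open>\<mu>\<close> and \<open>\<nu>\<close>
    at once.\<close>
  obtain E where E: "E \<in> grid_sets M1 M2" and small: "measure \<rho> (D - E \<union> (E - D)) < e / 2"
    using grid_sets_approx[OF \<rho> D, of "e / 2"] e by auto
  let ?X = "D - E \<union> (E - D)"
  have E': "E \<in> sets (M1 \<Otimes>\<^sub>M M2)" by (rule sets_grid_sets) fact
  then have X: "?X \<in> sets (M1 \<Otimes>\<^sub>M M2)" using D by auto
  have \<rho>X: "emeasure \<rho> ?X \<le> ennreal (e / 2)"
    using small by (simp add: \<rho>.emeasure_eq_measure ennreal_leI)
  have "emeasure \<nu> D \<le> emeasure \<nu> (E \<union> ?X)"
    using D E' s by (intro emeasure_mono) auto
  also have "\<dots> \<le> emeasure \<nu> E + emeasure \<nu> ?X"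
    using X E' s by (intro emeasure_subadditive) auto
  also have "\<dots> \<le> emeasure \<mu> E + ennreal (e / 2)"
    by (intro add_mono emeasure_grid_sets_mono[OF E s] le order_trans[OF dom(2)[OF X] \<rho>X])
  also have "emeasure \<mu> E \<le> emeasure \<mu> D + ennreal (e / 2)"
  proof -
    have "emeasure \<mu> E \<le> emeasure \<mu> (D \<union> ?X)"
      using D E' s by (intro emeasure_mono) auto
    also have "\<dots> \<le> emeasure \<mu> D + emeasure \<mu> ?X"
      using X D s by (intro emeasure_subadditive) auto
    also have "\<dots> \<le> emeasure \<mu> D + ennreal (e / 2)"
      by (intro add_mono order_refl order_trans[OF dom(1)[OF X] \<rho>X])
    finally show ?thesis .
  qed
  also have "emeasure \<mu> D + ennreal (e / 2) + ennreal (e / 2) = emeasure \<mu> D + ennreal e"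
    using e by (simp add: add.assoc flip: ennreal_plus)
  finally show "emeasure \<nu> D \<le> emeasure \<mu> D + ennreal e" by (simp add: add_right_mono)
qed

text \<open>Testing the hypothesis on the part of \<open>R\<close> where \<open>g\<close> exceeds
  \<open>c\<close> shows that the excess has integral zero.\<close>

lemma AE_le_of_nn_integral_le:
  fixes g :: "'a \<Rightarrow> ennreal"
  assumes [measurable]: "g \<in> borel_measurable M" "R \<in> sets M"
    and c: "c < top" and R: "emeasure M R < top"
    and le: "\<And>D. D \<in> sets M \<Longrightarrow> D \<subseteq> R \<Longrightarrow> (\<integral>\<^sup>+x\<in>D. g x \<partial>M) \<le> c * emeasure M D"
  shows "AE x in M. x \<in> R \<longrightarrow> g x \<le> c"
proof -
  define D where "D = {x \<in> R. c < g x}"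
  have D_sub: "D \<subseteq> R" by (auto simp: D_def)
  have "D = {x \<in> space M. x \<in> R \<and> c < g x}"
    using sets.sets_into_space[OF assms(2)] by (auto simp: D_def)
  then have [measurable]: "D \<in> sets M" by simp
  \<comment> \<open>Finiteness is what allows this term to be cancelled in
    \<open>ennreal\<close>.\<close>
  have fin: "c * emeasure M D < top"
    using c le_less_trans[OF emeasure_mono[OF D_sub, of M] R] by (simp add: ennreal_mult_less_top)
  have "(\<integral>\<^sup>+x. (g x - c) * indicator D x \<partial>M) + c * emeasure M D
      = (\<integral>\<^sup>+x. (g x - c) * indicator D x + c * indicator D x \<partial>M)"
    by (simp add: nn_integral_add nn_integral_cmult)
  also have "\<dots> = (\<integral>\<^sup>+x\<in>D. g x \<partial>M)"
    by (intro nn_integral_cong) (auto simp: D_def diff_add_cancel_ennreal split: split_indicator)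
  also have "\<dots> \<le> c * emeasure M D" by (intro le) (use D_sub in auto)
  finally have "c * emeasure M D + (\<integral>\<^sup>+x. (g x - c) * indicator D x \<partial>M) \<le> c * emeasure M D + 0"
    by (simp only: add.commute[of _ "c * emeasure M D"] add_0_right)
  then have "(\<integral>\<^sup>+x. (g x - c) * indicator D x \<partial>M) \<le> 0"
    unfolding ennreal_add_left_cancel_le using fin by auto
  then have "AE x in M. (g x - c) * indicator D x = 0"
    by (subst nn_integral_0_iff_AE[symmetric]) auto
  then show ?thesis
  proof eventually_elim
    case (elim x)
    show ?case
    proof (rule ccontr)
      assume "\<not> ?case"
      then have "c < g x" "x \<in> D" by (auto simp: D_def)
      then show False using elim ennreal_minus_eq_0[of "g x" c] by auto
    qed
  qed
qed

text \<open>Rectangle bounds compare the densities \<open>g\<close> and \<open>c\<close>; by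
  approximation they compare them on all measurable sets, where
  \<open>AE_le_of_nn_integral_le\<close> applies. Sigma-finite exhaustion reduces everything to a
  rectangle \<open>R\<close> of finite measure.\<close>

lemma AE_le_of_rectangles:
  fixes g :: "'a \<times> 'b \<Rightarrow> ennreal"
  assumes M: "sigma_finite_measure M1" "sigma_finite_measure M2"
    and X[measurable]: "X1 \<in> sets M1" "X2 \<in> sets M2"
    and g[measurable]: "g \<in> borel_measurable (M1 \<Otimes>\<^sub>M M2)" and c: "c < top"
    and le: "\<And>A B. A \<in> sets M1 \<Longrightarrow> B \<in> sets M2 \<Longrightarrow> A \<subseteq> X1 \<Longrightarrow> B \<subseteq> X2 \<Longrightarrow>
      emeasure M1 A < top \<Longrightarrow> emeasure M2 B < top \<Longrightarrow>
      (\<integral>\<^sup>+z\<in>A \<times> B. g z \<partial>(M1 \<Otimes>\<^sub>M M2)) \<le> c * (emeasure M1 A * emeasure M2 B)"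
  shows "AE z in M1 \<Otimes>\<^sub>M M2. z \<in> X1 \<times> X2 \<longrightarrow> g z \<le> c"
proof -
  interpret M1: sigma_finite_measure M1 by fact
  interpret M2: sigma_finite_measure M2 by fact
  interpret P: pair_sigma_finite M1 M2 ..
  let ?P = "M1 \<Otimes>\<^sub>M M2"
  obtain A where A: "range A \<subseteq> sets M1" "(\<Union>i. A i) = space M1" "\<And>i. emeasure M1 (A i) \<noteq> \<infinity>" "incseq A"
    using M1.sigma_finite_incseq by blast
  obtain B where B: "range B \<subseteq> sets M2" "(\<Union>i. B i) = space M2" "\<And>i. emeasure M2 (B i) \<noteq> \<infinity>" "incseq B"
    using M2.sigma_finite_incseq by blast
  have [measurable]: "A n \<in> sets M1" "B n \<in> sets M2" for n using A(1) B(1) by auto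
  have "AE z in ?P. z \<in> (A n \<inter> X1) \<times> (B n \<inter> X2) \<longrightarrow> g z \<le> c" for n
  proof (rule AE_le_of_nn_integral_le)
    define R where "R = (A n \<inter> X1) \<times> (B n \<inter> X2)"
    have [measurable]: "R \<in> sets ?P" by (simp add: R_def)
    have fin1: "emeasure M1 (C \<inter> (A n \<inter> X1)) < top" for C
    proof (rule le_less_trans[OF emeasure_mono])
      show "emeasure M1 (A n) < top" using A(3)[of n] unfolding infinity_ennreal_def less_top .
    qed auto
    have fin2: "emeasure M2 (C \<inter> (B n \<inter> X2)) < top" for C
    proof (rule le_less_trans[OF emeasure_mono])
      show "emeasure M2 (B n) < top" using B(3)[of n] unfolding infinity_ennreal_def less_top .
    qed auto
    have Rm: "emeasure ?P R = emeasure M1 (A n \<inter> X1) * emeasure M2 (B n \<inter> X2)"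
      unfolding R_def by (intro M2.emeasure_pair_measure_Times) auto
    then show R_fin: "emeasure ?P ((A n \<inter> X1) \<times> (B n \<inter> X2)) < top"
      using fin1[of UNIV] fin2[of UNIV] by (simp add: R_def ennreal_mult_less_top)
    fix D assume D[measurable]: "D \<in> sets ?P" and DR: "D \<subseteq> (A n \<inter> X1) \<times> (B n \<inter> X2)"
    define \<nu> where "\<nu> = density ?P (\<lambda>z. g z * indicator R z)"
    define \<mu> where "\<mu> = density ?P (\<lambda>z. c * indicator R z)"
    define \<rho> where "\<rho> = density ?P (\<lambda>z. (g z + c) * indicator R z)"
    \<comment> \<open>The rectangle \<open>R\<close> is itself a test set; this makes the dominating
      measure \<open>\<rho>\<close> finite.\<close>
    have gR: "(\<integral>\<^sup>+z\<in>R. g z \<partial>?P) \<le> c * emeasure ?P R"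
      unfolding Rm unfolding R_def by (rule le) (use fin1[of UNIV] fin2[of UNIV] in auto)
    have "emeasure \<nu> D \<le> emeasure \<mu> D"
    proof (rule emeasure_mono_of_rectangles)
      have "emeasure \<rho> (space \<rho>) = (\<integral>\<^sup>+z\<in>R. g z \<partial>?P) + c * emeasure ?P R"
        by (simp add: \<rho>_def emeasure_density nn_integral_add nn_integral_cmult distrib_right)
      also have "\<dots> < top"
        using gR R_fin c by (simp add: R_def[symmetric] ennreal_mult_less_top le_less_trans)
      finally show "finite_measure \<rho>" by (intro finite_measureI) simp
      show "emeasure \<mu> C \<le> emeasure \<rho> C" "emeasure \<nu> C \<le> emeasure \<rho> C" if [measurable]: "C \<in> sets ?P" for C
        unfolding \<mu>_def \<nu>_def \<rho>_def
        by (auto simp: emeasure_density intro!: nn_integral_mono split: split_indicator)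
      fix C E assume [measurable]: "C \<in> sets M1" "E \<in> sets M2"
      have ind: "indicator R z * indicator (C \<times> E) z
          = (indicator ((C \<inter> (A n \<inter> X1)) \<times> (E \<inter> (B n \<inter> X2))) z :: ennreal)" for z
        by (auto simp: R_def split: split_indicator)
      have "emeasure \<nu> (C \<times> E) = (\<integral>\<^sup>+z\<in>(C \<inter> (A n \<inter> X1)) \<times> (E \<inter> (B n \<inter> X2)). g z \<partial>?P)"
        by (simp add: \<nu>_def emeasure_density mult.assoc ind)
      also have "\<dots> \<le> c * (emeasure M1 (C \<inter> (A n \<inter> X1)) * emeasure M2 (E \<inter> (B n \<inter> X2)))"
        using fin1 fin2 by (intro le) auto
      also have "\<dots> = emeasure \<mu> (C \<times> E)"
        by (simp add: \<mu>_def emeasure_density mult.assoc ind nn_integral_cmult M2.emeasure_pair_measure_Times)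
      finally show "emeasure \<nu> (C \<times> E) \<le> emeasure \<mu> (C \<times> E)" .
    qed (simp_all add: \<mu>_def \<nu>_def \<rho>_def D)
    moreover have "indicator R z * indicator D z = (indicator D z :: ennreal)" for z
      using DR by (auto simp: R_def split: split_indicator)
    ultimately show "(\<integral>\<^sup>+z\<in>D. g z \<partial>?P) \<le> c * emeasure ?P D"
      by (simp add: \<mu>_def \<nu>_def emeasure_density mult.assoc nn_integral_cmult)
  qed (use c in simp_all)
  then have "AE z in ?P. \<forall>n. z \<in> (A n \<inter> X1) \<times> (B n \<inter> X2) \<longrightarrow> g z \<le> c"
    by (subst AE_all_countable) blast
  then show ?thesis
  proof eventually_elim
    case (elim z)
    show ?case
    proof
      assume z: "z \<in> X1 \<times> X2"
      then have "fst z \<in> space M1" "snd z \<in> space M2"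
        using X[THEN sets.sets_into_space] by auto
      then obtain i j where "fst z \<in> A i" "snd z \<in> B j" using A(2) B(2) by blast
      then have "fst z \<in> A (max i j)" "snd z \<in> B (max i j)"
        using A(4) B(4) by (meson incseqD max.cobounded1 max.cobounded2 subsetD)+
      then show "g z \<le> c" using z elim by (cases z) auto
    qed
  qed
qed

text \<open>Only one factor is differentiated at a time: the family of products of the \<open>\<B> j\<close> need not
  differentiate locally integrable functions of all variables.\<close>

lemma (in product_sigma_finite) AE_PiM_le:
  fixes g :: "('i \<Rightarrow> 'a) \<Rightarrow> ennreal"
  assumes "finite J"
    and "\<And>j. j \<in> J \<Longrightarrow> X j \<in> sets (M j)"
    and "\<And>j B. j \<in> J \<Longrightarrow> B \<in> \<B> j \<Longrightarrow> B \<in> sets (M j) \<and> emeasure (M j) B < top"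
    and "\<And>j h d. j \<in> J \<Longrightarrow> h \<in> borel_measurable (M j) \<Longrightarrow> d < top \<Longrightarrow>
      (\<And>B. B \<in> \<B> j \<Longrightarrow> (\<integral>\<^sup>+x\<in>B. h x \<partial>M j) \<le> d * emeasure (M j) B) \<Longrightarrow> AE x in M j. x \<in> X j \<longrightarrow> h x \<le> d"
    and "g \<in> borel_measurable (PiM J M)" and "c < top"
    and "\<And>B. (\<And>j. j \<in> J \<Longrightarrow> B j \<in> \<B> j) \<Longrightarrow>
      (\<integral>\<^sup>+w\<in>PiE J B. g w \<partial>PiM J M) \<le> c * (\<Prod>j\<in>J. emeasure (M j) (B j))"
  shows "AE w in PiM J M. w \<in> PiE J X \<longrightarrow> g w \<le> c"
  using assms
proof (induction J arbitrary: g c)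
  case empty
  from empty.prems(6)[of "\<lambda>_. {}"] have "g (\<lambda>_. undefined) \<le> c"
    by (simp add: PiM_empty nn_integral_count_space_finite)
  then show ?case by (auto simp: PiM_empty AE_count_space)
next
  case (insert j J)
  note [measurable] = insert.prems(4)
  have Xm[measurable]: "X j \<in> sets (M j)" "PiE J X \<in> sets (PiM J M)"
    using insert.prems(1) insert.hyps(1) by (auto intro!: sets_PiM_I_finite)
  interpret J: sigma_finite_measure "PiM J M" by (rule sigma_finite) fact
  interpret P: pair_sigma_finite "M j" "PiM J M" ..
  let ?P = "M j \<Otimes>\<^sub>M PiM J M"
  let ?u = "\<lambda>z. (snd z)(j := fst z)"
  have u[measurable]: "?u \<in> ?P \<rightarrow>\<^sub>M PiM (insert j J) M" by measurable
  have d: "distr ?P (PiM (insert j J) M) ?u = PiM (insert j J) M"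
    using distr_PiM_insert[OF insert.hyps] by (simp add: case_prod_unfold)
  have Bm: "B \<in> sets (M j)" "emeasure (M j) B < top" if "B \<in> \<B> j" for B
    using insert.prems(2)[of j] that by auto
  \<comment> \<open>Integrate the factor \<open>j\<close> over a basis set \<open>B\<close> and
    apply the induction hypothesis to the resulting function of the remaining variables, with
    constant \<open>c * emeasure (M j) B\<close>.\<close>
  have slab: "AE w in PiM J M. w \<in> PiE J X \<longrightarrow> (\<integral>\<^sup>+x\<in>B. g (w(j := x)) \<partial>M j) \<le> c * emeasure (M j) B"
    if B: "B \<in> \<B> j" for B
  proof (rule insert.IH)
    note [measurable] = Bm(1)[OF B]
    show "c * emeasure (M j) B < top" using insert.prems(5) Bm(2)[OF B] by (simp add: ennreal_mult_less_top)
    show "(\<lambda>w. \<integral>\<^sup>+x\<in>B. g (w(j := x)) \<partial>M j) \<in> borel_measurable (PiM J M)" by measurable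
    fix C assume C: "\<And>i. i \<in> J \<Longrightarrow> C i \<in> \<B> i"
    define C' where "C' = C(j := B)"
    have C': "C' i \<in> \<B> i" if "i \<in> insert j J" for i using that B C by (auto simp: C'_def)
    have Cm[measurable]: "PiE (insert j J) C' \<in> sets (PiM (insert j J) M)" "PiE J C \<in> sets (PiM J M)"
      using insert.prems(2) C C' insert.hyps(1) by (auto intro!: sets_PiM_I_finite)
    have "(\<integral>\<^sup>+w\<in>PiE J C. (\<integral>\<^sup>+x\<in>B. g (w(j := x)) \<partial>M j) \<partial>PiM J M)
        = (\<integral>\<^sup>+w. \<integral>\<^sup>+x. g (w(j := x)) * indicator (PiE (insert j J) C') (w(j := x)) \<partial>M j \<partial>PiM J M)"
    proof (intro nn_integral_cong)
      fix w assume w: "w \<in> space (PiM J M)"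
      have ind: "indicator (PiE (insert j J) C') (w(j := x)) = indicator B x * (indicator (PiE J C) w :: ennreal)" for x
        using w insert.hyps(2)
        by (auto simp: C'_def PiE_iff space_PiM extensional_def split: split_indicator if_splits) 
      show "(\<integral>\<^sup>+x\<in>B. g (w(j := x)) \<partial>M j) * indicator (PiE J C) w
          = (\<integral>\<^sup>+x. g (w(j := x)) * indicator (PiE (insert j J) C') (w(j := x)) \<partial>M j)"
        using w by (simp add: ind mult.assoc[symmetric] nn_integral_multc)
    qed
    also have "\<dots> = (\<integral>\<^sup>+w\<in>PiE (insert j J) C'. g w \<partial>PiM (insert j J) M)"
      using insert.hyps by (intro product_nn_integral_insert[symmetric]) auto
    also have "\<dots> \<le> c * (\<Prod>i\<in>insert j J. emeasure (M i) (C' i))"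
      by (intro insert.prems(6) C')
    also have "(\<Prod>i\<in>insert j J. emeasure (M i) (C' i)) = emeasure (M j) B * (\<Prod>i\<in>J. emeasure (M i) (C i))"
    proof -
      have "(\<Prod>i\<in>J. emeasure (M i) (C' i)) = (\<Prod>i\<in>J. emeasure (M i) (C i))"
        by (intro prod.cong) (use insert.hyps in \<open>auto simp: C'_def\<close>)
      then show ?thesis using insert.hyps by (simp add: C'_def)
    qed
    finally show "(\<integral>\<^sup>+w\<in>PiE J C. (\<integral>\<^sup>+x\<in>B. g (w(j := x)) \<partial>M j) \<partial>PiM J M)
        \<le> c * emeasure (M j) B * (\<Prod>i\<in>J. emeasure (M i) (C i))" by (simp only: mult.assoc)
  qed (use insert.prems in auto)
  have "AE z in ?P. z \<in> X j \<times> PiE J X \<longrightarrow> g (?u z) \<le> c"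
  proof (rule AE_le_of_rectangles)
    fix A D assume A[measurable]: "A \<in> sets (M j)" and D[measurable]: "D \<in> sets (PiM J M)"
      and AX: "A \<subseteq> X j" and DX: "D \<subseteq> PiE J X"
      and fin: "emeasure (M j) A < top" "emeasure (PiM J M) D < top"
    \<comment> \<open>Now the remaining variables are integrated over \<open>D\<close> and
      \<open>j\<close> is left free. By \<open>slab\<close> the averages of \<open>h\<close> over
      basis sets are bounded, so differentiation in the factor \<open>j\<close> alone bounds
      \<open>h\<close>.\<close>
    define h where "h x = (\<integral>\<^sup>+w\<in>D. g (w(j := x)) \<partial>PiM J M)" for x
    have [measurable]: "h \<in> borel_measurable (M j)" unfolding h_def by measurable
    have h: "AE x in M j. x \<in> X j \<longrightarrow> h x \<le> c * emeasure (PiM J M) D"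
    proof (rule insert.prems(3))
      show "c * emeasure (PiM J M) D < top" using fin insert.prems(5) by (simp add: ennreal_mult_less_top)
      fix B assume B: "B \<in> \<B> j"
      note [measurable] = Bm(1)[OF B]
      have "(\<integral>\<^sup>+x\<in>B. h x \<partial>M j) = (\<integral>\<^sup>+x. \<integral>\<^sup>+w. g (w(j := x)) * indicator D w * indicator B x \<partial>PiM J M \<partial>M j)"
        unfolding h_def by (intro nn_integral_cong nn_integral_multc[symmetric]) measurable
      also have "\<dots> = (\<integral>\<^sup>+w. \<integral>\<^sup>+x. g (w(j := x)) * indicator D w * indicator B x \<partial>M j \<partial>PiM J M)"
        by (rule P.Fubini'[symmetric]) measurable
      also have "\<dots> \<le> (\<integral>\<^sup>+w. c * emeasure (M j) B * indicator D w \<partial>PiM J M)"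
      proof (intro nn_integral_mono_AE, use slab[OF B] AE_space in eventually_elim)
        case (elim w)
        have "(\<integral>\<^sup>+x. g (w(j := x)) * indicator D w * indicator B x \<partial>M j)
            = (\<integral>\<^sup>+x\<in>B. g (w(j := x)) \<partial>M j) * indicator D w"
          by (auto split: split_indicator)
        also have "\<dots> \<le> c * emeasure (M j) B * indicator D w"
          using elim DX by (auto split: split_indicator)
        finally show ?case .
      qed
      also have "\<dots> = c * emeasure (PiM J M) D * emeasure (M j) B"
        by (subst nn_integral_cmult) (auto simp: ac_simps)
      finally show "(\<integral>\<^sup>+x\<in>B. h x \<partial>M j) \<le> c * emeasure (PiM J M) D * emeasure (M j) B" .
    qed auto
    have "(\<integral>\<^sup>+z\<in>A \<times> D. g (?u z) \<partial>?P) = (\<integral>\<^sup>+x. \<integral>\<^sup>+w. g (w(j := x)) * indicator D w * indicator A x \<partial>PiM J M \<partial>M j)"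
      by (subst J.nn_integral_fst[symmetric]) (auto simp: indicator_times ac_simps)
    also have "\<dots> = (\<integral>\<^sup>+x\<in>A. h x \<partial>M j)"
      unfolding h_def by (intro nn_integral_cong nn_integral_multc) measurable
    also have "\<dots> \<le> (\<integral>\<^sup>+x. c * emeasure (PiM J M) D * indicator A x \<partial>M j)"
    proof (intro nn_integral_mono_AE, use h in eventually_elim)
      case (elim x)
      then show ?case using AX by (auto split: split_indicator)
    qed
    also have "\<dots> = c * (emeasure (M j) A * emeasure (PiM J M) D)"
      by (subst nn_integral_cmult) (auto simp: ac_simps)
    finally show "(\<integral>\<^sup>+z\<in>A \<times> D. g (?u z) \<partial>?P) \<le> c * (emeasure (M j) A * emeasure (PiM J M) D)" .
  qed (use insert.prems Xm in \<open>auto intro: sigma_finite_measures J.sigma_finite_measure_axioms\<close>)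
  then have ae: "AE z in ?P. ?u z \<in> PiE (insert j J) X \<longrightarrow> g (?u z) \<le> c"
    using AE_space
  proof eventually_elim
    case (elim z)
    then show ?case using insert.hyps(2)
      by (cases z) (auto simp: PiE_iff space_pair_measure space_PiM extensional_def split: if_splits)
  qed
  have [measurable]: "PiE (insert j J) X \<in> sets (PiM (insert j J) M)"
    using insert.prems(1) insert.hyps(1) by (auto intro!: sets_PiM_I_finite)
  have "AE w in distr ?P (PiM (insert j J) M) ?u. w \<in> PiE (insert j J) X \<longrightarrow> g w \<le> c"
    using ae by (subst AE_distr_iff) auto
  then show ?case by (simp only: d)
qed

subsection \<open>Lebesgue measure on coordinate blocks\<close>

text \<open>The uncompleted product: its measurable functions have measurable sections, so Fubini
  and slicing are done here. \<open>leb\<close> is its completion.\<close>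

abbreviation lam :: "nat set \<Rightarrow> pt measure" where
  "lam I \<equiv> PiM I (\<lambda>_. lborel)"

interpretation lborel_family: product_sigma_finite "\<lambda>_::nat. lborel :: real measure"
  by (rule product_sigma_finite.intro) (rule lborel.sigma_finite_measure_axioms)

lemma sigma_finite_lam: "finite I \<Longrightarrow> sigma_finite_measure (lam I)"
  by (rule lborel_family.sigma_finite)

text \<open>Closed boxes are compact, so local integrability applies to them. Taking the corners
  extensional makes the family the image of a countable set.\<close>

definition rat_boxes :: "nat set \<Rightarrow> pt set set" where
  "rat_boxes I = (\<lambda>(a, b). PiE I (\<lambda>i. {a i..b i})) ` (PiE I (\<lambda>_. \<rat>) \<times> PiE I (\<lambda>_. \<rat>))"

lemma countable_rat_boxes: "finite I \<Longrightarrow> countable (rat_boxes I)"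
  unfolding rat_boxes_def
  by (intro countable_image countable_SIGMA countable_PiE countable_rat)

lemma sets_rat_boxes: "finite I \<Longrightarrow> C \<in> rat_boxes I \<Longrightarrow> C \<in> sets (lam I)"
  by (auto simp: rat_boxes_def intro!: sets_PiM_I_finite)

lemma compactin_rat_boxes: "C \<in> rat_boxes I \<Longrightarrow> compactin (Rtop I) C"
  by (auto simp: rat_boxes_def Rtop_def compactin_PiE)

lemma openin_Rtop_box:
  assumes I: "finite I" and S: "openin (Rtop I) S" and x: "x \<in> S"
  shows "\<exists>C\<in>rat_boxes I. x \<in> C \<and> C \<subseteq> S"
proof -
  obtain U where U: "\<And>i. i \<in> I \<Longrightarrow> open (U i)" "x \<in> PiE I U" "PiE I U \<subseteq> S"
    using S[unfolded Rtop_def openin_product_topology_alt, rule_format, OF x] by auto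
  have "\<exists>a b. a \<in> \<rat> \<and> b \<in> \<rat> \<and> a \<le> x i \<and> x i \<le> b \<and> {a..b} \<subseteq> U i" if i: "i \<in> I" for i
  proof -
    have "x i \<in> U i" using U(2) i by auto
    then obtain e where e: "0 < e" "ball (x i) e \<subseteq> U i"
      using U(1)[OF i] open_contains_ball by blast
    obtain a where a: "a \<in> \<rat>" "x i - e < a" "a < x i"
      using Rats_dense_in_real[of "x i - e" "x i"] e by auto
    obtain b where b: "b \<in> \<rat>" "x i < b" "b < x i + e"
      using Rats_dense_in_real[of "x i" "x i + e"] e by auto
    have "{a..b} \<subseteq> ball (x i) e" using a b by (auto simp: dist_real_def)
    then show ?thesis using a b e by (intro exI[of _ a] exI[of _ b]) auto
  qed
  then obtain a b where ab: "\<And>i. i \<in> I \<Longrightarrow> a i \<in> \<rat> \<and> b i \<in> \<rat> \<and> a i \<le> x i \<and> x i \<le> b i \<and> {a i..b i} \<subseteq> U i"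
    by metis
  define C where "C = PiE I (\<lambda>i. {a i..b i})"
  have "C = (\<lambda>(a, b). PiE I (\<lambda>i. {a i..b i})) (restrict a I, restrict b I)"
    unfolding C_def by (auto intro!: PiE_cong)
  moreover have "(restrict a I, restrict b I) \<in> PiE I (\<lambda>_. \<rat>) \<times> PiE I (\<lambda>_. \<rat>)" using ab by simp
  ultimately have "C \<in> rat_boxes I" unfolding rat_boxes_def by (rule image_eqI)
  moreover have "x \<in> C" using ab U(2) by (auto simp: C_def PiE_iff)
  moreover have "C \<subseteq> PiE I U" unfolding C_def using ab by (intro PiE_mono) auto
  ultimately show ?thesis using U(3) by (intro bexI[of _ C] conjI) auto
qed

lemma openin_Rtop_eq_Union_boxes:
  assumes "finite I" "openin (Rtop I) S"
  shows "S = \<Union>{C \<in> rat_boxes I. C \<subseteq> S}"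
proof
  show "S \<subseteq> \<Union>{C \<in> rat_boxes I. C \<subseteq> S}"
  proof
    fix x assume "x \<in> S"
    from openin_Rtop_box[OF assms this] obtain C where C: "C \<in> rat_boxes I" "x \<in> C" "C \<subseteq> S"
      by (elim bexE conjE)
    then show "x \<in> \<Union>{C \<in> rat_boxes I. C \<subseteq> S}" by (intro UnionI[of C] CollectI conjI)
  qed
qed auto

lemma sets_openin_Rtop:
  assumes "finite I" "openin (Rtop I) S"
  shows "S \<in> sets (lam I)"
proof -
  have "\<Union>{C \<in> rat_boxes I. C \<subseteq> S} \<in> sets (lam I)"
  proof (rule sets.countable_Union)
    show "countable {C \<in> rat_boxes I. C \<subseteq> S}"
      by (rule countable_subset[OF _ countable_rat_boxes[OF assms(1)]]) (rule Collect_subset)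
    show "{C \<in> rat_boxes I. C \<subseteq> S} \<subseteq> sets (lam I)"
      using sets_rat_boxes[OF assms(1)] by (intro subsetI) simp
  qed
  then show ?thesis
    using openin_Rtop_eq_Union_boxes[OF assms, symmetric] by (rule back_subst[of "\<lambda>X. X \<in> sets (lam I)"])
qed

text \<open>Lindeloef property: for each rational box that fits into some member of
  \<open>\<S>\<close>, keep one such member.\<close>

lemma Rtop_countable_subcover:
  assumes I: "finite I" and op: "\<And>S. S \<in> \<S> \<Longrightarrow> openin (Rtop I) S"
  obtains \<T> where "countable \<T>" "\<T> \<subseteq> \<S>" "\<Union>\<T> = \<Union>\<S>"
proof
  define \<B> where "\<B> = {C \<in> rat_boxes I. \<exists>S\<in>\<S>. C \<subseteq> S}"
  define s where "s C = (SOME S. S \<in> \<S> \<and> C \<subseteq> S)" for C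
  have s: "s C \<in> \<S>" "C \<subseteq> s C" if "C \<in> \<B>" for C
    using that someI_ex[of "\<lambda>S. S \<in> \<S> \<and> C \<subseteq> S"] by (auto simp: \<B>_def s_def)
  show "countable (s ` \<B>)"
    unfolding \<B>_def
    by (rule countable_image, rule countable_subset[OF _ countable_rat_boxes[OF I]], rule Collect_subset)
  show "s ` \<B> \<subseteq> \<S>" using s by auto
  show "\<Union>(s ` \<B>) = \<Union>\<S>"
  proof
    show "\<Union>\<S> \<subseteq> \<Union>(s ` \<B>)"
    proof
      fix x assume "x \<in> \<Union>\<S>"
      then obtain S where S: "S \<in> \<S>" "x \<in> S" by auto
      then obtain C where C: "C \<in> rat_boxes I" "x \<in> C" "C \<subseteq> S"
        using openin_Rtop_box[OF I op[OF S(1)] S(2)] by (elim bexE conjE)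
      then have "C \<in> \<B>" using S by (auto simp: \<B>_def)
      then show "x \<in> \<Union>(s ` \<B>)" using s(2)[of C] C(2) by auto
    qed
  qed (use s in auto)
qed

text \<open>Integrability over each member gives measurability there; countably many pieces glue to
  a function measurable for the completion, and such a function has a Borel version.\<close>

lemma borel_version_of_integrable_cover:
  fixes f :: "pt \<Rightarrow> real"
  assumes \<C>: "countable \<C>" "\<And>C. C \<in> \<C> \<Longrightarrow> C \<in> sets (lam I)"
    and f: "\<And>C. C \<in> \<C> \<Longrightarrow> set_integrable (leb I) C f"
  obtains g where "g \<in> borel_measurable (lam I)" "AE x in lam I. x \<in> \<Union>\<C> \<longrightarrow> f x = g x"
proof -
  define D where "D = \<Union>\<C>"
  have D: "D \<in> sets (lam I)" unfolding D_def using \<C> by (intro sets.countable_Union) auto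
  define h where "h x = indicator D x * f x" for x
  have sl: "sets (lam I) \<subseteq> sets (leb I)" by (auto simp: leb_def)
  have sp: "space (leb I) = space (lam I)" by (simp add: leb_def)
  \<comment> \<open>The complement of \<open>D\<close>, where \<open>h\<close> vanishes, is one
    additional piece of the partition argument.\<close>
  have "h \<in> borel_measurable (leb I)"
  proof (rule measurable_piecewise_restrict[of "insert (space (leb I) - D) \<C>"])
    show "countable (insert (space (leb I) - D) \<C>)" using \<C> by auto
    show "space (leb I) \<subseteq> \<Union>(insert (space (leb I) - D) \<C>)" by (auto simp: D_def)
    fix A assume A: "A \<in> insert (space (leb I) - D) \<C>"
    have "A \<in> sets (lam I)" using A
    proof
      assume "A = space (leb I) - D"
      then show ?thesis using D by (simp only: sp sets.compl_sets)
    qed (rule \<C>(2))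
    then have "A \<in> sets (leb I)" using sl by (rule subsetD[rotated])
    then show m: "A \<inter> space (leb I) \<in> sets (leb I)" by (rule sets.Int) (rule sets.top)
    show "h \<in> borel_measurable (restrict_space (leb I) A)"
    proof (cases "A \<in> \<C>")
      case True
      have "(\<lambda>x. indicator A x *\<^sub>R f x) \<in> borel_measurable (leb I)"
        using f[OF True] unfolding set_integrable_def by (rule borel_measurable_integrable)
      moreover have "(\<lambda>x. indicator A x *\<^sub>R h x) = (\<lambda>x. indicator A x *\<^sub>R f x)"
      proof
        fix x
        have "x \<in> A \<Longrightarrow> x \<in> D" using True by (auto simp: D_def)
        then show "indicator A x *\<^sub>R h x = indicator A x *\<^sub>R f x"
          by (cases "x \<in> A") (simp_all add: h_def)
      qed
      ultimately show ?thesis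
        by (subst borel_measurable_restrict_space_iff[OF m]) simp
    next
      case False
      then have "A = space (leb I) - D" using A by auto
      then have "h x = 0" if "x \<in> A" for x using that by (auto simp: h_def)
      then show ?thesis
        by (intro measurable_cong[THEN iffD2, OF _ borel_measurable_const[of 0]]) (simp add: space_restrict_space)
    qed
  qed
  then have "h \<in> borel_measurable (completion (lam I))" by (simp only: leb_def)
  from completion_ex_borel_measurable_real[OF this]
  obtain g where g: "g \<in> borel_measurable (lam I)" "AE x in lam I. h x = g x" by (elim bexE)
  show thesis
  proof (rule that[OF g(1)])
    show "AE x in lam I. x \<in> \<Union>\<C> \<longrightarrow> f x = g x"
      using g(2) by eventually_elim (simp add: h_def D_def[symmetric] indicator_def of_bool_def split: if_splits)
  qed
qed

locale coordinate_blocks =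
  fixes b :: "nat \<Rightarrow> nat set"
  assumes disj: "disjoint_family b" and fin: "\<And>j. finite (b j)"
begin

sublocale product_sigma_finite "\<lambda>j. lam (b j)"
  by (rule product_sigma_finite.intro) (intro sigma_finite_lam fin)

text \<open>Inverse to restricting a point to its blocks. The index set \<open>J\<close> is a
  parameter because the points of the remaining factors are glued too; \<open>undefined\<close>
  outside the blocks keeps points extensional.\<close>

definition glue :: "nat set \<Rightarrow> (nat \<Rightarrow> pt) \<Rightarrow> pt" where
  "glue J w = (\<lambda>c. if \<exists>j\<in>J. c \<in> b j then w (THE j. c \<in> b j) c else undefined)"

lemma glue_eq: "j \<in> J \<Longrightarrow> c \<in> b j \<Longrightarrow> glue J w c = w j c"
proof -
  assume j: "j \<in> J" "c \<in> b j"
  then have "(THE j. c \<in> b j) = j"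
    using disj by (intro the_equality) (auto simp: disjoint_family_on_def)
  then show ?thesis using j by (auto simp: glue_def)
qed

lemma glue_undefined: "c \<notin> (\<Union>j\<in>J. b j) \<Longrightarrow> glue J w c = undefined"
  by (auto simp: glue_def)

lemma restrict_glue:
  assumes "j \<in> J" "w j \<in> space (lam (b j))"
  shows "restrict (glue J w) (b j) = w j"
proof
  fix c show "restrict (glue J w) (b j) c = w j c"
    using assms by (cases "c \<in> b j") (auto simp: glue_eq space_PiM PiE_iff extensional_def)
qed

lemma measurable_glue[measurable]: "glue J \<in> PiM J (\<lambda>j. lam (b j)) \<rightarrow>\<^sub>M lam (\<Union>j\<in>J. b j)"
proof (rule measurable_PiM_single')
  fix c assume "c \<in> (\<Union>j\<in>J. b j)"
  then obtain j where j: "j \<in> J" "c \<in> b j" by auto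
  have 1: "(\<lambda>w. w j) \<in> PiM J (\<lambda>j. lam (b j)) \<rightarrow>\<^sub>M lam (b j)"
    using j(1) by (rule measurable_component_singleton)
  have 2: "(\<lambda>x. x c) \<in> lam (b j) \<rightarrow>\<^sub>M lborel"
    using j(2) by (rule measurable_component_singleton)
  have "(\<lambda>w. w j c) \<in> PiM J (\<lambda>j. lam (b j)) \<rightarrow>\<^sub>M lborel"
    by (rule measurable_compose[OF 1 2])
  then show "(\<lambda>w. glue J w c) \<in> PiM J (\<lambda>j. lam (b j)) \<rightarrow>\<^sub>M lborel"
    using j by (simp add: glue_eq)
qed (auto simp: PiE_iff extensional_def glue_undefined)

lemma distr_glue:
  assumes J: "finite J"
  shows "distr (PiM J (\<lambda>j. lam (b j))) (lam (\<Union>j\<in>J. b j)) (glue J) = lam (\<Union>j\<in>J. b j)"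
proof (rule lborel_family.PiM_eqI)
  show "finite (\<Union>j\<in>J. b j)" using J fin by auto
  fix A :: "nat \<Rightarrow> real set" assume A: "\<And>i. i \<in> (\<Union>j\<in>J. b j) \<Longrightarrow> A i \<in> sets lborel"
  have [measurable]: "PiE (\<Union>j\<in>J. b j) A \<in> sets (lam (\<Union>j\<in>J. b j))"
    using A J fin by (intro sets_PiM_I_finite) auto
  have blockA: "PiE (b j) A \<in> sets (lam (b j))" if "j \<in> J" for j
    using A fin that by (intro sets_PiM_I_finite) blast+
  have "glue J -` PiE (\<Union>j\<in>J. b j) A \<inter> space (PiM J (\<lambda>j. lam (b j))) = PiE J (\<lambda>j. PiE (b j) A)"
    by (auto simp: space_PiM PiE_iff glue_eq extensional_def glue_undefined)
  then have "emeasure (distr (PiM J (\<lambda>j. lam (b j))) (lam (\<Union>j\<in>J. b j)) (glue J)) (PiE (\<Union>j\<in>J. b j) A)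
      = (\<Prod>j\<in>J. emeasure (lam (b j)) (PiE (b j) A))"
    using A fin J by (subst emeasure_distr) (auto intro!: emeasure_PiM blockA)
  also have "\<dots> = (\<Prod>j\<in>J. \<Prod>c\<in>b j. emeasure lborel (A c))"
    using A fin by (intro prod.cong refl lborel_family.emeasure_PiM) auto
  also have "\<dots> = (\<Prod>c\<in>(\<Union>j\<in>J. b j). emeasure lborel (A c))"
    using J fin disj by (intro prod.UNION_disjoint[symmetric]) (auto simp: disjoint_family_on_def)
  finally show "emeasure (distr (PiM J (\<lambda>j. lam (b j))) (lam (\<Union>j\<in>J. b j)) (glue J)) (PiE (\<Union>j\<in>J. b j) A)
      = (\<Prod>c\<in>(\<Union>j\<in>J. b j). emeasure lborel (A c))" .
qed simp

end

lemma disjoint_blk: "disjoint_family (blk m)"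
proof -
  have *: "sum m {..<i} + m i \<le> sum m {..<j}" if "i < j" for i j
  proof -
    have "sum m {..<i} + m i = sum m {..<Suc i}" by simp
    also have "\<dots> \<le> sum m {..<j}" using that by (intro sum_mono2) auto
    finally show ?thesis .
  qed
  show ?thesis unfolding disjoint_family_on_def
  proof (intro ballI impI)
    fix i j :: nat assume "i \<noteq> j"
    then consider "i < j" | "j < i" by linarith
    then show "blk m i \<inter> blk m j = {}" using *[of i j] *[of j i] by cases (auto simp: blk_def)
  qed
qed

lemma UN_blk: "(\<Union>i<k. blk m i) = {..<sum m {..<k}}"
  by (induction k) (auto simp: lessThan_Suc blk_def)

subsection \<open>Oscillation with respect to the completed measure\<close>

lemma uniform_measure_distr:
  assumes T[measurable]: "T \<in> N \<rightarrow>\<^sub>M L" and S[measurable]: "S \<in> sets L"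
  shows "uniform_measure (distr N L T) S = distr (uniform_measure N (T -` S \<inter> space N)) L T"
proof (rule measure_eqI)
  fix A assume "A \<in> sets (uniform_measure (distr N L T) S)"
  then have [measurable]: "A \<in> sets L" by simp
  have "T -` S \<inter> space N \<inter> (T -` A \<inter> space N) = T -` (S \<inter> A) \<inter> space N" by auto
  then show "emeasure (uniform_measure (distr N L T) S) A
      = emeasure (distr (uniform_measure N (T -` S \<inter> space N)) L T) A"
    by (simp add: emeasure_distr)
qed simp

lemma borel_measurable_completion_AE:
  assumes g: "g \<in> borel_measurable (completion M)" and ae: "AE x in completion M. h x = g x"
  shows "h \<in> borel_measurable (completion M)"
proof (rule measurableI)
  fix B assume B: "B \<in> sets (borel :: 'b measure)"
  show "h -` B \<inter> space (completion M) \<in> sets (completion M)"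
  proof (rule completion.in_sets_AE)
    show "AE x in completion M. x \<in> g -` B \<inter> space (completion M) \<longleftrightarrow> x \<in> h -` B \<inter> space (completion M)"
      using ae by eventually_elim simp
    show "g -` B \<inter> space (completion M) \<in> sets (completion M)"
      using g B by (rule measurable_sets)
  qed simp
qed simp

text \<open>Measurability of \<open>f\<close> is not assumed: agreement with the Borel function
  \<open>g\<close> almost everywhere on \<open>S\<close> yields it by completeness.\<close>

lemma set_integrable_completion_iff:
  fixes f g :: "'a \<Rightarrow> real"
  assumes g[measurable]: "g \<in> borel_measurable M" and S[measurable]: "S \<in> sets M"
    and fg: "AE x in M. x \<in> S \<longrightarrow> f x = g x"
  shows "set_integrable (completion M) S f \<longleftrightarrow> set_integrable M S g"
    and "(LINT x:S|completion M. f x) = (LINT x:S|M. g x)"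
proof -
  have gS: "(\<lambda>x. indicator S x *\<^sub>R g x) \<in> borel_measurable M" by measurable
  have ae: "AE x in completion M. indicator S x *\<^sub>R f x = indicator S x *\<^sub>R g x"
    unfolding AE_completion_iff using fg
    by eventually_elim (auto split: split_indicator)
  have gS': "(\<lambda>x. indicator S x *\<^sub>R g x) \<in> borel_measurable (completion M)"
    using gS by (rule measurable_completion)
  have fS: "(\<lambda>x. indicator S x *\<^sub>R f x) \<in> borel_measurable (completion M)"
    using gS' ae by (rule borel_measurable_completion_AE)
  show "set_integrable (completion M) S f \<longleftrightarrow> set_integrable M S g"
    unfolding set_integrable_def integrable_cong_AE[OF fS gS' ae] by (rule integrable_completion[OF gS])
  show "(LINT x:S|completion M. f x) = (LINT x:S|M. g x)"
    unfolding set_lebesgue_integral_def integral_cong_AE[OF fS gS' ae] by (rule integral_completion[OF gS])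
qed

lemma uniform_measure_integral:
  fixes g :: "'a \<Rightarrow> real"
  assumes g[measurable]: "g \<in> borel_measurable M" and S[measurable]: "S \<in> sets M"
    and pos: "emeasure M S \<noteq> 0" and fin: "emeasure M S \<noteq> top"
  shows "integrable (uniform_measure M S) g \<longleftrightarrow> set_integrable M S g"
    and "integral\<^sup>L (uniform_measure M S) g = (LINT x:S|M. g x) / measure M S"
proof -
  have mpos: "0 < measure M S"
    using pos fin by (simp add: emeasure_eq_ennreal_measure zero_less_measure_iff)
  have U: "uniform_measure M S = density M (\<lambda>x. ennreal (indicator S x / measure M S))"
    unfolding uniform_measure_def
    using mpos fin by (intro density_cong)
      (auto simp: emeasure_eq_ennreal_measure divide_ennreal[symmetric] ennreal_indicator)
  have *: "(\<lambda>x. (indicator S x / measure M S) *\<^sub>R g x) = (\<lambda>x. inverse (measure M S) *\<^sub>R (indicator S x *\<^sub>R g x))"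
    by (simp add: divide_inverse fun_eq_iff)
  have "integrable (uniform_measure M S) g \<longleftrightarrow> integrable M (\<lambda>x. inverse (measure M S) * (indicator S x * g x))"
    unfolding U using mpos by (subst integrable_density) (simp_all only: *, auto)
  also have "\<dots> \<longleftrightarrow> set_integrable M S g"
    unfolding set_integrable_def using mpos by (subst integrable_mult_left_iff) auto
  finally show "integrable (uniform_measure M S) g \<longleftrightarrow> set_integrable M S g" .
  have "integral\<^sup>L (uniform_measure M S) g = (\<integral>x. inverse (measure M S) * (indicator S x * g x) \<partial>M)"
    unfolding U using mpos by (subst integral_density) (simp_all only: *, auto)
  then show "integral\<^sup>L (uniform_measure M S) g = (LINT x:S|M. g x) / measure M S"
    by (simp add: set_lebesgue_integral_def divide_inverse mult.commute)
qed

text \<open>\<open>enn2real\<close> sends infinity to 0, so only the finiteness conjunct excludes an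
  infinite \<open>X\<close> on the left.\<close>

lemma root_le_iff_le_powr:
  assumes "1 \<le> p" "0 \<le> K"
  shows "X < \<infinity> \<and> enn2real X powr (1 / p) \<le> K \<longleftrightarrow> X \<le> ennreal (K powr p)"
proof (cases "X < \<infinity>")
  case True
  then obtain x where x: "X = ennreal x" "0 \<le> x" by (cases X) auto
  have "x powr (1 / p) \<le> K \<longleftrightarrow> x \<le> K powr p"
  proof
    assume "x powr (1 / p) \<le> K"
    then have "(x powr (1 / p)) powr p \<le> K powr p" using assms by (intro powr_mono2) auto
    then show "x \<le> K powr p" using assms x by (simp add: powr_powr)
  next
    assume "x \<le> K powr p"
    then have "x powr (1 / p) \<le> (K powr p) powr (1 / p)" using assms x by (intro powr_mono2) auto
    then show "x powr (1 / p) \<le> K" using assms by (simp add: powr_powr)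
  qed
  then show ?thesis using x by simp
next
  case False
  then have "X = top" by (simp add: less_top[symmetric])
  then show ?thesis by (simp add: top_unique)
qed

lemma mean_osc_iff_osc_le:
  fixes f g :: "pt \<Rightarrow> real"
  assumes S[measurable]: "S \<in> sets (lam I)" and pos: "emeasure (lam I) S \<noteq> 0" "emeasure (lam I) S \<noteq> top"
    and g[measurable]: "g \<in> borel_measurable (lam I)" and fg: "AE x in lam I. x \<in> S \<longrightarrow> f x = g x"
    and p: "1 \<le> p" and K: "0 \<le> K"
  shows "set_integrable (leb I) S f \<and> mean_osc I p S f < \<infinity> \<and> enn2real (mean_osc I p S f) powr (1 / p) \<le> K
    \<longleftrightarrow> osc_le (uniform_measure (lam I) S) p g K"
proof -
  have em: "emeasure (leb I) S = emeasure (lam I) S" by (simp add: leb_def)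
  have av: "avg I S f = integral\<^sup>L (uniform_measure (lam I) S) g"
    unfolding avg_def leb_def using set_integrable_completion_iff(2)[OF g S fg] uniform_measure_integral(2)[OF g S pos]
    by simp
  define c where "c = integral\<^sup>L (uniform_measure (lam I) S) g"
  have "(\<integral>\<^sup>+x\<in>S. ennreal (\<bar>f x - c\<bar> powr p) \<partial>lam I) = (\<integral>\<^sup>+x\<in>S. ennreal (\<bar>g x - c\<bar> powr p) \<partial>lam I)"
    by (rule nn_integral_cong_AE, use fg in eventually_elim) (auto split: split_indicator)
  then have mo: "mean_osc I p S f = (\<integral>\<^sup>+x. ennreal (\<bar>g x - c\<bar> powr p) \<partial>uniform_measure (lam I) S)"
    unfolding mean_osc_def av c_def[symmetric] em unfolding leb_def nn_integral_completion
    by (subst nn_integral_uniform_measure) auto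
  have int: "set_integrable (leb I) S f \<longleftrightarrow> integrable (uniform_measure (lam I) S) g"
    unfolding leb_def set_integrable_completion_iff(1)[OF g S fg] uniform_measure_integral(1)[OF g S pos] ..
  show ?thesis
    unfolding osc_le_def int root_le_iff_le_powr[OF p K] mo c_def ..
qed

text \<open>The new factor has to be the inner variable, hence the pair is swapped before Fubini is
  applied to the null set.\<close>

lemma (in product_sigma_finite) AE_PiM_insert:
  assumes J: "finite J" "j \<notin> J" and ae: "AE w in PiM (insert j J) M. P w"
  shows "AE w in PiM J M. AE x in M j. P (w(j := x))"
proof -
  interpret J: sigma_finite_measure "PiM J M" by (rule sigma_finite) fact
  interpret P: pair_sigma_finite "M j" "PiM J M" ..
  interpret Q: pair_sigma_finite "PiM J M" "M j" ..
  have 1: "AE w in distr (M j \<Otimes>\<^sub>M PiM J M) (PiM (insert j J) M) (\<lambda>(x, X). X(j := x)). P w"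
    using ae unfolding distr_PiM_insert[OF J] .
  have "AE z in M j \<Otimes>\<^sub>M PiM J M. P ((\<lambda>(x, X). X(j := x)) z)"
    by (rule AE_distrD[OF _ 1]) measurable
  then have 2: "AE z in distr (PiM J M \<Otimes>\<^sub>M M j) (M j \<Otimes>\<^sub>M PiM J M) (\<lambda>(x, y). (y, x)). P ((\<lambda>(x, X). X(j := x)) z)"
    by (simp only: P.distr_pair_swap[symmetric])
  have "AE z in PiM J M \<Otimes>\<^sub>M M j. P ((\<lambda>(x, X). X(j := x)) ((\<lambda>(x, y). (y, x)) z))"
    by (rule AE_distrD[OF _ 2]) measurable
  from Q.AE_pair[OF this] show ?thesis by simp
qed

section \<open>BMO bounds, attained infima and essential suprema\<close>

lemma emeasure_leb: "S \<in> sets (lam I) \<Longrightarrow> emeasure (leb I) S = emeasure (lam I) S"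
  by (simp add: leb_def)

lemma is_shape_emeasure:
  assumes "finite I" "is_shape I S"
  shows "S \<in> sets (lam I)" "emeasure (lam I) S \<noteq> 0" "emeasure (lam I) S \<noteq> top"
proof -
  show S: "S \<in> sets (lam I)" using assms by (simp add: is_shape_def sets_openin_Rtop)
  show "emeasure (lam I) S \<noteq> 0" "emeasure (lam I) S \<noteq> top"
    using assms(2) unfolding is_shape_def emeasure_leb[OF S] by auto
qed

lemma bmo_bound_iff_osc_le:
  assumes I: "finite I" and \<S>: "shape_basis I D \<S>"
    and g: "g \<in> borel_measurable (lam I)" and fg: "AE x in lam I. x \<in> D \<longrightarrow> f x = g x"
    and p: "1 \<le> p" and K: "0 \<le> K"
  shows "bmo_bound I p \<S> f K \<longleftrightarrow> (\<forall>S\<in>\<S>. osc_le (uniform_measure (lam I) S) p g K)"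
proof -
  have "(set_integrable (leb I) S f \<and> mean_osc I p S f < \<infinity> \<and> enn2real (mean_osc I p S f) powr (1 / p) \<le> K)
    \<longleftrightarrow> osc_le (uniform_measure (lam I) S) p g K" if S: "S \<in> \<S>" for S
  proof (rule mean_osc_iff_osc_le)
    have sh: "is_shape I S" "S \<subseteq> D" using \<S> S by (auto simp: shape_basis_def)
    show "S \<in> sets (lam I)" "emeasure (lam I) S \<noteq> 0" "emeasure (lam I) S \<noteq> top"
      by (intro is_shape_emeasure I sh(1))+
    show "AE x in lam I. x \<in> S \<longrightarrow> f x = g x" using fg sh(2) by auto
  qed (use g p K in auto)
  then show ?thesis unfolding bmo_bound_def by blast
qed

text \<open>A single shape makes the set of bounds bounded below; with no shapes every real number
  would be a bound.\<close>

lemma BMO_norm_le: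
  assumes "\<S> \<noteq> {}" "bmo_bound I p \<S> f K"
  shows "BMO_norm I p \<S> f \<le> K"
  unfolding BMO_norm_def
proof (rule cInf_lower)
  obtain S where "S \<in> \<S>" using assms by auto
  then have "enn2real (mean_osc I p S f) powr (1 / p) \<le> K'" if "bmo_bound I p \<S> f K'" for K'
    using that by (auto simp: bmo_bound_def)
  then show "bdd_below {K. bmo_bound I p \<S> f K}" by (intro bdd_belowI) auto
qed (use assms in auto)

lemma bmo_bound_nonneg:
  assumes "\<S> \<noteq> {}" "bmo_bound I p \<S> f K"
  shows "0 \<le> K"
proof -
  obtain S where "S \<in> \<S>" using assms by auto
  then have "enn2real (mean_osc I p S f) powr (1 / p) \<le> K" using assms by (auto simp: bmo_bound_def)
  then show ?thesis using powr_ge_zero order_trans by blast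
qed

text \<open>The infimum is attained: the oscillation over each single shape is a lower bound of all
  admissible \<open>K\<close>, hence of their infimum.\<close>

lemma bmo_bound_BMO_norm:
  assumes "in_BMO I p \<S> f"
  shows "bmo_bound I p \<S> f (BMO_norm I p \<S> f)"
proof -
  obtain K where K: "bmo_bound I p \<S> f K" using assms by (auto simp: in_BMO_def)
  have "enn2real (mean_osc I p S f) powr (1 / p) \<le> BMO_norm I p \<S> f" if "S \<in> \<S>" for S
    unfolding BMO_norm_def using K that by (intro cInf_greatest) (auto simp: bmo_bound_def)
  then show ?thesis using K by (auto simp: bmo_bound_def)
qed

text \<open>The infimum over admissible bounds is the infimum of a sequence of them, so countably
  many null sets are enough.\<close>

lemma AE_le_ess_sup_on: "AE y in M. y \<in> A \<longrightarrow> g y \<le> ess_sup_on M A g"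
proof -
  let ?Z = "{z. AE y in M. y \<in> A \<longrightarrow> g y \<le> z}"
  have "top \<in> ?Z" by simp
  then have "?Z \<noteq> {}" by blast
  then obtain z :: "nat \<Rightarrow> ereal" where z: "range z \<subseteq> ?Z" "Inf ?Z = (INF i. z i)"
    using Inf_countable_INF[of ?Z] by blast
  have "AE y in M. \<forall>i. y \<in> A \<longrightarrow> g y \<le> z i"
    using z(1) by (subst AE_all_countable) auto
  then show ?thesis
    unfolding ess_sup_on_def z(2) by eventually_elim (auto intro: INF_greatest)
qed

lemma (in coordinate_blocks) join_glue:
  assumes "i \<in> J"
  shows "Defs.join (b i) x (glue (J - {i}) w) = glue J (w(i := x))"
proof
  fix c
  consider "c \<in> b i" | j where "j \<in> J - {i}" "c \<in> b j" | "c \<notin> (\<Union>j\<in>J. b j)" by blast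
  then show "Defs.join (b i) x (glue (J - {i}) w) c = glue J (w(i := x)) c"
  proof cases
    case 1
    then show ?thesis using assms by (simp add: Defs.join_def glue_eq)
  next
    case 2
    then have "c \<notin> b i" using disj by (auto simp: disjoint_family_on_def)
    then show ?thesis using 2 glue_eq[of j "J - {i}" c w] glue_eq[of j J c "w(i := x)"]
      by (auto simp: Defs.join_def)
  next
    case 3
    then have "c \<notin> b i" "c \<notin> (\<Union>j\<in>J - {i}. b j)" using assms by auto
    then show ?thesis using 3 by (simp only: Defs.join_def if_False glue_undefined not_False_eq_True)
  qed
qed

subsection \<open>From directional bounds to product shapes\<close>

locale product_bases =
  fixes k :: nat and m :: "nat \<Rightarrow> nat" and \<Omega> :: "nat \<Rightarrow> pt set" and \<S>i :: "nat \<Rightarrow> pt set set"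
  assumes basis_i: "\<And>i. i < k \<Longrightarrow> shape_basis (blk m i) (\<Omega> i) (\<S>i i)"
    and \<Omega>_ne: "\<And>i. i < k \<Longrightarrow> \<Omega> i \<noteq> {}"
begin

sublocale coordinate_blocks "blk m"
  by unfold_locales (auto simp: disjoint_blk blk_def)

definition "n = sum m {..<k}"

abbreviation "N J \<equiv> PiM J (\<lambda>j. lam (blk m j))"

abbreviation "others i \<equiv> {..<k} - {i}"

lemma open_\<Omega>: "i < k \<Longrightarrow> openin (Rtop (blk m i)) (\<Omega> i)"
proof -
  assume i: "i < k"
  have "openin (Rtop (blk m i)) (\<Union>(\<S>i i))"
    using basis_i[OF i] by (intro openin_Union) (simp add: shape_basis_def is_shape_def)
  then show ?thesis using basis_i[OF i] by (simp add: shape_basis_def)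
qed

lemma sets_\<Omega>: "i < k \<Longrightarrow> \<Omega> i \<in> sets (lam (blk m i))"
  by (intro sets_openin_Rtop fin open_\<Omega>)

lemma shape_i:
  assumes "i < k" "S \<in> \<S>i i"
  shows "S \<in> sets (lam (blk m i))" "emeasure (lam (blk m i)) S \<noteq> 0" "emeasure (lam (blk m i)) S \<noteq> top" "S \<subseteq> \<Omega> i"
proof -
  have "is_shape (blk m i) S" "S \<subseteq> \<Omega> i" using basis_i[OF assms(1)] assms(2) by (auto simp: shape_basis_def)
  then show "S \<in> sets (lam (blk m i))" "emeasure (lam (blk m i)) S \<noteq> 0" "emeasure (lam (blk m i)) S \<noteq> top" "S \<subseteq> \<Omega> i"
    using is_shape_emeasure[OF fin] by blast+
qed

lemma \<S>i_ne: "i < k \<Longrightarrow> \<S>i i \<noteq> {}"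
  using \<Omega>_ne[of i] basis_i[of i] by (auto simp: shape_basis_def)

lemma emeasure_\<Omega>_ne: assumes "i < k" shows "emeasure (lam (blk m i)) (\<Omega> i) \<noteq> 0"
proof -
  obtain S where S: "S \<in> \<S>i i" using \<S>i_ne[OF assms] by auto
  from emeasure_mono[OF shape_i(4)[OF assms S] sets_\<Omega>[OF assms]] shape_i(2)[OF assms S]
  show ?thesis by auto
qed

lemma UN_all: "(\<Union>j\<in>{..<k}. blk m j) = {..<n}"
  by (simp add: n_def UN_blk)

lemma UN_others:
  assumes "i < k"
  shows "(\<Union>j\<in>others i. blk m j) = co_idx n m i"
  unfolding co_idx_def UN_all[symmetric] using disj assms by (fastforce simp: disjoint_family_on_def)

lemma distr_glue_all: "distr (N {..<k}) (lam {..<n}) (glue {..<k}) = lam {..<n}"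
  using distr_glue[of "{..<k}"] by (simp only: UN_all finite_lessThan)

lemma measurable_glue_all[measurable]: "glue {..<k} \<in> N {..<k} \<rightarrow>\<^sub>M lam {..<n}"
  using measurable_glue[of "{..<k}"] by (simp only: UN_all)

lemma glue_mem_prod_set:
  assumes w: "w \<in> space (N {..<k})"
  shows "glue {..<k} w \<in> prod_set n m k A \<longleftrightarrow> w \<in> PiE {..<k} A"
proof -
  have "glue {..<k} w \<in> space (lam {..<n})" using measurable_space[OF measurable_glue_all w] .
  then have 1: "glue {..<k} w \<in> PiE {..<n} (\<lambda>_. UNIV)" by (simp add: space_PiM)
  have "w j \<in> space (lam (blk m j))" if "j < k" for j using w that by (auto simp: space_PiM PiE_iff)
  then have 2: "restrict (glue {..<k} w) (blk m j) = w j" if "j < k" for j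
    using restrict_glue[of j "{..<k}" w] that by simp
  have "w \<in> extensional {..<k}" using w by (simp add: space_PiM PiE_iff)
  then show ?thesis using 1 2 by (auto simp: prod_set_def PiE_iff)
qed

lemma insert_others: "i < k \<Longrightarrow> insert i (others i) = {..<k}" by auto

lemma AE_others:
  assumes i: "i < k" and ae: "AE y in leb (co_idx n m i). P y"
  shows "AE w in N (others i). P (glue (others i) w)"
proof -
  have "AE y in lam (\<Union>j\<in>others i. blk m j). P y"
    using ae unfolding leb_def AE_completion_iff UN_others[OF i] .
  then have "AE y in distr (N (others i)) (lam (\<Union>j\<in>others i. blk m j)) (glue (others i)). P y"
    unfolding distr_glue[OF finite_Diff[OF finite_lessThan]] .
  then show ?thesis by (rule AE_distrD[rotated]) measurable
qed

lemma glue_mem_co_dom: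
  assumes i: "i < k" and w: "w \<in> PiE (others i) \<Omega>"
  shows "glue (others i) w \<in> co_dom n m k \<Omega> i"
proof -
  have wj: "w j \<in> space (lam (blk m j))" "w j \<in> \<Omega> j" if "j < k" "j \<noteq> i" for j
    using sets.sets_into_space[OF sets_\<Omega>[OF that(1)]] w that by auto
  have "w \<in> space (N (others i))" using w wj by (auto simp: space_PiM PiE_iff)
  then have "glue (others i) w \<in> space (lam (\<Union>j\<in>others i. blk m j))"
    by (rule measurable_space[OF measurable_glue])
  then have "glue (others i) w \<in> PiE (co_idx n m i) (\<lambda>_. UNIV)"
    unfolding UN_others[OF i] by (simp add: space_PiM)
  then show ?thesis using wj restrict_glue[of _ "others i" w] by (auto simp: co_dom_def)
qed

text \<open>Without this the slices of \<open>f\<close> could not be exchanged for those of its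
  Borel version: Fubini slices the null set where they differ.\<close>

lemma AE_slices:
  assumes i: "i < k" and fg: "AE z in lam {..<n}. z \<in> prod_set n m k \<Omega> \<longrightarrow> f z = g z"
  shows "AE w in N (others i). AE x in lam (blk m i). w \<in> PiE (others i) \<Omega> \<longrightarrow> x \<in> \<Omega> i \<longrightarrow>
    f (glue {..<k} (w(i := x))) = g (glue {..<k} (w(i := x)))"
proof -
  have "AE z in distr (N {..<k}) (lam {..<n}) (glue {..<k}). z \<in> prod_set n m k \<Omega> \<longrightarrow> f z = g z"
    unfolding distr_glue_all by (rule fg)
  then have "AE v in N {..<k}. glue {..<k} v \<in> prod_set n m k \<Omega> \<longrightarrow> f (glue {..<k} v) = g (glue {..<k} v)"
    by (rule AE_distrD[rotated]) measurable
  then have "AE v in N {..<k}. v \<in> PiE {..<k} \<Omega> \<longrightarrow> f (glue {..<k} v) = g (glue {..<k} v)"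
    using AE_space by eventually_elim (simp add: glue_mem_prod_set)
  then have "AE v in N (insert i (others i)). v \<in> PiE {..<k} \<Omega> \<longrightarrow> f (glue {..<k} v) = g (glue {..<k} v)"
    unfolding insert_others[OF i] .
  then have *: "AE w in N (others i). AE x in lam (blk m i). w(i := x) \<in> PiE {..<k} \<Omega> \<longrightarrow>
      f (glue {..<k} (w(i := x))) = g (glue {..<k} (w(i := x)))"
    by (intro AE_PiM_insert) auto
  have "w(i := x) \<in> PiE {..<k} \<Omega>" if "w \<in> PiE (others i) \<Omega>" "x \<in> \<Omega> i" for w x
    using that i by (auto simp: PiE_iff extensional_def)
  note up = this
  from * show ?thesis
  proof eventually_elim
    case (elim w)
    then show ?case by eventually_elim (use up in blast)
  qed
qed

lemma slice_glue: "i < k \<Longrightarrow> slice m i f (glue (others i) w) = (\<lambda>x. f (glue {..<k} (w(i := x))))"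
  by (simp add: slice_def join_glue)

lemma emeasure_others_ne: "emeasure (N (others i)) (PiE (others i) \<Omega>) \<noteq> 0"
  by (subst emeasure_PiM) (auto simp: sets_\<Omega> emeasure_\<Omega>_ne)

lemma sets_PiE_\<Omega>: "PiE (others i) \<Omega> \<in> sets (N (others i))"
  by (intro sets_PiM_I_finite) (auto intro: sets_\<Omega>)

lemma dir_norm:
  assumes i: "i < k" and dir: "in_BMO_dir n m k \<Omega> p \<S>i i f"
  defines "c \<equiv> BMO_dir_norm n m k \<Omega> p \<S>i i f"
  shows "0 \<le> c"
    and "AE w in N (others i). w \<in> PiE (others i) \<Omega> \<longrightarrow>
      bmo_bound (blk m i) p (\<S>i i) (\<lambda>x. f (glue {..<k} (w(i := x)))) c"
proof -
  define E where "E = dir_ess_sup n m k \<Omega> p \<S>i i f"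
  have E: "E < \<infinity>" using dir by (simp add: in_BMO_dir_def E_def)
  have "AE w in N (others i). glue (others i) w \<in> co_dom n m k \<Omega> i \<longrightarrow> slice_norm m p \<S>i i f (glue (others i) w) \<le> E"
    using AE_others[OF i AE_le_ess_sup_on] unfolding E_def dir_ess_sup_def .
  then have ae: "AE w in N (others i). w \<in> PiE (others i) \<Omega> \<longrightarrow> slice_norm m p \<S>i i f (glue (others i) w) \<le> E"
    by eventually_elim (simp add: glue_mem_co_dom[OF i])
  have nn: "0 \<le> slice_norm m p \<S>i i f y" for y
    using bmo_bound_nonneg[OF \<S>i_ne[OF i] bmo_bound_BMO_norm] by (simp add: slice_norm_def)
  \<comment> \<open>An essential supremum over a null set would be minus infinity. Slice norms are
    nonnegative and the product of the domains has positive measure, so this cannot happen, and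
    \<open>real_of_ereal\<close> loses nothing.\<close>
  have "0 \<le> E"
  proof (rule ccontr)
    assume "\<not> 0 \<le> E"
    then have "\<not> slice_norm m p \<S>i i f y \<le> E" for y using nn[of y] by (meson order_trans)
    then have "AE w in N (others i). w \<notin> PiE (others i) \<Omega>" using ae by simp
    then have "emeasure (N (others i)) (PiE (others i) \<Omega>) = 0"
      by (subst (asm) AE_iff_measurable[OF sets_PiE_\<Omega>[of i]])
        (use sets.sets_into_space[OF sets_PiE_\<Omega>[of i]] in auto)
    then show False using emeasure_others_ne by simp
  qed
  with E obtain r where r: "E = ereal r" "0 \<le> r" by (cases E) auto
  then have "c = r" by (simp add: c_def BMO_dir_norm_def E_def[symmetric])
  with r have Ec: "E = ereal c" "0 \<le> c" by simp_all
  then show "0 \<le> c" by simp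
  show "AE w in N (others i). w \<in> PiE (others i) \<Omega> \<longrightarrow>
      bmo_bound (blk m i) p (\<S>i i) (\<lambda>x. f (glue {..<k} (w(i := x)))) c"
    using ae
  proof eventually_elim
    case (elim w)
    show ?case
    proof
      assume "w \<in> PiE (others i) \<Omega>"
      then have "slice_norm m p \<S>i i f (glue (others i) w) \<le> ereal c" using elim Ec by simp
      then have *: "in_BMO (blk m i) p (\<S>i i) (slice m i f (glue (others i) w))"
        "BMO_norm (blk m i) p (\<S>i i) (slice m i f (glue (others i) w)) \<le> c"
        by (auto simp: slice_norm_def split: if_splits)
      from bmo_bound_BMO_norm[OF *(1)] *(2)
      show "bmo_bound (blk m i) p (\<S>i i) (\<lambda>x. f (glue {..<k} (w(i := x)))) c"
        unfolding slice_glue[OF i] bmo_bound_def by (meson order_trans)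
    qed
  qed
qed

lemma sets_prod_set:
  assumes "\<And>i. i < k \<Longrightarrow> A i \<in> sets (lam (blk m i))"
  shows "prod_set n m k A \<in> sets (lam {..<n})"
proof -
  have sub: "blk m i \<subseteq> {..<n}" if "i < k" for i using that UN_all by blast
  have "prod_set n m k A = {x \<in> space (lam {..<n}). \<forall>i\<in>{..<k}. restrict x (blk m i) \<in> A i}"
    by (auto simp: prod_set_def space_PiM)
  also have "\<dots> \<in> sets (lam {..<n})"
  proof (intro sets.sets_Collect_finite_All)
    fix i assume "i \<in> {..<k}"
    then have "(\<lambda>x. restrict x (blk m i)) \<in> lam {..<n} \<rightarrow>\<^sub>M lam (blk m i)" "A i \<in> sets (lam (blk m i))"
      using sub assms by (auto intro!: measurable_restrict_subset)
    then show "{x \<in> space (lam {..<n}). restrict x (blk m i) \<in> A i} \<in> sets (lam {..<n})"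
      by measurable
  qed auto
  finally show ?thesis .
qed

lemma uniform_measure_prod_set:
  assumes A: "\<And>i. i < k \<Longrightarrow> A i \<in> sets (lam (blk m i))"
  shows "uniform_measure (lam {..<n}) (prod_set n m k A)
    = distr (uniform_measure (N {..<k}) (PiE {..<k} A)) (lam {..<n}) (glue {..<k})"
proof -
  have sub: "PiE {..<k} A \<subseteq> space (N {..<k})"
    using A by (intro sets.sets_into_space sets_PiM_I_finite) auto
  have "glue {..<k} -` prod_set n m k A \<inter> space (N {..<k}) = PiE {..<k} A"
    using glue_mem_prod_set[of _ A] sub by blast
  then show ?thesis
    using uniform_measure_distr[OF measurable_glue_all sets_prod_set[OF A]] by (simp only: distr_glue_all)
qed

end

lemma loc_intD: "loc_int I D f \<Longrightarrow> compactin (Rtop I) K \<Longrightarrow> K \<subseteq> D \<Longrightarrow> set_integrable (leb I) K f"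
  unfolding loc_int_def by (elim allE impE) (intro conjI)

context product_bases begin

lemma prod_set_ne: "prod_set n m k \<Omega> \<noteq> {}"
proof -
  have "PiE {..<k} \<Omega> \<noteq> {}" using \<Omega>_ne by (simp add: PiE_eq_empty_iff)
  then obtain w where w: "w \<in> PiE {..<k} \<Omega>" by auto
  have "w \<in> space (N {..<k})"
    using w sets.sets_into_space[OF sets_\<Omega>] by (fastforce simp: space_PiM[of "{..<k}"] PiE_iff[of _ "{..<k}"])
  then show ?thesis using w glue_mem_prod_set[of w \<Omega>] by auto
qed

lemma loc_int_borel_version:
  assumes op: "openin (Rtop {..<n}) D" and f: "loc_int {..<n} D f"
  obtains g where "g \<in> borel_measurable (lam {..<n})" "AE x in lam {..<n}. x \<in> D \<longrightarrow> f x = g x"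
proof -
  define \<C> where "\<C> = {C \<in> rat_boxes {..<n}. C \<subseteq> D}"
  have D: "\<Union>\<C> = D" unfolding \<C>_def using openin_Rtop_eq_Union_boxes[OF finite_lessThan op] by (rule sym)
  have 1: "countable \<C>"
    unfolding \<C>_def by (rule countable_subset[OF Collect_subset countable_rat_boxes[OF finite_lessThan]])
  have 2: "C \<in> sets (lam {..<n})" "set_integrable (leb {..<n}) C f" if "C \<in> \<C>" for C
  proof -
    have C: "C \<in> rat_boxes {..<n}" "C \<subseteq> D" using that by (simp_all add: \<C>_def)
    show "C \<in> sets (lam {..<n})" by (rule sets_rat_boxes[OF finite_lessThan C(1)])
    show "set_integrable (leb {..<n}) C f"
      by (rule loc_intD[OF f compactin_rat_boxes[OF C(1)] C(2)])
  qed
  show thesis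
  proof (rule borel_version_of_integrable_cover)
    show "countable \<C>" by (rule 1)
    fix g assume "g \<in> borel_measurable (lam {..<n})" "AE x in lam {..<n}. x \<in> \<Union>\<C> \<longrightarrow> f x = g x"
    then show thesis unfolding D by (rule that)
  qed (rule 2, assumption)+
qed

text \<open>A product shape is, after normalisation, a product of probability spaces, to which
  \<open>osc_le_PiM\<close> applies. Its almost everywhere hypothesis holds because the essential
  supremum controls the norms of almost all slices.\<close>

lemma BMO_of_directional:
  assumes p: "1 \<le> p" and k: "0 < k"
    and \<S>: "shape_basis {..<n} (prod_set n m k \<Omega>) \<S>"
    and weak: "weak_decomp n m k \<S> \<S>i"
    and dir: "\<And>i. i < k \<Longrightarrow> in_BMO_dir n m k \<Omega> p \<S>i i f"
  shows "in_BMO {..<n} p \<S> f \<and> BMO_norm {..<n} p \<S> f \<le> (\<Sum>i<k. BMO_dir_norm n m k \<Omega> p \<S>i i f)"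
proof -
  define c where "c i = BMO_dir_norm n m k \<Omega> p \<S>i i f" for i
  have c: "0 \<le> c i" if "i < k" for i using dir_norm(1)[OF that dir[OF that]] by (simp add: c_def)
  have op: "openin (Rtop {..<n}) (prod_set n m k \<Omega>)"
  proof -
    have "openin (Rtop {..<n}) (\<Union>\<S>)"
      using \<S> by (intro openin_Union) (simp add: shape_basis_def is_shape_def)
    then show ?thesis using \<S> by (simp add: shape_basis_def)
  qed
  have "loc_int {..<n} (prod_set n m k \<Omega>) f" using dir[OF k] by (simp add: in_BMO_dir_def)
  then obtain g where g[measurable]: "g \<in> borel_measurable (lam {..<n})"
    and fg: "AE x in lam {..<n}. x \<in> prod_set n m k \<Omega> \<longrightarrow> f x = g x"
    by (rule loc_int_borel_version[OF op]) (rule that)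
  have gm: "(\<lambda>x. g (glue {..<k} (w(i := x)))) \<in> borel_measurable (lam (blk m i))"
    if "i < k" "w \<in> space (N (others i))" for i w
  proof -
    have "(\<lambda>x. w(i := x)) \<in> lam (blk m i) \<rightarrow>\<^sub>M N (insert i (others i))"
      using that(2) by measurable
    then have [measurable]: "(\<lambda>x. w(i := x)) \<in> lam (blk m i) \<rightarrow>\<^sub>M N {..<k}"
      unfolding insert_others[OF that(1)] .
    show ?thesis by measurable
  qed
  have "osc_le (uniform_measure (lam {..<n}) S) p g (\<Sum>i<k. c i)" if S: "S \<in> \<S>" for S
  proof -
    obtain A where A0: "\<forall>i<k. A i \<in> \<S>i i" and SA: "S = prod_set n m k A"
      using bspec[OF weak[unfolded weak_decomp_def] S] by (elim exE conjE)
    have A: "A i \<in> \<S>i i" if "i < k" for i using A0 that by simp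
    define P where "P i = uniform_measure (lam (blk m i)) (A i)" for i
    have PN: "PiM J P = uniform_measure (N J) (PiE J A)" if "J \<subseteq> {..<k}" for J
      unfolding P_def using that shape_i A by (intro PiM_uniform_measure) (auto intro: finite_subset)
    have AJ: "PiE J A \<in> sets (N J)" if "J \<subseteq> {..<k}" for J
      using that shape_i A by (intro sets_PiM_I_finite) (auto intro: finite_subset)
    have "osc_le (PiM {..<k} P) p (\<lambda>w. g (glue {..<k} w)) (\<Sum>i<k. c i)"
    proof (rule osc_le_PiM)
      show "prob_space (P i)" if "i \<in> {..<k}" for i
        unfolding P_def using that shape_i[OF _ A] by (intro prob_space_uniform_measure) auto
      show "(\<lambda>w. g (glue {..<k} w)) \<in> borel_measurable (PiM {..<k} P)"
      proof -
        have "(\<lambda>w. g (glue {..<k} w)) \<in> borel_measurable (N {..<k})" by measurable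
        then show ?thesis by (simp add: PN)
      qed
      fix i assume "i \<in> {..<k}"
      then have i: "i < k" by simp
      have sub: "PiE (others i) A \<subseteq> PiE (others i) \<Omega>"
        using shape_i(4)[OF _ A] by (intro PiE_mono) auto
      have "AE w in N (others i). w \<in> PiE (others i) A \<longrightarrow>
          osc_le (P i) p (\<lambda>x. g (glue {..<k} (w(i := x)))) (c i)"
        using dir_norm(2)[OF i dir[OF i]] AE_slices[OF i fg] AE_space
      proof eventually_elim
        case (elim w)
        show ?case
        proof
          assume "w \<in> PiE (others i) A"
          then have w: "w \<in> PiE (others i) \<Omega>" using sub by auto
          then have ae: "AE x in lam (blk m i). x \<in> \<Omega> i \<longrightarrow> f (glue {..<k} (w(i := x))) = g (glue {..<k} (w(i := x)))"
            using elim(2) by simp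
          have "bmo_bound (blk m i) p (\<S>i i) (\<lambda>x. f (glue {..<k} (w(i := x)))) (c i)"
            using elim(1) w by (simp add: c_def)
          then show "osc_le (P i) p (\<lambda>x. g (glue {..<k} (w(i := x)))) (c i)"
            unfolding P_def bmo_bound_iff_osc_le[OF fin basis_i[OF i] gm[OF i elim(3)] ae p c[OF i]]
            by (rule bspec) (rule A[OF i])
        qed
      qed
      \<comment> \<open>The product of the other normalised measures is Lebesgue measure restricted
        to a box and rescaled, so it inherits the exceptional null set.\<close>
      then show "AE w in PiM (others i) P. osc_le (P i) p (\<lambda>x. g (glue {..<k} (w(i := x)))) (c i)"
        unfolding PN[OF Diff_subset] by (intro AE_uniform_measureI AJ) auto
    qed (use p c in auto)
    then have "osc_le (uniform_measure (N {..<k}) (PiE {..<k} A)) p (\<lambda>w. g (glue {..<k} w)) (\<Sum>i<k. c i)"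
      by (simp only: PN[OF order_refl])
    then show ?thesis
      unfolding SA using uniform_measure_prod_set[of A] shape_i(1)[OF _ A]
      by (simp add: osc_le_distr)
  qed
  then have b: "bmo_bound {..<n} p \<S> f (\<Sum>i<k. c i)"
    using c by (subst bmo_bound_iff_osc_le[OF finite_lessThan \<S> g fg p]) (auto intro: sum_nonneg)
  have "\<S> \<noteq> {}" using \<S> prod_set_ne by (auto simp: shape_basis_def)
  from BMO_norm_le[OF this b] b show ?thesis by (auto simp: in_BMO_def c_def)
qed

end

subsection \<open>From product shapes to directional bounds\<close>

text \<open>Origin of the constant. After subtracting \<open>a\<close>, convexity gives the factor
  \<open>2 powr p / 2\<close> for the function and for its mean, and Jensen bounds the mean by the
  function. For \<open>p = 2\<close> the variance is at most the second moment.\<close>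

lemma (in prob_space) nn_integral_mean_le_const:
  assumes p: "1 \<le> p" and Q: "Q = 2 \<or> p = 2 \<and> Q = (1::real)"
    and u[measurable]: "u \<in> borel_measurable M"
  shows "(\<integral>\<^sup>+x. ennreal (\<bar>u x - expectation u\<bar> powr p) \<partial>M)
    \<le> ennreal (Q powr p) * (\<integral>\<^sup>+x. ennreal (\<bar>u x - a\<bar> powr p) \<partial>M)"
proof (cases "(\<integral>\<^sup>+x. ennreal (\<bar>u x - a\<bar> powr p) \<partial>M) < \<infinity>")
  case False
  have "0 < Q powr p" using Q by auto
  then show ?thesis using False by (simp add: not_less top_unique ennreal_mult_top)
next
  case True
  define v where "v x = u x - a" for x
  have v: "integrable M v"
    using integrable_of_powr[OF p _ True] by (simp add: v_def[abs_def])
  have uv: "u x = v x + a" for x by (simp add: v_def)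
  have "expectation u = expectation v + a"
    unfolding uv using v by (simp add: prob_space)
  then have diff: "u x - expectation u = v x - expectation v" for x by (simp add: uv)
  have J: "ennreal (\<bar>expectation v\<bar> powr p) \<le> (\<integral>\<^sup>+x. ennreal (\<bar>v x\<bar> powr p) \<partial>M)"
    by (rule jensen_powr[OF p v])
  have [measurable]: "v \<in> borel_measurable M" using v by auto
  have goal: "(\<integral>\<^sup>+x. ennreal (\<bar>v x - expectation v\<bar> powr p) \<partial>M)
      \<le> ennreal (Q powr p) * (\<integral>\<^sup>+x. ennreal (\<bar>v x\<bar> powr p) \<partial>M)"
    using Q
  proof
    assume Q2: "Q = 2"
    have "(\<integral>\<^sup>+x. ennreal (\<bar>v x - expectation v\<bar> powr p) \<partial>M)
        \<le> (\<integral>\<^sup>+x. ennreal (2 powr p / 2) * ennreal (\<bar>v x\<bar> powr p) + ennreal (2 powr p / 2) * ennreal (\<bar>expectation v\<bar> powr p) \<partial>M)"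
    proof (rule nn_integral_mono)
      fix x
      have "\<bar>v x - expectation v\<bar> powr p = \<bar>1 / 2 * (2 * v x) + 1 / 2 * (- 2 * expectation v)\<bar> powr p"
        by simp
      also have "\<dots> \<le> 1 / 2 * \<bar>2 * v x\<bar> powr p + 1 / 2 * \<bar>- 2 * expectation v\<bar> powr p"
        by (rule abs_powr_convex[OF p]) auto
      also have "\<dots> = 2 powr p / 2 * \<bar>v x\<bar> powr p + 2 powr p / 2 * \<bar>expectation v\<bar> powr p"
        by (simp add: abs_mult powr_mult)
      finally show "ennreal (\<bar>v x - expectation v\<bar> powr p)
          \<le> ennreal (2 powr p / 2) * ennreal (\<bar>v x\<bar> powr p) + ennreal (2 powr p / 2) * ennreal (\<bar>expectation v\<bar> powr p)"
        by (simp add: ennreal_leI flip: ennreal_mult ennreal_plus)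
    qed
    also have "\<dots> = ennreal (2 powr p / 2) * (\<integral>\<^sup>+x. ennreal (\<bar>v x\<bar> powr p) \<partial>M) + ennreal (2 powr p / 2) * ennreal (\<bar>expectation v\<bar> powr p)"
      by (subst nn_integral_add) (simp_all add: nn_integral_cmult emeasure_space_1)
    also have "\<dots> \<le> ennreal (2 powr p / 2) * (\<integral>\<^sup>+x. ennreal (\<bar>v x\<bar> powr p) \<partial>M)
        + ennreal (2 powr p / 2) * (\<integral>\<^sup>+x. ennreal (\<bar>v x\<bar> powr p) \<partial>M)"
      by (intro add_mono mult_left_mono J) auto
    also have "\<dots> = ennreal (2 powr p) * (\<integral>\<^sup>+x. ennreal (\<bar>v x\<bar> powr p) \<partial>M)"
      unfolding distrib_right[symmetric] by (subst ennreal_plus[symmetric]) auto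
    finally show ?thesis unfolding Q2 .
  next
    assume Q1: "p = 2 \<and> Q = 1"
    have sq: "\<bar>t\<bar> powr p = t\<^sup>2" for t :: real using Q1 by (cases "t = 0") auto
    have i: "integrable M (\<lambda>x. (v x)\<^sup>2)"
    proof (rule integrableI_bounded)
      show "(\<integral>\<^sup>+x. ennreal (norm ((v x)\<^sup>2)) \<partial>M) < \<infinity>" using True by (simp add: v_def sq)
    qed simp
    have i': "integrable M (\<lambda>x. (v x - expectation v)\<^sup>2)"
      using i v by (simp add: power2_diff)
    have "(\<integral>x. (v x - expectation v)\<^sup>2 \<partial>M) \<le> (\<integral>x. (v x)\<^sup>2 \<partial>M)"
      using variance_eq[OF v i] by simp
    then show ?thesis
      using i i' Q1 by (simp add: sq nn_integral_eq_integral ennreal_leI)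
  qed
  show ?thesis unfolding diff using goal by (simp add: v_def)
qed

lemma set_nn_integral_mean_le_const:
  fixes u :: "'a \<Rightarrow> real"
  assumes p: "1 \<le> p" and Q: "Q = 2 \<or> p = 2 \<and> Q = (1::real)"
    and u[measurable]: "u \<in> borel_measurable M"
    and E[measurable]: "E \<in> sets M" and pos: "emeasure M E \<noteq> 0" "emeasure M E \<noteq> top"
  shows "(\<integral>\<^sup>+x\<in>E. ennreal (\<bar>u x - (LINT x:E|M. u x) / measure M E\<bar> powr p) \<partial>M)
    \<le> ennreal (Q powr p) * (\<integral>\<^sup>+x\<in>E. ennreal (\<bar>u x - a\<bar> powr p) \<partial>M)"
proof -
  interpret U: prob_space "uniform_measure M E" using pos by (intro prob_space_uniform_measure) auto
  have *: "(\<integral>\<^sup>+x\<in>E. h x \<partial>M) = emeasure M E * (\<integral>\<^sup>+x. h x \<partial>uniform_measure M E)"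
    if [measurable]: "h \<in> borel_measurable M" for h
    using pos by (subst nn_integral_uniform_measure) (auto simp: ennreal_times_divide mult_divide_eq_ennreal mult.commute[of "emeasure M E"])
  have "u \<in> borel_measurable (uniform_measure M E)" by simp
  from U.nn_integral_mean_le_const[OF p Q this, of a]
  have "emeasure M E * (\<integral>\<^sup>+x. ennreal (\<bar>u x - integral\<^sup>L (uniform_measure M E) u\<bar> powr p) \<partial>uniform_measure M E)
      \<le> emeasure M E * (ennreal (Q powr p) * (\<integral>\<^sup>+x. ennreal (\<bar>u x - a\<bar> powr p) \<partial>uniform_measure M E))"
    by (rule mult_left_mono) simp
  then show ?thesis
    unfolding uniform_measure_integral(2)[OF u E pos] by (simp add: * mult.left_commute)
qed

text \<open>The centres move with \<open>j\<close>, and integrability on the union is part of the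
  claim. Fatou is therefore used twice: with the fixed centre \<open>a 0\<close> to get
  integrability, then, once the means are known to converge, with the moving centres.\<close>

lemma osc_bound_exhaustion:
  fixes u :: "'a \<Rightarrow> real" and E :: "nat \<Rightarrow> 'a set"
  assumes p: "1 \<le> p" and u[measurable]: "u \<in> borel_measurable M"
    and E[measurable]: "\<And>j. E j \<in> sets M" and inc: "incseq E"
    and pos: "emeasure M (E 0) \<noteq> 0" and fin: "emeasure M (\<Union>j. E j) \<noteq> top" and c: "c < top"
    and le: "\<And>j. (\<integral>\<^sup>+x\<in>E j. ennreal (\<bar>u x - (LINT x:E j|M. u x) / measure M (E j)\<bar> powr p) \<partial>M) \<le> c"
  shows "set_integrable M (\<Union>j. E j) u" (is "set_integrable M ?S u")
    and "(\<integral>\<^sup>+x\<in>\<Union>j. E j. ennreal (\<bar>u x - (LINT x:(\<Union>j. E j)|M. u x) / measure M (\<Union>j. E j)\<bar> powr p) \<partial>M) \<le> c"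
proof -
  define a where "a j = (LINT x:E j|M. u x) / measure M (E j)" for j
  have S[measurable]: "?S \<in> sets M" by measurable
  have E0: "E 0 \<subseteq> E j" for j using inc by (simp add: incseqD)
  have posE: "emeasure M (E j) \<noteq> 0" for j using emeasure_mono[OF E0[of j] E] pos by auto
  have finE: "emeasure M (E j) \<noteq> top" for j
    using emeasure_mono[of "E j" ?S M] fin S by (metis UN_upper UNIV_I top_unique)
  have posS: "emeasure M ?S \<noteq> 0" using emeasure_mono[OF UN_upper[of 0 UNIV E, OF UNIV_I] S] pos by auto
  have prob: "prob_space (uniform_measure M (E j))" for j
    using posE finE by (intro prob_space_uniform_measure) auto
  have U: "(\<integral>\<^sup>+x. h x \<partial>uniform_measure M A) < top"
    if "(\<integral>\<^sup>+x\<in>A. h x \<partial>M) < top" "emeasure M A \<noteq> 0" "A \<in> sets M" "h \<in> borel_measurable M" for h A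
    using that by (subst nn_integral_uniform_measure) (auto simp: ennreal_divide_eq_top_iff less_top[symmetric])
  \<comment> \<open>Any constant at finite p-distance proves integrability, so it does not matter
    here whether \<open>a j\<close> is a genuine mean.\<close>
  have intE: "integrable (uniform_measure M (E j)) u" for j
  proof -
    interpret prob_space "uniform_measure M (E j)" by (rule prob)
    have "(\<integral>\<^sup>+x. ennreal (\<bar>u x - a j\<bar> powr p) \<partial>uniform_measure M (E j)) < \<infinity>"
      using le_less_trans[OF le[of j] c] posE[of j] unfolding a_def infinity_ennreal_def by (intro U) auto
    then have "integrable (uniform_measure M (E j)) (\<lambda>x. u x - a j)"
      by (intro integrable_of_powr[OF p]) auto
    from Bochner_Integration.integrable_add[OF this integrable_const[of "a j"]] show ?thesis by simp
  qed
  have a_eq: "a j = integral\<^sup>L (uniform_measure M (E j)) u" for j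
    unfolding a_def using uniform_measure_integral(2)[OF u E posE finE] by simp
  define b where "b = c / emeasure M (E 0)"
  have b: "b < top" using c pos by (simp add: b_def ennreal_divide_eq_top_iff less_top[symmetric])
  \<comment> \<open>The smallest set \<open>E 0\<close> lies in every \<open>E j\<close>, so by
    Jensen on \<open>E 0\<close> the means stay within a bounded distance of
    \<open>a 0\<close>.\<close>
  have ab: "ennreal (\<bar>a 0 - a j\<bar> powr p) \<le> b" for j
  proof -
    interpret prob_space "uniform_measure M (E 0)" by (rule prob)
    have i: "integrable (uniform_measure M (E 0)) (\<lambda>x. u x - a j)" using intE[of 0] by simp
    have "a 0 - a j = (\<integral>x. u x - a j \<partial>uniform_measure M (E 0))"
      using intE[of 0] prob_space by (simp add: a_eq[of 0])
    then have "ennreal (\<bar>a 0 - a j\<bar> powr p) \<le> (\<integral>\<^sup>+x. ennreal (\<bar>u x - a j\<bar> powr p) \<partial>uniform_measure M (E 0))"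
      using jensen_powr[OF p i] by simp
    also have "\<dots> = (\<integral>\<^sup>+x\<in>E 0. ennreal (\<bar>u x - a j\<bar> powr p) \<partial>M) / emeasure M (E 0)"
      by (subst nn_integral_uniform_measure) auto
    also have "(\<integral>\<^sup>+x\<in>E 0. ennreal (\<bar>u x - a j\<bar> powr p) \<partial>M) \<le> (\<integral>\<^sup>+x\<in>E j. ennreal (\<bar>u x - a j\<bar> powr p) \<partial>M)"
      using E0[of j] by (intro nn_integral_mono) (auto split: split_indicator)
    also have "\<dots> \<le> c" unfolding a_def by (rule le)
    finally show ?thesis unfolding b_def by (simp add: divide_right_mono_ennreal)
  qed
  \<comment> \<open>Three terms: twice the 1 from \<open>t \<le> 1 + t powr p\<close>, the bound
    \<open>c\<close> around \<open>a j\<close>, and the bound \<open>b\<close> for moving the centre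
    to \<open>a 0\<close>.\<close>
  define B where "B = 2 * emeasure M ?S + c + b * emeasure M ?S"
  have B: "B < top"
    using b c fin by (auto simp: B_def ennreal_mult_less_top less_top[symmetric] ennreal_mult_eq_top_iff)
  have L1E: "(\<integral>\<^sup>+x\<in>E j. ennreal \<bar>u x - a 0\<bar> \<partial>M) \<le> B" for j
  proof -
    have pt: "ennreal \<bar>u x - a 0\<bar> \<le> 2 + ennreal (\<bar>u x - a j\<bar> powr p) + b" for x
    proof -
      have "\<bar>u x - a 0\<bar> \<le> \<bar>u x - a j\<bar> + \<bar>a 0 - a j\<bar>" by simp
      also have "\<dots> \<le> (1 + \<bar>u x - a j\<bar> powr p) + (1 + \<bar>a 0 - a j\<bar> powr p)"
        by (intro add_mono le_one_plus_powr p) auto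
      finally have "ennreal \<bar>u x - a 0\<bar> \<le> ennreal (2 + \<bar>u x - a j\<bar> powr p + \<bar>a 0 - a j\<bar> powr p)"
        by (intro ennreal_leI) simp
      also have "\<dots> = 2 + ennreal (\<bar>u x - a j\<bar> powr p) + ennreal (\<bar>a 0 - a j\<bar> powr p)"
        by (simp add: ennreal_plus)
      also have "\<dots> \<le> 2 + ennreal (\<bar>u x - a j\<bar> powr p) + b" by (intro add_mono ab) auto
      finally show ?thesis .
    qed
    have "(\<integral>\<^sup>+x\<in>E j. ennreal \<bar>u x - a 0\<bar> \<partial>M)
        \<le> (\<integral>\<^sup>+x. 2 * indicator (E j) x + ennreal (\<bar>u x - a j\<bar> powr p) * indicator (E j) x + b * indicator (E j) x \<partial>M)"
      using pt by (intro nn_integral_mono) (auto split: split_indicator)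
    also have "\<dots> = 2 * emeasure M (E j) + (\<integral>\<^sup>+x\<in>E j. ennreal (\<bar>u x - a j\<bar> powr p) \<partial>M) + b * emeasure M (E j)"
      by (simp add: nn_integral_add nn_integral_cmult)
    also have "\<dots> \<le> B" unfolding B_def
      using le[of j] by (intro add_mono mult_left_mono emeasure_mono) (auto simp: a_def)
    finally show ?thesis .
  qed
  have fatou: "(\<integral>\<^sup>+x\<in>?S. h x \<partial>M) \<le> D"
    if bound: "\<And>j. (\<integral>\<^sup>+x\<in>E j. hs j x \<partial>M) \<le> D" and lim: "\<And>x. (\<lambda>j. hs j x) \<longlonglongrightarrow> h x"
      and [measurable]: "\<And>j. hs j \<in> borel_measurable M"
    for h :: "'a \<Rightarrow> ennreal" and hs D
  proof -
    have "(\<integral>\<^sup>+x\<in>?S. h x \<partial>M) \<le> (\<integral>\<^sup>+x. liminf (\<lambda>j. hs j x * indicator (E j) x) \<partial>M)"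
    proof (rule nn_integral_mono)
      fix x
      show "h x * indicator ?S x \<le> liminf (\<lambda>j. hs j x * indicator (E j) x)"
      proof (cases "x \<in> ?S")
        case True
        then obtain i where i: "x \<in> E i" by auto
        have "x \<in> E j" if "i \<le> j" for j using inc i that by (auto simp: incseq_def)
        then have ev: "eventually (\<lambda>j. x \<in> E j) sequentially"
          unfolding eventually_sequentially by blast
        have "(\<lambda>j. hs j x * indicator (E j) x) \<longlonglongrightarrow> h x"
          by (rule Lim_transform_eventually[OF lim]) (use ev in eventually_elim, simp)
        then have "liminf (\<lambda>j. hs j x * indicator (E j) x) = h x" by (intro lim_imp_Liminf) auto
        then show ?thesis using True by simp
      qed simp
    qed
    also have "\<dots> \<le> liminf (\<lambda>j. \<integral>\<^sup>+x\<in>E j. hs j x \<partial>M)"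
      by (rule nn_integral_liminf) measurable
    also have "\<dots> \<le> liminf (\<lambda>j. D)"
      by (intro Liminf_mono always_eventually allI bound)
    finally show ?thesis by (simp add: Liminf_const)
  qed
  have L1S: "(\<integral>\<^sup>+x\<in>?S. ennreal \<bar>u x - a 0\<bar> \<partial>M) \<le> B"
    by (rule fatou[OF L1E]) auto
  interpret US: prob_space "uniform_measure M ?S"
    using posS fin by (intro prob_space_uniform_measure) auto
  have "integrable (uniform_measure M ?S) (\<lambda>x. u x - a 0)"
  proof (rule integrableI_bounded)
    show "(\<integral>\<^sup>+x. ennreal (norm (u x - a 0)) \<partial>uniform_measure M ?S) < \<infinity>"
      unfolding real_norm_def infinity_ennreal_def
      by (rule U[OF le_less_trans[OF L1S B] posS S]) measurable
  qed simp
  from Bochner_Integration.integrable_add[OF this US.integrable_const[of "a 0"]]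
  show int: "set_integrable M ?S u"
    using uniform_measure_integral(1)[OF u S posS fin] by simp
  define aS where "aS = (LINT x:?S|M. u x) / measure M ?S"
  \<comment> \<open>With \<open>u\<close> integrable on the union, numerators and denominators of
    the means both converge.\<close>
  have "(\<lambda>j. measure M (E j)) \<longlonglongrightarrow> measure M ?S"
    using fin by (intro Lim_measure_incseq inc) (auto simp: less_top)
  moreover have "measure M ?S \<noteq> 0" using posS fin by (simp add: emeasure_eq_ennreal_measure)
  ultimately have a_lim: "a \<longlonglongrightarrow> aS"
    unfolding a_def aS_def by (intro tendsto_divide set_integral_cont_up inc int E)
  have "(\<integral>\<^sup>+x\<in>?S. ennreal (\<bar>u x - aS\<bar> powr p) \<partial>M) \<le> c"
  proof (rule fatou[OF le])
    show "(\<lambda>j. ennreal (\<bar>u x - (LINT x:E j|M. u x) / measure M (E j)\<bar> powr p)) \<longlonglongrightarrow> ennreal (\<bar>u x - aS\<bar> powr p)" for x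
      using p a_lim[unfolded a_def]
      by (intro tendsto_ennrealI tendsto_powr2 tendsto_rabs tendsto_diff tendsto_const always_eventually) auto
  qed measurable
  then show "(\<integral>\<^sup>+x\<in>?S. ennreal (\<bar>u x - (LINT x:?S|M. u x) / measure M ?S\<bar> powr p) \<partial>M) \<le> c"
    by (simp only: aS_def)
qed

section \<open>Almost everywhere bounds from differentiation\<close>

lemma sets_compactin_Rtop:
  assumes I: "finite I" and K: "compactin (Rtop I) K"
  shows "K \<in> sets (lam I)"
proof -
  have "Hausdorff_space (Rtop I)" by (simp add: Rtop_def Hausdorff_space_product_topology)
  then have "closedin (Rtop I) K" using K by (rule compactin_imp_closedin)
  then have K': "K \<subseteq> topspace (Rtop I)" "openin (Rtop I) (topspace (Rtop I) - K)" by (auto simp: closedin_def)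
  have sp: "topspace (Rtop I) = space (lam I)" by (simp add: Rtop_def space_PiM)
  have "space (lam I) - (space (lam I) - K) \<in> sets (lam I)"
    using sets_openin_Rtop[OF I K'(2)] unfolding sp by (rule sets.compl_sets)
  then show ?thesis using K'(1) unfolding sp by (simp add: double_diff)
qed

lemma loc_int_of_open_cover:
  assumes I: "finite I" and op: "\<And>S. S \<in> \<S> \<Longrightarrow> openin (Rtop I) S"
    and f: "\<And>S. S \<in> \<S> \<Longrightarrow> set_integrable (leb I) S f"
  shows "loc_int I (\<Union>\<S>) f"
  unfolding loc_int_def
proof (intro allI impI)
  fix K assume K: "compactin (Rtop I) K \<and> K \<subseteq> \<Union>\<S>"
  then have Kc: "compactin (Rtop I) K" and K\<S>: "K \<subseteq> \<Union>\<S>" by simp_all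
  have "\<exists>\<F>. finite \<F> \<and> \<F> \<subseteq> \<S> \<and> K \<subseteq> \<Union>\<F>"
    using Kc[unfolded compactin_def, THEN conjunct2, rule_format, of \<S>] op K\<S> by simp
  then obtain \<F> where F: "finite \<F>" "\<F> \<subseteq> \<S>" "K \<subseteq> \<Union>\<F>" by (elim exE conjE)
  have leb: "sets (lam I) \<subseteq> sets (leb I)" by (auto simp: leb_def)
  have "set_integrable (leb I) (\<Union>S\<in>\<F>. S) f"
  proof (rule set_integrable_UN[OF F(1)])
    fix S assume "S \<in> \<F>"
    then have S: "S \<in> \<S>" using F(2) by (rule subsetD[rotated])
    show "set_integrable (leb I) S f" by (rule f[OF S])
    show "S \<in> sets (leb I)" by (rule subsetD[OF leb sets_openin_Rtop[OF I op[OF S]]])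
  qed
  then show "set_integrable (leb I) K f"
  proof (rule set_integrable_subset)
    show "K \<in> sets (leb I)" by (rule subsetD[OF leb sets_compactin_Rtop[OF I Kc]])
    show "K \<subseteq> (\<Union>S\<in>\<F>. S)" using F(3) by simp
  qed
qed

text \<open>Along any shrinking sequence the averages are at most \<open>d\<close>, hence so is the
  upper derivative, which is the function itself almost everywhere. Before that, \<open>h\<close>
  has to be replaced by a real locally integrable function \<open>r\<close>.\<close>

lemma AE_le_of_differentiates:
  assumes I: "finite I" and \<S>: "shape_basis I D \<S>" and \<T>: "\<T> \<subseteq> \<S>" "differentiates I D \<T>"
    and h[measurable]: "h \<in> borel_measurable (lam I)" and d: "d < top"
    and le: "\<And>S. S \<in> \<S> \<Longrightarrow> (\<integral>\<^sup>+x\<in>S. h x \<partial>lam I) \<le> d * emeasure (lam I) S"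
  shows "AE x in lam I. x \<in> D \<longrightarrow> h x \<le> d"
proof -
  have S: "openin (Rtop I) S" "S \<in> sets (lam I)" "emeasure (lam I) S \<noteq> 0" "emeasure (lam I) S \<noteq> top"
    if "S \<in> \<S>" for S
  proof -
    have "is_shape I S" using \<S> that by (simp add: shape_basis_def)
    then show "openin (Rtop I) S" "S \<in> sets (lam I)" "emeasure (lam I) S \<noteq> 0" "emeasure (lam I) S \<noteq> top"
      using is_shape_emeasure[OF I, of S] by (simp_all add: is_shape_def)
  qed
  have fin: "(\<integral>\<^sup>+x\<in>S. h x \<partial>lam I) < top" if "S \<in> \<S>" for S
  proof (rule le_less_trans[OF le[OF that]])
    have "emeasure (lam I) S < top" using S(4)[OF that] unfolding less_top .
    then show "d * emeasure (lam I) S < top" using d by (simp add: ennreal_mult_less_top)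
  qed
  obtain \<C> where C: "countable \<C>" "\<C> \<subseteq> \<S>" "\<Union>\<C> = \<Union>\<S>"
    by (rule Rtop_countable_subcover[OF I S(1)]) (assumption | rule that)+
  \<comment> \<open>The basis may be uncountable, so the null sets where \<open>h\<close> is
    infinite are collected over a countable subcover.\<close>
  have "AE x in lam I. \<forall>S\<in>\<C>. x \<in> S \<longrightarrow> h x \<noteq> top"
  proof (subst AE_ball_countable[OF C(1)], intro ballI)
    fix A assume "A \<in> \<C>"
    then have A: "A \<in> \<S>" using C by auto
    note [measurable] = S(2)[OF A]
    have "AE x in lam I. h x * indicator A x \<noteq> \<infinity>"
      using fin[OF A] by (intro nn_integral_PInf_AE) auto
    then show "AE x in lam I. x \<in> A \<longrightarrow> h x \<noteq> top"
      by eventually_elim (auto split: split_indicator_asm)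
  qed
  then have h_fin: "AE x in lam I. x \<in> D \<longrightarrow> h x \<noteq> top"
    by eventually_elim (use \<S> C(3) in \<open>auto simp: shape_basis_def\<close>)
  define r where "r x = enn2real (h x)" for x
  have r[measurable]: "r \<in> borel_measurable (lam I)" unfolding r_def by measurable
  have r_le: "(\<integral>\<^sup>+x. ennreal (indicator A x *\<^sub>R r x) \<partial>lam I) \<le> (\<integral>\<^sup>+x\<in>A. h x \<partial>lam I)" for A
    by (intro nn_integral_mono) (auto simp: r_def ennreal_enn2real_if split: split_indicator)
  have r_int: "set_integrable (lam I) A r" if A: "A \<in> \<S>" for A
    unfolding set_integrable_def
  proof (rule integrableI_bounded)
    note [measurable] = S(2)[OF A]
    show "(\<lambda>x. indicator A x *\<^sub>R r x) \<in> borel_measurable (lam I)" by measurable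
    have "norm (indicator A x *\<^sub>R r x) = indicator A x *\<^sub>R r x" for x by (simp add: r_def)
    then show "(\<integral>\<^sup>+x. ennreal (norm (indicator A x *\<^sub>R r x)) \<partial>lam I) < \<infinity>"
      using le_less_trans[OF r_le fin[OF A]] by simp
  qed
  have comp: "set_integrable (leb I) A r" "(LINT x:A|leb I. r x) = (LINT x:A|lam I. r x)" if A: "A \<in> \<S>" for A
    using set_integrable_completion_iff[OF r S(2)[OF A], of r] r_int[OF A] by (auto simp: leb_def)
  obtain d' where d': "d = ennreal d'" "0 \<le> d'" using d by (cases d) auto
  have avg_le: "avg I A r \<le> d'" if A: "A \<in> \<S>" for A
  proof -
    have m: "0 < measure (lam I) A" "emeasure (lam I) A = ennreal (measure (lam I) A)"
      using S(3,4)[OF A] by (auto simp: emeasure_eq_ennreal_measure zero_less_measure_iff)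
    have "ennreal (LINT x:A|lam I. r x) = (\<integral>\<^sup>+x. ennreal (indicator A x *\<^sub>R r x) \<partial>lam I)"
      unfolding set_lebesgue_integral_def
      using r_int[OF A] by (subst nn_integral_eq_integral) (auto simp: set_integrable_def r_def)
    also have "\<dots> \<le> ennreal (d' * measure (lam I) A)"
      using order_trans[OF r_le le[OF A]] d' m by (simp add: ennreal_mult)
    finally have "(LINT x:A|lam I. r x) \<le> d' * measure (lam I) A"
      using d' by (subst (asm) ennreal_le_iff) auto
    moreover have "measure (leb I) A = measure (lam I) A"
      using emeasure_leb[OF S(2)[OF A]] by (simp add: measure_def)
    ultimately show ?thesis
      using m by (simp add: avg_def comp(2)[OF A] field_simps)
  qed
  have "loc_int I (\<Union>\<S>) r" by (rule loc_int_of_open_cover[OF I S(1) comp(1)])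
  then have "loc_int I D r" using \<S> by (simp add: shape_basis_def)
  then have "AE x in leb I. x \<in> D \<longrightarrow> upper_deriv I \<T> r x = ereal (r x) \<and> lower_deriv I \<T> r x = ereal (r x)"
    using \<T>(2) unfolding differentiates_def by blast
  then have ae: "AE x in lam I. x \<in> D \<longrightarrow> upper_deriv I \<T> r x = ereal (r x) \<and> lower_deriv I \<T> r x = ereal (r x)"
    unfolding leb_def AE_completion_iff .
  have up: "upper_deriv I \<T> r x \<le> ereal d'" for x
    unfolding upper_deriv_def
  proof (rule SUP_least)
    fix Sk assume "Sk \<in> shrinking_seqs I \<T> x"
    then have "Sk j \<in> \<S>" for j using \<T>(1) by (auto simp: shrinking_seqs_def)
    then have "limsup (\<lambda>j. ereal (avg I (Sk j) r)) \<le> limsup (\<lambda>j. ereal d')"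
      by (intro Limsup_mono always_eventually allI) (simp add: avg_le)
    then show "limsup (\<lambda>j. ereal (avg I (Sk j) r)) \<le> ereal d'" by (simp add: Limsup_const)
  qed
  from ae h_fin show ?thesis
  proof eventually_elim
    case (elim x)
    show ?case
    proof
      assume x: "x \<in> D"
      then have "ereal (r x) \<le> ereal d'" using elim(1) up[of x] by simp
      then have "ennreal (r x) \<le> d" using d' by (simp add: ennreal_leI)
      then show "h x \<le> d" using elim(2) x by (simp add: r_def ennreal_enn2real_if)
    qed
  qed
qed

lemma indicator_PiE_fun_upd:
  assumes "j \<notin> J" "w \<in> extensional J"
  shows "indicator (PiE (insert j J) (C(j := B))) (w(j := x)) = indicator B x * (indicator (PiE J C) w :: ennreal)"
proof -
  have "w(j := x) \<in> PiE (insert j J) (C(j := B)) \<longleftrightarrow> x \<in> B \<and> w \<in> PiE J C"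
    using assms by (auto simp: PiE_iff extensional_def)
  then show ?thesis by (simp add: indicator_def)
qed

context product_bases begin

lemma measurable_upd:
  assumes "i < k"
  shows "(\<lambda>z. (fst z)(i := snd z)) \<in> N (others i) \<Otimes>\<^sub>M lam (blk m i) \<rightarrow>\<^sub>M N {..<k}"
proof -
  have "(\<lambda>z. (fst z)(i := snd z)) \<in> N (others i) \<Otimes>\<^sub>M lam (blk m i) \<rightarrow>\<^sub>M N (insert i (others i))"
    by measurable
  then show ?thesis unfolding insert_others[OF assms] .
qed

text \<open>Almost everywhere statements pull back along measure-preserving maps but need not push
  forward. Therefore the measurable inverse \<open>\<psi>\<close> of gluing is shown to preserve
  measure as well.\<close>

lemma AE_co_dom:
  assumes i: "i < k" and ae: "AE w in N (others i). w \<in> PiE (others i) \<Omega> \<longrightarrow> P (glue (others i) w)"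
  shows "AE y in leb (co_idx n m i). y \<in> co_dom n m k \<Omega> i \<longrightarrow> P y"
proof -
  let ?U = "\<Union>j\<in>others i. blk m j"
  define \<psi> where "\<psi> y = (\<lambda>j\<in>others i. restrict y (blk m j))" for y :: pt
  have \<psi>[measurable]: "\<psi> \<in> lam ?U \<rightarrow>\<^sub>M N (others i)"
    unfolding \<psi>_def[abs_def] by (intro measurable_restrict measurable_restrict_subset) auto
  have id: "\<psi> (glue (others i) w) = w" if w: "w \<in> space (N (others i))" for w
  proof
    fix j show "\<psi> (glue (others i) w) j = w j"
    proof (cases "j \<in> others i")
      case True
      then have "w j \<in> space (lam (blk m j))" using w by (simp add: space_PiM PiE_iff)
      with True show ?thesis by (simp add: \<psi>_def restrict_glue)
    next
      case False
      then show ?thesis using w by (auto simp: \<psi>_def space_PiM PiE_iff extensional_def)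
    qed
  qed
  have "distr (lam ?U) (N (others i)) \<psi> = distr (distr (N (others i)) (lam ?U) (glue (others i))) (N (others i)) \<psi>"
    by (subst distr_glue) auto
  also have "\<dots> = distr (N (others i)) (N (others i)) (\<lambda>w. \<psi> (glue (others i) w))"
    by (subst distr_distr) (auto simp: comp_def)
  also have "\<dots> = distr (N (others i)) (N (others i)) (\<lambda>w. w)"
    by (rule distr_cong) (auto simp: id)
  finally have d: "distr (lam ?U) (N (others i)) \<psi> = N (others i)" by (simp add: distr_id)
  have "AE w in distr (lam ?U) (N (others i)) \<psi>. w \<in> PiE (others i) \<Omega> \<longrightarrow> P (glue (others i) w)"
    unfolding d by (rule ae)
  then have "AE y in lam ?U. \<psi> y \<in> PiE (others i) \<Omega> \<longrightarrow> P (glue (others i) (\<psi> y))"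
    by (rule AE_distrD[rotated]) measurable
  then have "AE y in lam (co_idx n m i). \<psi> y \<in> PiE (others i) \<Omega> \<longrightarrow> P (glue (others i) (\<psi> y))"
    unfolding UN_others[OF i] .
  then show ?thesis
    unfolding leb_def AE_completion_iff
  proof eventually_elim
    case (elim y)
    show ?case
    proof
      assume y: "y \<in> co_dom n m k \<Omega> i"
      then have "\<psi> y \<in> PiE (others i) \<Omega>" by (auto simp: \<psi>_def co_dom_def)
      moreover have "glue (others i) (\<psi> y) = y"
      proof
        fix c show "glue (others i) (\<psi> y) c = y c"
        proof (cases "c \<in> ?U")
          case True
          then obtain j where j: "j \<in> others i" "c \<in> blk m j" by blast
          then show ?thesis unfolding glue_eq[OF j] by (simp add: \<psi>_def)
        next
          case False
          then have "c \<notin> co_idx n m i" unfolding UN_others[OF i] .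
          then show ?thesis using y unfolding glue_undefined[OF False]
            by (simp add: co_dom_def PiE_iff extensional_def)
        qed
      qed
      ultimately show "P y" using elim by simp
    qed
  qed
qed

end

text \<open>The assumption \<open>osc\<close> is where strong decomposition enters: shapes of the
  factors may be combined freely, so one of them can stay fixed while the others shrink.
  \<open>Q\<close> covers the general case and \<open>p = 2\<close> in one argument.\<close>

locale strong_product_bases = product_bases +
  fixes p Q K :: real and g :: "pt \<Rightarrow> real"
  assumes diff: "\<And>j. j < k \<Longrightarrow> \<exists>\<T>. \<T> \<subseteq> \<S>i j \<and> differentiates (blk m j) (\<Omega> j) \<T>"
    and p: "1 \<le> p" and Q: "Q = 2 \<or> p = 2 \<and> Q = 1" and K: "0 \<le> K"
    and g[measurable]: "g \<in> borel_measurable (lam {..<n})"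
    and osc: "\<And>A. (\<And>j. j < k \<Longrightarrow> A j \<in> \<S>i j) \<Longrightarrow> osc_le (uniform_measure (lam {..<n}) (prod_set n m k A)) p g K"
begin

text \<open>If \<open>sec i w\<close> is not integrable on \<open>E\<close>, the mean in \<open>sec_osc\<close> is the junk value \<open>0\<close>; but then
  \<open>sec_osc i E w\<close> is infinite as soon as \<open>E\<close> has finite measure.\<close>

definition "sec i w x = g (glue {..<k} (w(i := x)))"

definition "sec_osc i E w = (\<integral>\<^sup>+x\<in>E. ennreal (\<bar>sec i w x -
  (LINT x:E|lam (blk m i). sec i w x) / measure (lam (blk m i)) E\<bar> powr p) \<partial>lam (blk m i))"

definition "L = ennreal (Q powr p) * ennreal (K powr p)"

lemma L_finite: "L < top"
  by (simp add: L_def ennreal_mult_less_top)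

lemma measurable_sec_pair:
  assumes "i < k"
  shows "(\<lambda>z. sec i (fst z) (snd z)) \<in> borel_measurable (N (others i) \<Otimes>\<^sub>M lam (blk m i))"
  unfolding sec_def
  by (rule measurable_compose[OF measurable_upd[OF assms]]) measurable

lemma measurable_sec:
  assumes "i < k" "w \<in> space (N (others i))"
  shows "sec i w \<in> borel_measurable (lam (blk m i))"
  using measurable_Pair2[OF measurable_sec_pair[OF assms(1)] assms(2)] by simp

lemma measurable_sec_osc:
  assumes i: "i < k" and E[measurable]: "E \<in> sets (lam (blk m i))"
  shows "sec_osc i E \<in> borel_measurable (N (others i))"
proof -
  interpret sigma_finite_measure "lam (blk m i)" by (rule sigma_finite_lam) (rule fin)
  have [measurable]: "(\<lambda>(w, x). sec i w x) \<in> borel_measurable (N (others i) \<Otimes>\<^sub>M lam (blk m i))"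
    using measurable_sec_pair[OF i] by (simp add: case_prod_unfold)
  show ?thesis unfolding sec_osc_def[abs_def] set_lebesgue_integral_def by measurable
qed

text \<open>The centre \<open>a\<close> is the mean over the product shape, but only its
  independence of the point matters later, so it is left unspecified.\<close>

lemma osc_on_product:
  assumes A: "\<And>j. j < k \<Longrightarrow> A j \<in> \<S>i j"
  obtains a where "(\<integral>\<^sup>+v\<in>PiE {..<k} A. ennreal (\<bar>g (glue {..<k} v) - a\<bar> powr p) \<partial>N {..<k})
    \<le> ennreal (K powr p) * (\<Prod>j<k. emeasure (lam (blk m j)) (A j))"
proof -
  have Am: "A j \<in> sets (lam (blk m j))" if "j < k" for j using shape_i(1)[OF that A[OF that]] .
  have [measurable]: "PiE {..<k} A \<in> sets (N {..<k})" using Am by (intro sets_PiM_I_finite) auto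
  have em: "emeasure (N {..<k}) (PiE {..<k} A) = (\<Prod>j<k. emeasure (lam (blk m j)) (A j))"
    using Am by (intro emeasure_PiM) auto
  have pos: "emeasure (N {..<k}) (PiE {..<k} A) \<noteq> 0" "emeasure (N {..<k}) (PiE {..<k} A) \<noteq> top"
    unfolding em using shape_i(2,3)[OF _ A] by (auto simp: ennreal_prod_eq_top)
  have "osc_le (uniform_measure (lam {..<n}) (prod_set n m k A)) p g K"
    by (rule osc) (rule A)
  also have "uniform_measure (lam {..<n}) (prod_set n m k A)
      = distr (uniform_measure (N {..<k}) (PiE {..<k} A)) (lam {..<n}) (glue {..<k})"
    by (rule uniform_measure_prod_set) (rule Am)
  finally have "osc_le (uniform_measure (N {..<k}) (PiE {..<k} A)) p (\<lambda>v. g (glue {..<k} v)) K"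
    by (subst (asm) osc_le_distr) auto
  then obtain a where a: "(\<integral>\<^sup>+v. ennreal (\<bar>g (glue {..<k} v) - a\<bar> powr p) \<partial>uniform_measure (N {..<k}) (PiE {..<k} A))
      \<le> ennreal (K powr p)" unfolding osc_le_def by (elim conjE) (rule that)
  define X where "X = (\<integral>\<^sup>+v\<in>PiE {..<k} A. ennreal (\<bar>g (glue {..<k} v) - a\<bar> powr p) \<partial>N {..<k})"
  have "X / emeasure (N {..<k}) (PiE {..<k} A) \<le> ennreal (K powr p)"
    unfolding X_def using a by (subst (asm) nn_integral_uniform_measure) auto
  then have "X / emeasure (N {..<k}) (PiE {..<k} A) * emeasure (N {..<k}) (PiE {..<k} A)
      \<le> ennreal (K powr p) * emeasure (N {..<k}) (PiE {..<k} A)" by (rule mult_right_mono) simp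
  moreover have "X / emeasure (N {..<k}) (PiE {..<k} A) * emeasure (N {..<k}) (PiE {..<k} A) = X"
    unfolding mult.commute[of "X / _"] ennreal_times_divide mult.commute[of _ X] by (rule mult_divide_eq_ennreal[OF pos])
  ultimately have "X \<le> ennreal (K powr p) * (\<Prod>j<k. emeasure (lam (blk m j)) (A j))" by (simp only: em)
  then show thesis unfolding X_def by (rule that)
qed

text \<open>Integrated over a product of other shapes, the section oscillations are at most
  \<open>L\<close> times the size of \<open>S\<close> times the sizes of those shapes;
  \<open>AE_PiM_le\<close> then localises this to almost every \<open>w\<close>.\<close>

lemma sec_osc_bound:
  assumes i: "i < k" and S: "S \<in> \<S>i i"
    and E[measurable]: "E \<in> sets (lam (blk m i))" and ES: "E \<subseteq> S" and pos: "emeasure (lam (blk m i)) E \<noteq> 0"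
  shows "AE w in N (others i). w \<in> PiE (others i) \<Omega> \<longrightarrow> sec_osc i E w \<le> L * emeasure (lam (blk m i)) S"
proof (rule AE_PiM_le)
  let ?M = "lam (blk m i)"
  have S_fin: "emeasure ?M S < top" using shape_i(3)[OF i S] unfolding less_top .
  note [measurable] = shape_i(1)[OF i S]
  have E_fin: "emeasure ?M E \<noteq> top" using emeasure_mono[OF ES shape_i(1)[OF i S]] S_fin by (auto simp: top_unique)
  show "finite (others i)" by simp
  show "\<Omega> j \<in> sets (lam (blk m j))" if "j \<in> others i" for j using that sets_\<Omega> by simp
  show "B \<in> sets (lam (blk m j)) \<and> emeasure (lam (blk m j)) B < top" if "j \<in> others i" "B \<in> \<S>i j" for j B
    using shape_i(1,3)[of j B] that unfolding less_top by simp
  show "AE x in lam (blk m j). x \<in> \<Omega> j \<longrightarrow> h x \<le> d"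
    if j: "j \<in> others i" and h: "h \<in> borel_measurable (lam (blk m j))" and d: "d < top"
      and le: "\<And>B. B \<in> \<S>i j \<Longrightarrow> (\<integral>\<^sup>+x\<in>B. h x \<partial>lam (blk m j)) \<le> d * emeasure (lam (blk m j)) B" for j h d
  proof -
    have j': "j < k" using j by simp
    obtain \<T> where T: "\<T> \<subseteq> \<S>i j" "differentiates (blk m j) (\<Omega> j) \<T>" using diff[OF j'] by (elim exE conjE)
    show ?thesis by (rule AE_le_of_differentiates[OF fin basis_i[OF j'] T h d le])
  qed
  show "sec_osc i E \<in> borel_measurable (N (others i))" by (rule measurable_sec_osc[OF i E])
  show "L * emeasure ?M S < top" using L_finite S_fin by (simp add: ennreal_mult_less_top)
  fix B assume B: "\<And>j. j \<in> others i \<Longrightarrow> B j \<in> \<S>i j"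
  define A where "A = B(i := S)"
  have A: "A j \<in> \<S>i j" if "j < k" for j using B S that by (simp add: A_def)
  obtain a where a: "(\<integral>\<^sup>+v\<in>PiE {..<k} A. ennreal (\<bar>g (glue {..<k} v) - a\<bar> powr p) \<partial>N {..<k})
    \<le> ennreal (K powr p) * (\<Prod>j<k. emeasure (lam (blk m j)) (A j))"
    by (rule osc_on_product[OF A]) (assumption | rule that)+
  have Am: "PiE {..<k} A \<in> sets (N {..<k})" using shape_i(1)[OF _ A] by (intro sets_PiM_I_finite) auto
  have "(\<integral>\<^sup>+w\<in>PiE (others i) B. sec_osc i E w \<partial>N (others i))
      \<le> (\<integral>\<^sup>+w. ennreal (Q powr p) * (\<integral>\<^sup>+x. ennreal (\<bar>sec i w x - a\<bar> powr p) * indicator (PiE {..<k} A) (w(i := x)) \<partial>?M) \<partial>N (others i))"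
  proof (rule nn_integral_mono)
    fix w assume w: "w \<in> space (N (others i))"
    note [measurable] = measurable_sec[OF i w]
    \<comment> \<open>The mean over \<open>E\<close> is traded for \<open>a\<close> first; only with
      a fixed centre does enlarging \<open>E\<close> to \<open>S\<close> increase the
      integral.\<close>
    have "sec_osc i E w \<le> ennreal (Q powr p) * (\<integral>\<^sup>+x\<in>E. ennreal (\<bar>sec i w x - a\<bar> powr p) \<partial>?M)"
      unfolding sec_osc_def by (rule set_nn_integral_mean_le_const[OF p Q _ E pos E_fin]) measurable
    also have "\<dots> \<le> ennreal (Q powr p) * (\<integral>\<^sup>+x\<in>S. ennreal (\<bar>sec i w x - a\<bar> powr p) \<partial>?M)"
      using ES by (intro mult_left_mono nn_integral_mono) (auto split: split_indicator)
    finally have 1: "sec_osc i E w \<le> ennreal (Q powr p) * (\<integral>\<^sup>+x\<in>S. ennreal (\<bar>sec i w x - a\<bar> powr p) \<partial>?M)" .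
    have "w \<in> extensional (others i)" using w by (simp add: space_PiM PiE_iff)
    then have ind: "indicator (PiE {..<k} A) (w(i := x)) = indicator S x * (indicator (PiE (others i) B) w :: ennreal)" for x
      using indicator_PiE_fun_upd[of i "others i" w B S x] unfolding A_def insert_others[OF i] by simp
    have "(\<integral>\<^sup>+x. ennreal (\<bar>sec i w x - a\<bar> powr p) * indicator (PiE {..<k} A) (w(i := x)) \<partial>?M)
        = (\<integral>\<^sup>+x\<in>S. ennreal (\<bar>sec i w x - a\<bar> powr p) \<partial>?M) * indicator (PiE (others i) B) w"
      unfolding ind mult.assoc[symmetric] by (rule nn_integral_multc) measurable
    then show "sec_osc i E w * indicator (PiE (others i) B) w
        \<le> ennreal (Q powr p) * (\<integral>\<^sup>+x. ennreal (\<bar>sec i w x - a\<bar> powr p) * indicator (PiE {..<k} A) (w(i := x)) \<partial>?M)"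
      using mult_right_mono[OF 1] by (simp add: mult.assoc)
  qed
  also have "\<dots> = ennreal (Q powr p) * (\<integral>\<^sup>+w. \<integral>\<^sup>+x. ennreal (\<bar>sec i w x - a\<bar> powr p) * indicator (PiE {..<k} A) (w(i := x)) \<partial>?M \<partial>N (others i))"
  proof (rule nn_integral_cmult)
    interpret sigma_finite_measure ?M by (rule sigma_finite_lam) (rule fin)
    have "(\<lambda>z. ennreal (\<bar>sec i (fst z) (snd z) - a\<bar> powr p) * indicator (PiE {..<k} A) ((fst z)(i := snd z)))
        \<in> borel_measurable (N (others i) \<Otimes>\<^sub>M ?M)"
      using measurable_sec_pair[OF i] measurable_compose[OF measurable_upd[OF i] borel_measurable_indicator[OF Am]]
      by measurable
    then show "(\<lambda>w. \<integral>\<^sup>+x. ennreal (\<bar>sec i w x - a\<bar> powr p) * indicator (PiE {..<k} A) (w(i := x)) \<partial>?M)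
        \<in> borel_measurable (N (others i))"
      by (intro borel_measurable_nn_integral) (simp add: case_prod_unfold)
  qed
  also have "(\<integral>\<^sup>+w. \<integral>\<^sup>+x. ennreal (\<bar>sec i w x - a\<bar> powr p) * indicator (PiE {..<k} A) (w(i := x)) \<partial>?M \<partial>N (others i))
      = (\<integral>\<^sup>+v\<in>PiE {..<k} A. ennreal (\<bar>g (glue {..<k} v) - a\<bar> powr p) \<partial>N (insert i (others i)))"
    unfolding sec_def
  proof (rule product_nn_integral_insert[symmetric])
    have "(\<lambda>v. ennreal (\<bar>g (glue {..<k} v) - a\<bar> powr p) * indicator (PiE {..<k} A) v) \<in> borel_measurable (N {..<k})"
      using Am by measurable
    then show "(\<lambda>v. ennreal (\<bar>g (glue {..<k} v) - a\<bar> powr p) * indicator (PiE {..<k} A) v)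
        \<in> borel_measurable (N (insert i (others i)))" unfolding insert_others[OF i] .
  qed auto
  also have "ennreal (Q powr p) * \<dots> \<le> ennreal (Q powr p) * (ennreal (K powr p) * (\<Prod>j<k. emeasure (lam (blk m j)) (A j)))"
    unfolding insert_others[OF i] by (intro mult_left_mono a) simp
  also have "(\<Prod>j<k. emeasure (lam (blk m j)) (A j)) = emeasure ?M S * (\<Prod>j\<in>others i. emeasure (lam (blk m j)) (B j))"
  proof -
    have "(\<Prod>j<k. emeasure (lam (blk m j)) (A j))
        = emeasure (lam (blk m i)) (A i) * (\<Prod>j\<in>others i. emeasure (lam (blk m j)) (A j))"
      using i by (intro prod.remove) auto
    also have "(\<Prod>j\<in>others i. emeasure (lam (blk m j)) (A j)) = (\<Prod>j\<in>others i. emeasure (lam (blk m j)) (B j))"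
      by (intro prod.cong) (auto simp: A_def)
    finally show ?thesis by (simp add: A_def)
  qed
  finally show "(\<integral>\<^sup>+w\<in>PiE (others i) B. sec_osc i E w \<partial>N (others i))
      \<le> L * emeasure ?M S * (\<Prod>j\<in>others i. emeasure (lam (blk m j)) (B j))"
    by (simp only: L_def mult.assoc)
qed

text \<open>The set \<open>E\<close> ranges over a countable family, but the shapes \<open>S\<close> around it do not. The left-hand side
  of the bound does not depend on \<open>S\<close>, so a sequence of shapes realising the infimum of the
  right-hand sides is enough.\<close>

lemma sec_osc_all_shapes:
  assumes i: "i < k" and \<E>: "countable \<E>" "\<And>E. E \<in> \<E> \<Longrightarrow> E \<in> sets (lam (blk m i))"
  shows "AE w in N (others i). w \<in> PiE (others i) \<Omega> \<longrightarrow>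
    (\<forall>E\<in>\<E>. \<forall>S\<in>\<S>i i. E \<subseteq> S \<longrightarrow> emeasure (lam (blk m i)) E \<noteq> 0 \<longrightarrow> sec_osc i E w \<le> L * emeasure (lam (blk m i)) S)"
proof -
  let ?M = "lam (blk m i)"
  have one: "AE w in N (others i). w \<in> PiE (others i) \<Omega> \<longrightarrow>
      (\<forall>S\<in>\<S>i i. E \<subseteq> S \<longrightarrow> emeasure ?M E \<noteq> 0 \<longrightarrow> sec_osc i E w \<le> L * emeasure ?M S)" if E: "E \<in> \<E>" for E
  proof (cases "emeasure ?M E = 0 \<or> (\<forall>S\<in>\<S>i i. \<not> E \<subseteq> S)")
    case True
    then show ?thesis by (intro AE_I2) auto
  next
    case False
    define Z where "Z = (\<lambda>S. L * emeasure ?M S) ` {S \<in> \<S>i i. E \<subseteq> S}"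
    have "Z \<noteq> {}" using False by (auto simp: Z_def)
    from ennreal_Inf_countable_INF[OF this] obtain z :: "nat \<Rightarrow> ennreal"
      where z: "range z \<subseteq> Z" "Inf Z = (INF l. z l)" by blast
    have "AE w in N (others i). w \<in> PiE (others i) \<Omega> \<longrightarrow> sec_osc i E w \<le> z l" for l
    proof -
      have "z l \<in> Z" using z(1) by auto
      then obtain S where S: "S \<in> \<S>i i" "E \<subseteq> S" "z l = L * emeasure ?M S" by (auto simp: Z_def)
      show ?thesis unfolding S(3) using False by (intro sec_osc_bound i S(1,2) \<E>(2)[OF E]) auto
    qed
    then have "AE w in N (others i). \<forall>l. w \<in> PiE (others i) \<Omega> \<longrightarrow> sec_osc i E w \<le> z l"
      by (subst AE_all_countable) blast
    then show ?thesis
    proof eventually_elim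
      case (elim w)
      show ?case
      proof (intro impI ballI)
        fix S assume w: "w \<in> PiE (others i) \<Omega>" and S: "S \<in> \<S>i i" "E \<subseteq> S"
        have "sec_osc i E w \<le> Inf Z" unfolding z(2) using elim w by (intro INF_greatest) simp
        also have "\<dots> \<le> L * emeasure ?M S" using S by (intro Inf_lower) (simp add: Z_def)
        finally show "sec_osc i E w \<le> L * emeasure ?M S" .
      qed
    qed
  qed
  have "AE w in N (others i). \<forall>E\<in>\<E>. w \<in> PiE (others i) \<Omega> \<longrightarrow>
      (\<forall>S\<in>\<S>i i. E \<subseteq> S \<longrightarrow> emeasure ?M E \<noteq> 0 \<longrightarrow> sec_osc i E w \<le> L * emeasure ?M S)"
    using one by (subst AE_ball_countable[OF \<E>(1)]) simp
  then show ?thesis by eventually_elim simp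
qed

text \<open>The hypothesis concerns finite unions of rational boxes only. Those exhausting
  \<open>S\<close> share the bound \<open>L * emeasure (lam (blk m i)) S\<close>; after the limit,
  normalising by \<open>S\<close> leaves \<open>L\<close>, which is
  \<open>(Q * K) powr p\<close>.\<close>

lemma osc_le_section:
  assumes i: "i < k" and w: "w \<in> space (N (others i))" and S: "S \<in> \<S>i i"
    and le: "\<And>\<F>. finite \<F> \<Longrightarrow> \<F> \<subseteq> rat_boxes (blk m i) \<Longrightarrow> \<Union>\<F> \<subseteq> S \<Longrightarrow> emeasure (lam (blk m i)) (\<Union>\<F>) \<noteq> 0 \<Longrightarrow>
      sec_osc i (\<Union>\<F>) w \<le> L * emeasure (lam (blk m i)) S"
  shows "osc_le (uniform_measure (lam (blk m i)) S) p (sec i w) (Q * K)"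
proof -
  let ?M = "lam (blk m i)"
  note Sm[measurable] = shape_i(1)[OF i S]
  have "openin (Rtop (blk m i)) S" using basis_i[OF i] S by (simp add: shape_basis_def is_shape_def)
  then have S_eq: "S = \<Union>{C \<in> rat_boxes (blk m i). C \<subseteq> S}" by (rule openin_Rtop_eq_Union_boxes[OF fin])
  define \<C> where "\<C> = {C \<in> rat_boxes (blk m i). C \<subseteq> S}"
  have SC: "\<Union>\<C> = S" using S_eq unfolding \<C>_def by (rule sym)
  have C: "countable \<C>" unfolding \<C>_def by (rule countable_subset[OF Collect_subset countable_rat_boxes[OF fin]])
  have C_ne: "\<C> \<noteq> {}"
  proof
    assume "\<C> = {}"
    then have "S = {}" using SC by simp
    then show False using shape_i(2)[OF i S] by simp
  qed
  define F where "F j = from_nat_into \<C> ` {..j}" for j :: nat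
  have FC: "F j \<subseteq> \<C>" for j unfolding F_def using from_nat_into[OF C_ne] by auto
  have F: "finite (F j)" "F j \<subseteq> rat_boxes (blk m i)" "\<Union>(F j) \<subseteq> S" for j
    using FC[of j] by (auto simp: F_def \<C>_def)
  have UF: "(\<Union>j. \<Union>(F j)) = S"
  proof -
    have "(\<Union>j. F j) = from_nat_into \<C> ` UNIV" by (auto simp: F_def)
    also have "\<dots> = \<C>" by (rule range_from_nat_into[OF C_ne C])
    finally have "\<Union>(\<Union>j. F j) = S" by (simp only: SC)
    then show ?thesis by blast
  qed
  have Fm: "\<Union>(F j) \<in> sets ?M" for j
    using F(1,2)[of j] sets_rat_boxes[OF fin] by (intro sets.finite_Union) auto
  have inc: "incseq (\<lambda>j. \<Union>(F j))"
  proof (rule monoI)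
    fix a b :: nat assume "a \<le> b"
    then have "F a \<subseteq> F b" unfolding F_def by (intro image_mono) simp
    then show "\<Union>(F a) \<subseteq> \<Union>(F b)" by (rule Union_mono)
  qed
  have "(SUP j. emeasure ?M (\<Union>(F j))) = emeasure ?M S"
    using SUP_emeasure_incseq[of "\<lambda>j. \<Union>(F j)" ?M, OF _ inc] Fm by (simp add: UF image_subset_iff)
  then obtain j0 where j0: "emeasure ?M (\<Union>(F j0)) \<noteq> 0"
    using shape_i(2)[OF i S] by fastforce
  \<comment> \<open>The first unions may be null sets; the shift by \<open>j0\<close> starts the
    sequence at positive measure, as the exhaustion lemma demands.\<close>
  define E where "E j = \<Union>(F (j0 + j))" for j
  have E_inc: "incseq E" unfolding E_def by (intro monoI monoD[OF inc]) simp
  have UE: "(\<Union>j. E j) = S"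
  proof
    show "(\<Union>j. E j) \<subseteq> S" using F(3) by (auto simp: E_def)
    have "\<Union>(F j) \<subseteq> E j" for j unfolding E_def by (rule monoD[OF inc]) simp
    then show "S \<subseteq> (\<Union>j. E j)" unfolding UF[symmetric] by blast
  qed
  have pos: "emeasure ?M (E j) \<noteq> 0" for j
  proof -
    have "emeasure ?M (\<Union>(F j0)) \<le> emeasure ?M (E j)"
      unfolding E_def by (intro emeasure_mono monoD[OF inc] Fm) simp
    then show ?thesis using j0 by auto
  qed
  have S_fin: "emeasure ?M S < top" using shape_i(3)[OF i S] unfolding less_top .
  then have c: "L * emeasure ?M S < top" using L_finite by (simp add: ennreal_mult_less_top)
  have bound: "(\<integral>\<^sup>+x\<in>E j. ennreal (\<bar>sec i w x - (LINT x:E j|?M. sec i w x) / measure ?M (E j)\<bar> powr p) \<partial>?M)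
      \<le> L * emeasure ?M S" for j
    using le[OF F(1,2,3), of "j0 + j"] pos[of j] unfolding E_def sec_osc_def by simp
  have Em: "E j \<in> sets ?M" for j unfolding E_def by (rule Fm)
  have UE_fin: "emeasure ?M (\<Union>j. E j) \<noteq> top" unfolding UE by (rule shape_i(3)[OF i S])
  note ex = osc_bound_exhaustion[OF p measurable_sec[OF i w] Em E_inc pos[of 0] UE_fin c bound, unfolded UE]
  note um = uniform_measure_integral[OF measurable_sec[OF i w] Sm shape_i(2,3)[OF i S]]
  note [measurable] = measurable_sec[OF i w]
  have "(\<integral>\<^sup>+x. ennreal (\<bar>sec i w x - integral\<^sup>L (uniform_measure ?M S) (sec i w)\<bar> powr p) \<partial>uniform_measure ?M S)
      \<le> L * emeasure ?M S / emeasure ?M S"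
    unfolding um(2) using ex(2) by (subst nn_integral_uniform_measure) (auto intro: divide_right_mono_ennreal)
  also have "\<dots> = L" by (rule mult_divide_eq_ennreal[OF shape_i(2,3)[OF i S]])
  also have "L = ennreal ((Q * K) powr p)"
    using Q K by (auto simp: L_def powr_mult simp flip: ennreal_mult)
  finally show ?thesis unfolding osc_le_def um(1) using ex(1) by simp
qed

lemma osc_le_sections:
  assumes i: "i < k"
  shows "AE w in N (others i). w \<in> PiE (others i) \<Omega> \<longrightarrow>
    (\<forall>S\<in>\<S>i i. osc_le (uniform_measure (lam (blk m i)) S) p (sec i w) (Q * K))"
proof -
  define \<E> where "\<E> = Union ` {\<F>. finite \<F> \<and> \<F> \<subseteq> rat_boxes (blk m i)}"
  have E1: "countable \<E>"
    unfolding \<E>_def by (intro countable_image countable_Collect_finite_subset countable_rat_boxes fin)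
  have E2: "E \<in> sets (lam (blk m i))" if "E \<in> \<E>" for E
    using that sets_rat_boxes[OF fin] by (auto simp: \<E>_def intro!: sets.finite_Union)
  have "AE w in N (others i). w \<in> PiE (others i) \<Omega> \<longrightarrow>
    (\<forall>E\<in>\<E>. \<forall>S\<in>\<S>i i. E \<subseteq> S \<longrightarrow> emeasure (lam (blk m i)) E \<noteq> 0 \<longrightarrow> sec_osc i E w \<le> L * emeasure (lam (blk m i)) S)"
    by (rule sec_osc_all_shapes[OF i E1]) (rule E2)
  then show ?thesis
    using AE_space
  proof eventually_elim
    case (elim w)
    show ?case
    proof (intro impI ballI)
      fix S assume w: "w \<in> PiE (others i) \<Omega>" and S: "S \<in> \<S>i i"
      show "osc_le (uniform_measure (lam (blk m i)) S) p (sec i w) (Q * K)"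
      proof (rule osc_le_section[OF i elim(2) S])
        fix \<F> assume "finite \<F>" "\<F> \<subseteq> rat_boxes (blk m i)" "\<Union>\<F> \<subseteq> S" "emeasure (lam (blk m i)) (\<Union>\<F>) \<noteq> 0"
        then show "sec_osc i (\<Union>\<F>) w \<le> L * emeasure (lam (blk m i)) S"
          using elim(1) w S by (simp add: \<E>_def)
      qed
    qed
  qed
qed

end

context product_bases begin

text \<open>Local integrability belongs to the claim: a compact subset of the domain is covered by
  finitely many shapes, over each of which \<open>f\<close> is integrable.\<close>

lemma directional_of_BMO:
  assumes p: "1 \<le> p" and Q: "Q = 2 \<or> p = 2 \<and> Q = 1"
    and \<S>: "shape_basis {..<n} (prod_set n m k \<Omega>) \<S>"
    and strong: "strong_decomp n m k \<S> \<S>i"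
    and diff: "\<And>j. j < k \<Longrightarrow> \<exists>\<T>. \<T> \<subseteq> \<S>i j \<and> differentiates (blk m j) (\<Omega> j) \<T>"
    and f: "in_BMO {..<n} p \<S> f" and i: "i < k"
  shows "in_BMO_dir n m k \<Omega> p \<S>i i f \<and> BMO_dir_norm n m k \<Omega> p \<S>i i f \<le> Q * BMO_norm {..<n} p \<S> f"
proof -
  define K where "K = BMO_norm {..<n} p \<S> f"
  have S_ne: "\<S> \<noteq> {}" using \<S> prod_set_ne by (auto simp: shape_basis_def)
  have bmo: "bmo_bound {..<n} p \<S> f K" unfolding K_def by (rule bmo_bound_BMO_norm[OF f])
  have K: "0 \<le> K" by (rule bmo_bound_nonneg[OF S_ne bmo])
  have QK: "0 \<le> Q * K" using Q K by auto
  have op: "openin (Rtop {..<n}) S" if "S \<in> \<S>" for S using \<S> that by (simp add: shape_basis_def is_shape_def)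
  have US: "\<Union>\<S> = prod_set n m k \<Omega>" using \<S> by (simp add: shape_basis_def)
  have li: "loc_int {..<n} (prod_set n m k \<Omega>) f"
    unfolding US[symmetric] by (rule loc_int_of_open_cover) (use bmo op in \<open>auto simp: bmo_bound_def\<close>)
  have op\<Omega>: "openin (Rtop {..<n}) (prod_set n m k \<Omega>)"
    unfolding US[symmetric] by (rule openin_Union) (rule op)
  obtain g where g: "g \<in> borel_measurable (lam {..<n})"
    and fg: "AE x in lam {..<n}. x \<in> prod_set n m k \<Omega> \<longrightarrow> f x = g x"
    by (rule loc_int_borel_version[OF op\<Omega> li]) (rule that)
  have osc: "osc_le (uniform_measure (lam {..<n}) S) p g K" if "S \<in> \<S>" for S
    using bmo that unfolding bmo_bound_iff_osc_le[OF finite_lessThan \<S> g fg p K] by simp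
  interpret strong_product_bases k m \<Omega> \<S>i p Q K g
    by unfold_locales (use diff p Q K g osc strong in \<open>auto simp: strong_decomp_def\<close>)
  have "AE w in N (others i). w \<in> PiE (others i) \<Omega> \<longrightarrow> slice_norm m p \<S>i i f (glue (others i) w) \<le> ereal (Q * K)"
    using osc_le_sections[OF i] AE_slices[OF i fg] AE_space
  proof eventually_elim
    case (elim w)
    show ?case
    proof
      assume w: "w \<in> PiE (others i) \<Omega>"
      have ae: "AE x in lam (blk m i). x \<in> \<Omega> i \<longrightarrow> slice m i f (glue (others i) w) x = sec i w x"
        using elim(2) w unfolding slice_glue[OF i] sec_def by simp
      have "bmo_bound (blk m i) p (\<S>i i) (slice m i f (glue (others i) w)) (Q * K)"
        unfolding bmo_bound_iff_osc_le[OF fin basis_i[OF i] measurable_sec[OF i elim(3)] ae p QK]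
        using elim(1) w by simp
      then show "slice_norm m p \<S>i i f (glue (others i) w) \<le> ereal (Q * K)"
        using BMO_norm_le[OF \<S>i_ne[OF i]] by (auto simp: slice_norm_def in_BMO_def)
    qed
  qed
  from AE_co_dom[OF i this]
  have "dir_ess_sup n m k \<Omega> p \<S>i i f \<le> ereal (Q * K)"
    unfolding dir_ess_sup_def ess_sup_on_def by (intro Inf_lower) simp
  \<comment> \<open>The value minus infinity would be turned into 0 by \<open>real_of_ereal\<close>,
    which is still at most \<open>Q * K\<close>.\<close>
  then show ?thesis
    using li QK unfolding in_BMO_dir_def BMO_dir_norm_def K_def[symmetric]
    by (cases "dir_ess_sup n m k \<Omega> p \<S>i i f") auto
qed

end

theorem theorem8p3:
  fixes n k :: nat and m :: "nat \<Rightarrow> nat" and \<Omega> :: "nat \<Rightarrow> pt set"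
    and \<S> :: "pt set set" and \<S>i :: "nat \<Rightarrow> pt set set"
    and p :: real and f :: "pt \<Rightarrow> real"
  assumes "2 \<le> k" and "k \<le> n"
    and "\<forall>i<k. 1 \<le> m i \<and> m i \<le> n - 1"
    and "(\<Sum>i<k. m i) = n"
    and "\<forall>i<k. is_domain (blk m i) (\<Omega> i)"
    and "shape_basis {..<n} (prod_set n m k \<Omega>) \<S>"
    and "\<forall>i<k. shape_basis (blk m i) (\<Omega> i) (\<S>i i)"
    and "1 \<le> p"
  shows "(weak_decomp n m k \<S> \<S>i \<and> (\<forall>i<k. in_BMO_dir n m k \<Omega> p \<S>i i f) \<longrightarrow>
            in_BMO {..<n} p \<S> f \<and>
            BMO_norm {..<n} p \<S> f \<le> (\<Sum>i<k. BMO_dir_norm n m k \<Omega> p \<S>i i f))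
       \<and> (strong_decomp n m k \<S> \<S>i \<and>
          (\<forall>i<k. \<exists>\<T>. \<T> \<subseteq> \<S>i i \<and> diff_basis (blk m i) (\<Omega> i) \<T> \<and>
                       differentiates (blk m i) (\<Omega> i) \<T>) \<and>
          in_BMO {..<n} p \<S> f \<longrightarrow>
            (\<forall>i<k. in_BMO_dir n m k \<Omega> p \<S>i i f) \<and>
            Max ((\<lambda>i. BMO_dir_norm n m k \<Omega> p \<S>i i f) ` {..<k})
               \<le> 2 ^ (k - 1) * BMO_norm {..<n} p \<S> f \<and>
            (p = 2 \<longrightarrow> Max ((\<lambda>i. BMO_dir_norm n m k \<Omega> p \<S>i i f) ` {..<k})
               \<le> BMO_norm {..<n} p \<S> f))"
proof -
  interpret B: product_bases k m \<Omega> \<S>i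
    by unfold_locales (use assms(5,7) in \<open>auto simp: is_domain_def\<close>)
  have n: "B.n = n" using assms(4) by (simp add: B.n_def)
  have k: "0 < k" using assms(1) by simp
  have \<S>: "shape_basis {..<B.n} (prod_set B.n m k \<Omega>) \<S>" unfolding n by (rule assms(6))
  have \<S>_ne: "\<S> \<noteq> {}"
  proof
    assume "\<S> = {}"
    then have "prod_set B.n m k \<Omega> = {}" using \<S>[unfolded shape_basis_def, THEN conjunct2] by simp
    then show False using B.prod_set_ne by simp
  qed
  have Max_le: "Max (h ` {..<k}) \<le> C" if "\<And>i. i < k \<Longrightarrow> h i \<le> C" for h :: "nat \<Rightarrow> real" and C
    using that k by (intro Max.boundedI) auto
  show ?thesis
  proof (intro conjI impI)
    assume "weak_decomp n m k \<S> \<S>i \<and> (\<forall>i<k. in_BMO_dir n m k \<Omega> p \<S>i i f)"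
    then have "weak_decomp B.n m k \<S> \<S>i" "\<And>i. i < k \<Longrightarrow> in_BMO_dir B.n m k \<Omega> p \<S>i i f"
      by (simp_all add: n)
    from B.BMO_of_directional[OF assms(8) k \<S> this]
    show "in_BMO {..<n} p \<S> f" "BMO_norm {..<n} p \<S> f \<le> (\<Sum>i<k. BMO_dir_norm n m k \<Omega> p \<S>i i f)"
      unfolding n by auto
  next
    assume b: "strong_decomp n m k \<S> \<S>i \<and>
        (\<forall>i<k. \<exists>\<T>. \<T> \<subseteq> \<S>i i \<and> diff_basis (blk m i) (\<Omega> i) \<T> \<and> differentiates (blk m i) (\<Omega> i) \<T>) \<and>
        in_BMO {..<n} p \<S> f"
    have strong: "strong_decomp B.n m k \<S> \<S>i" and f: "in_BMO {..<B.n} p \<S> f" using b by (simp_all add: n)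
    have diff: "\<exists>\<T>. \<T> \<subseteq> \<S>i j \<and> differentiates (blk m j) (\<Omega> j) \<T>" if "j < k" for j using b that by blast
    have dir: "in_BMO_dir n m k \<Omega> p \<S>i i f" "BMO_dir_norm n m k \<Omega> p \<S>i i f \<le> Q * BMO_norm {..<n} p \<S> f"
      if "i < k" "Q = 2 \<or> p = 2 \<and> Q = 1" for i Q
      using B.directional_of_BMO[OF assms(8) that(2) \<S> strong diff f that(1)] unfolding n by auto
    show "\<forall>i<k. in_BMO_dir n m k \<Omega> p \<S>i i f" using dir(1)[of _ 2] by simp
    have K: "0 \<le> BMO_norm {..<n} p \<S> f"
      using bmo_bound_nonneg[OF \<S>_ne bmo_bound_BMO_norm[OF f]] by (simp add: n)
    \<comment> \<open>With at least two factors, the constant 2 is no larger than the stated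
      one.\<close>
    have "(2::real) ^ 1 \<le> 2 ^ (k - 1)" using assms(1) by (intro power_increasing) auto
    then have "2 * BMO_norm {..<n} p \<S> f \<le> 2 ^ (k - 1) * BMO_norm {..<n} p \<S> f"
      using K by (intro mult_right_mono) auto
    then have "BMO_dir_norm n m k \<Omega> p \<S>i i f \<le> 2 ^ (k - 1) * BMO_norm {..<n} p \<S> f" if "i < k" for i
      using dir(2)[OF that, of 2] by simp
    then show "Max ((\<lambda>i. BMO_dir_norm n m k \<Omega> p \<S>i i f) ` {..<k}) \<le> 2 ^ (k - 1) * BMO_norm {..<n} p \<S> f"
      by (rule Max_le)
    assume "p = 2"
    then show "Max ((\<lambda>i. BMO_dir_norm n m k \<Omega> p \<S>i i f) ` {..<k}) \<le> BMO_norm {..<n} p \<S> f"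
      using dir(2)[of _ 1] by (intro Max_le) simp
  qed
qed

end
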